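(* Let $n\ge 1$ be an integer and let $\mathcal{A}$ and $\mathcal{B}$ be two classes of objects in an abelian category $\mathcal{C}$. Then the following two conditions are equivalent: (a) $(\mathcal{A},\mathcal{B})$ is a left $n$-cotorsion pair in $\mathcal{C}$. (b) $\mathcal{A}=\bigcap_{i=1}^n{}^{\perp_i}\mathcal{B}$, and for any $C\in\mathcal{C}$ there is a short exact sequence $0\to K\to A\to C\to 0$ with $A\in\mathcal{A}$ and $K\in\mathcal{B}^\wedge_{n-1}$. Moreover, if (a) or (b) holds true, then $(\mathcal{A},\mathcal{B}^\wedge_{n-1})$ is a complete left cotorsion pair in $\mathcal{C}$.
   Context: $\mathrm{Ext}^i_{\mathcal{C}}$ denotes Yoneda Ext ($\mathcal{C}$ need not have enough projectives or injectives); $\mathrm{Ext}^i_{\mathcal{C}}(\mathcal{A},\mathcal{B})=0$ means $\mathrm{Ext}^i_{\mathcal{C}}(A,B)=0$ for all $A\in\mathcal{A}$, $B\in\mathcal{B}$. ${}^{\perp_i}\mathcal{B}=\{X:\mathrm{Ext}^i_{\mathcal{C}}(X,\mathcal{B})=0\}$. $\mathcal{B}^\wedge_m$ is the class of objects $C$ admitting an exact sequence $0\to B_m\to\cdots\to B_0\to C\to 0$ of length at most $m$ with all terms $B_k\in\mathcal{B}$ (i.e. $\mathcal{B}$-resolution dimension $\le m$). An $\mathcal{A}$-precover of $C$ is a morphism $f:A\to C$ with $A\in\mathcal{A}$ through which every morphism $A'\to C$ with $A'\in\mathcal{A}$ factors. Complete left cotorsion pair $(\mathcal{A},\mathcal{B})$: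 $\mathcal{A}={}^{\perp_1}\mathcal{B}$ and every object of $\mathcal{C}$ has an epic $\mathcal{A}$-precover with kernel in $\mathcal{B}$. Left $n$-cotorsion pair $(\mathcal{A},\mathcal{B})$: (1) $\mathcal{A}$ is closed under direct summands; (2) $\mathrm{Ext}^i_{\mathcal{C}}(\mathcal{A},\mathcal{B})=0$ for $1\le i\le n$; (3) for every $C\in\mathcal{C}$ there is a short exact sequence $0\to K\to A\to C\to 0$ with $A\in\mathcal{A}$ and $K\in\mathcal{B}^\wedge_{n-1}$. *)

theory Defs
  imports "HOL-Algebra.Group"
begin

section \<open>Abelian categories\<close>

text \<open>
  Objects and morphisms are the members of the carriers \<open>Obj\<close> and \<open>Arr\<close>; a class of objects is a
  subset of \<open>Obj\<close>. Composition is written in the applicative order and is only constrained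
  on composable pairs. \<open>Add\<close> and \<open>Zero X Y\<close> are the addition of parallel morphisms
  and the zero morphism from \<open>X\<close> to \<open>Y\<close>.
\<close>

record ('o, 'm) ab_cat =
  Obj :: "'o set"
  Arr :: "'m set"
  Dom :: "'m \<Rightarrow> 'o"
  Cod :: "'m \<Rightarrow> 'o"
  Id :: "'o \<Rightarrow> 'm"
  Comp :: "'m \<Rightarrow> 'm \<Rightarrow> 'm" (infixl "\<cdot>\<index>" 75)
  Add :: "'m \<Rightarrow> 'm \<Rightarrow> 'm"
  Zero :: "'o \<Rightarrow> 'o \<Rightarrow> 'm"

definition Hom :: "('o, 'm) ab_cat \<Rightarrow> 'o \<Rightarrow> 'o \<Rightarrow> 'm set" where
  "Hom C X Y = {f \<in> Arr C. Dom C f = X \<and> Cod C f = Y}"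

definition hom_group :: "('o, 'm) ab_cat \<Rightarrow> 'o \<Rightarrow> 'o \<Rightarrow> 'm monoid" where
  "hom_group C X Y = \<lparr>carrier = Hom C X Y, mult = Add C, one = Zero C X Y\<rparr>"

locale category =
  fixes C :: "('o, 'm) ab_cat"
  assumes Dom_in_Obj: "f \<in> Arr C \<Longrightarrow> Dom C f \<in> Obj C"
    and Cod_in_Obj: "f \<in> Arr C \<Longrightarrow> Cod C f \<in> Obj C"
    and Id_in_Hom: "X \<in> Obj C \<Longrightarrow> Id C X \<in> Hom C X X"
    and Comp_in_Hom: "\<lbrakk>f \<in> Hom C X Y; g \<in> Hom C Y Z\<rbrakk> \<Longrightarrow> g \<cdot>\<^bsub>C\<^esub> f \<in> Hom C X Z"
    and Comp_Id: "f \<in> Hom C X Y \<Longrightarrow> f \<cdot>\<^bsub>C\<^esub> Id C X = f"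
    and Id_Comp: "f \<in> Hom C X Y \<Longrightarrow> Id C Y \<cdot>\<^bsub>C\<^esub> f = f"
    and Comp_assoc: "\<lbrakk>f \<in> Hom C X Y; g \<in> Hom C Y Z; h \<in> Hom C Z W\<rbrakk>
      \<Longrightarrow> (h \<cdot>\<^bsub>C\<^esub> g) \<cdot>\<^bsub>C\<^esub> f = h \<cdot>\<^bsub>C\<^esub> (g \<cdot>\<^bsub>C\<^esub> f)"

locale preadditive_category = category +
  assumes hom_comm_group: "\<lbrakk>X \<in> Obj C; Y \<in> Obj C\<rbrakk> \<Longrightarrow> comm_group (hom_group C X Y)"
    and Comp_Add_left: "\<lbrakk>f \<in> Hom C X Y; g \<in> Hom C Y Z; g' \<in> Hom C Y Z\<rbrakk>
      \<Longrightarrow> Add C g g' \<cdot>\<^bsub>C\<^esub> f = Add C (g \<cdot>\<^bsub>C\<^esub> f) (g' \<cdot>\<^bsub>C\<^esub> f)"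
    and Comp_Add_right: "\<lbrakk>f \<in> Hom C X Y; f' \<in> Hom C X Y; g \<in> Hom C Y Z\<rbrakk>
      \<Longrightarrow> g \<cdot>\<^bsub>C\<^esub> Add C f f' = Add C (g \<cdot>\<^bsub>C\<^esub> f) (g \<cdot>\<^bsub>C\<^esub> f')"

definition zero_object :: "('o, 'm) ab_cat \<Rightarrow> 'o \<Rightarrow> bool" where
  "zero_object C Z \<longleftrightarrow> Z \<in> Obj C \<and>
    (\<forall>X \<in> Obj C. (\<exists>!f. f \<in> Hom C Z X) \<and> (\<exists>!f. f \<in> Hom C X Z))"

definition mono_arr :: "('o, 'm) ab_cat \<Rightarrow> 'm \<Rightarrow> bool" where
  "mono_arr C f \<longleftrightarrow> f \<in> Arr C \<and>
    (\<forall>X. \<forall>g \<in> Hom C X (Dom C f). \<forall>h \<in> Hom C X (Dom C f). f \<cdot>\<^bsub>C\<^esub> g = f \<cdot>\<^bsub>C\<^esub> h \<longrightarrow> g = h)"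

definition epi_arr :: "('o, 'm) ab_cat \<Rightarrow> 'm \<Rightarrow> bool" where
  "epi_arr C f \<longleftrightarrow> f \<in> Arr C \<and>
    (\<forall>Y. \<forall>g \<in> Hom C (Cod C f) Y. \<forall>h \<in> Hom C (Cod C f) Y. g \<cdot>\<^bsub>C\<^esub> f = h \<cdot>\<^bsub>C\<^esub> f \<longrightarrow> g = h)"

definition is_kernel :: "('o, 'm) ab_cat \<Rightarrow> 'm \<Rightarrow> 'm \<Rightarrow> bool" where
  "is_kernel C k f \<longleftrightarrow> f \<in> Arr C \<and> k \<in> Arr C \<and> Cod C k = Dom C f \<and>
    f \<cdot>\<^bsub>C\<^esub> k = Zero C (Dom C k) (Cod C f) \<and>
    (\<forall>X. \<forall>g \<in> Hom C X (Dom C f). f \<cdot>\<^bsub>C\<^esub> g = Zero C X (Cod C f) \<longrightarrow>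
      (\<exists>!u. u \<in> Hom C X (Dom C k) \<and> k \<cdot>\<^bsub>C\<^esub> u = g))"

definition is_cokernel :: "('o, 'm) ab_cat \<Rightarrow> 'm \<Rightarrow> 'm \<Rightarrow> bool" where
  "is_cokernel C c f \<longleftrightarrow> f \<in> Arr C \<and> c \<in> Arr C \<and> Dom C c = Cod C f \<and>
    c \<cdot>\<^bsub>C\<^esub> f = Zero C (Dom C f) (Cod C c) \<and>
    (\<forall>Y. \<forall>g \<in> Hom C (Cod C f) Y. g \<cdot>\<^bsub>C\<^esub> f = Zero C (Dom C f) Y \<longrightarrow>
      (\<exists>!u. u \<in> Hom C (Cod C c) Y \<and> u \<cdot>\<^bsub>C\<^esub> c = g))"

definition is_biproduct ::
    "('o, 'm) ab_cat \<Rightarrow> 'o \<Rightarrow> 'o \<Rightarrow> 'o \<Rightarrow> 'm \<Rightarrow> 'm \<Rightarrow> 'm \<Rightarrow> 'm \<Rightarrow> bool" where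
  "is_biproduct C X Y M i j p q \<longleftrightarrow>
    i \<in> Hom C X M \<and> j \<in> Hom C Y M \<and> p \<in> Hom C M X \<and> q \<in> Hom C M Y \<and>
    p \<cdot>\<^bsub>C\<^esub> i = Id C X \<and> q \<cdot>\<^bsub>C\<^esub> j = Id C Y \<and>
    q \<cdot>\<^bsub>C\<^esub> i = Zero C X Y \<and> p \<cdot>\<^bsub>C\<^esub> j = Zero C Y X \<and>
    Add C (i \<cdot>\<^bsub>C\<^esub> p) (j \<cdot>\<^bsub>C\<^esub> q) = Id C M"

locale abelian_category = preadditive_category +
  assumes ex_zero_object: "\<exists>Z. zero_object C Z"
    and ex_biproduct: "\<lbrakk>X \<in> Obj C; Y \<in> Obj C\<rbrakk> \<Longrightarrow> \<exists>M i j p q. is_biproduct C X Y M i j p q"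
    and ex_kernel: "f \<in> Arr C \<Longrightarrow> \<exists>k. is_kernel C k f"
    and ex_cokernel: "f \<in> Arr C \<Longrightarrow> \<exists>c. is_cokernel C c f"
    and mono_normal: "mono_arr C f \<Longrightarrow> \<exists>g. is_kernel C f g"
    and epi_normal: "epi_arr C f \<Longrightarrow> \<exists>g. is_cokernel C f g"


section \<open>Exact sequences\<close>

text \<open>The image is the kernel of the cokernel.\<close>

definition is_image :: "('o, 'm) ab_cat \<Rightarrow> 'm \<Rightarrow> 'm \<Rightarrow> bool" where
  "is_image C m f \<longleftrightarrow> (\<exists>c. is_cokernel C c f \<and> is_kernel C m c)"

definition exact_at :: "('o, 'm) ab_cat \<Rightarrow> 'm \<Rightarrow> 'm \<Rightarrow> bool" where
  "exact_at C f g \<longleftrightarrow> (\<exists>m. is_image C m f \<and> is_kernel C m g)"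

definition exact_seq :: "('o, 'm) ab_cat \<Rightarrow> 'm list \<Rightarrow> bool" where
  "exact_seq C fs \<longleftrightarrow> set fs \<subseteq> Arr C \<and>
    (\<forall>i. Suc i < length fs \<longrightarrow> exact_at C (fs ! i) (fs ! Suc i))"

text \<open>
  A nonempty list of morphisms \<open>[f\<^sub>0, \<dots>, f\<^sub>k]\<close>, in the order of the sequence from left to right,
  stands for \<open>0 \<rightarrow> Dom f\<^sub>0 \<rightarrow> \<dots> \<rightarrow> Cod f\<^sub>k \<rightarrow> 0\<close>.
\<close>

definition bounded_exact :: "('o, 'm) ab_cat \<Rightarrow> 'm list \<Rightarrow> bool" where
  "bounded_exact C fs \<longleftrightarrow> fs \<noteq> [] \<and>
    (\<exists>Z. zero_object C Z \<and>
      exact_seq C (Zero C Z (Dom C (hd fs)) # fs @ [Zero C (Cod C (last fs)) Z]))"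


section \<open>Yoneda Ext\<close>

text \<open>
  The members of \<open>extensions C n X Y\<close>, for \<open>n \<ge> 1\<close>, are the exact sequences
  \<open>0 \<rightarrow> Y \<rightarrow> E\<^sub>n \<rightarrow> \<dots> \<rightarrow> E\<^sub>1 \<rightarrow> X \<rightarrow> 0\<close>.
\<close>

definition extensions :: "('o, 'm) ab_cat \<Rightarrow> nat \<Rightarrow> 'o \<Rightarrow> 'o \<Rightarrow> 'm list set" where
  "extensions C n X Y = {fs. length fs = Suc n \<and> bounded_exact C fs \<and>
    Dom C (hd fs) = Y \<and> Cod C (last fs) = X}"

text \<open>Morphisms of extensions are the identity on both end terms.\<close>

definition extension_morphism ::
    "('o, 'm) ab_cat \<Rightarrow> nat \<Rightarrow> 'o \<Rightarrow> 'o \<Rightarrow> 'm list \<Rightarrow> 'm list \<Rightarrow> (nat \<Rightarrow> 'm) \<Rightarrow> bool" where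
  "extension_morphism C n X Y fs gs h \<longleftrightarrow>
    h 0 = Id C Y \<and> h (Suc n) = Id C X \<and>
    (\<forall>i \<le> n. h i \<in> Hom C (Dom C (fs ! i)) (Dom C (gs ! i)) \<and>
      h (Suc i) \<in> Hom C (Cod C (fs ! i)) (Cod C (gs ! i)) \<and>
      h (Suc i) \<cdot>\<^bsub>C\<^esub> (fs ! i) = (gs ! i) \<cdot>\<^bsub>C\<^esub> h i)"

definition extension_step ::
    "('o, 'm) ab_cat \<Rightarrow> nat \<Rightarrow> 'o \<Rightarrow> 'o \<Rightarrow> ('m list \<times> 'm list) set" where
  "extension_step C n X Y = {(fs, gs). fs \<in> extensions C n X Y \<and> gs \<in> extensions C n X Y \<and>
    (\<exists>h. extension_morphism C n X Y fs gs h)}"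

definition yoneda_equiv ::
    "('o, 'm) ab_cat \<Rightarrow> nat \<Rightarrow> 'o \<Rightarrow> 'o \<Rightarrow> ('m list \<times> 'm list) set" where
  "yoneda_equiv C n X Y = (extension_step C n X Y \<union> (extension_step C n X Y)\<inverse>)\<^sup>*"

definition Ext :: "('o, 'm) ab_cat \<Rightarrow> nat \<Rightarrow> 'o \<Rightarrow> 'o \<Rightarrow> 'm list set set" where
  "Ext C n X Y = extensions C n X Y // yoneda_equiv C n X Y"

text \<open>
  The zero of the Baer sum is the class of \<open>0 \<rightarrow> Y \<rightarrow> Y \<oplus> X \<rightarrow> X \<rightarrow> 0\<close> for \<open>n = 1\<close>, and of
  \<open>0 \<rightarrow> Y = Y \<rightarrow> 0 \<rightarrow> \<dots> \<rightarrow> 0 \<rightarrow> X = X \<rightarrow> 0\<close>, with \<open>n - 2\<close> middle zero terms, for \<open>n \<ge> 2\<close>.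
  These sequences depend on the choice of a biproduct or of a zero object; their class does not.
  Vanishing of the group only involves its set of elements and its zero, so the Baer sum
  itself is not introduced.
\<close>

definition trivial_extension ::
    "('o, 'm) ab_cat \<Rightarrow> nat \<Rightarrow> 'o \<Rightarrow> 'o \<Rightarrow> 'm list \<Rightarrow> bool" where
  "trivial_extension C n X Y fs \<longleftrightarrow>
    (if n = 1 then \<exists>M i j p q. is_biproduct C Y X M i j p q \<and> fs = [i, q]
     else \<exists>Z. zero_object C Z \<and>
       fs = Id C Y # map2 (Zero C) (Y # replicate (n - 2) Z) (replicate (n - 2) Z @ [X]) @ [Id C X])"

definition Ext_zero :: "('o, 'm) ab_cat \<Rightarrow> nat \<Rightarrow> 'o \<Rightarrow> 'o \<Rightarrow> 'm list set" where
  "Ext_zero C n X Y = yoneda_equiv C n X Y `` {fs. trivial_extension C n X Y fs}"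

definition Ext_vanishes :: "('o, 'm) ab_cat \<Rightarrow> nat \<Rightarrow> 'o \<Rightarrow> 'o \<Rightarrow> bool" where
  "Ext_vanishes C n X Y \<longleftrightarrow> Ext C n X Y = {Ext_zero C n X Y}"

definition left_perp :: "('o, 'm) ab_cat \<Rightarrow> nat \<Rightarrow> 'o set \<Rightarrow> 'o set" where
  "left_perp C i \<B> = {X \<in> Obj C. \<forall>Y \<in> \<B>. Ext_vanishes C i X Y}"


section \<open>Cotorsion pairs\<close>

text \<open>
  The sequence \<open>0 \<rightarrow> B\<^sub>k \<rightarrow> \<dots> \<rightarrow> B\<^sub>0 \<rightarrow> X \<rightarrow> 0\<close> has \<open>k + 1\<close> morphisms between its nonzero positions,
  and their domains are \<open>B\<^sub>k, \<dots>, B\<^sub>0\<close>.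
\<close>

definition resolution_class :: "('o, 'm) ab_cat \<Rightarrow> 'o set \<Rightarrow> nat \<Rightarrow> 'o set" where
  "resolution_class C \<B> m = {X \<in> Obj C. \<exists>k \<le> m. \<exists>fs. length fs = Suc k \<and> bounded_exact C fs \<and>
    Cod C (last fs) = X \<and> (\<forall>f \<in> set fs. Dom C f \<in> \<B>)}"

definition closed_under_direct_summands :: "('o, 'm) ab_cat \<Rightarrow> 'o set \<Rightarrow> bool" where
  "closed_under_direct_summands C \<A> \<longleftrightarrow>
    (\<forall>M \<in> \<A>. \<forall>X Y i j p q. is_biproduct C X Y M i j p q \<longrightarrow> X \<in> \<A>)"

definition has_approximations :: "('o, 'm) ab_cat \<Rightarrow> 'o set \<Rightarrow> 'o set \<Rightarrow> bool" where
  "has_approximations C \<A> \<K> \<longleftrightarrow>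
    (\<forall>X \<in> Obj C. \<exists>K \<in> \<K>. \<exists>A \<in> \<A>. \<exists>k \<in> Hom C K A. \<exists>f \<in> Hom C A X. bounded_exact C [k, f])"

definition precover :: "('o, 'm) ab_cat \<Rightarrow> 'o set \<Rightarrow> 'o \<Rightarrow> 'm \<Rightarrow> bool" where
  "precover C \<A> X f \<longleftrightarrow> f \<in> Arr C \<and> Dom C f \<in> \<A> \<and> Cod C f = X \<and>
    (\<forall>A' \<in> \<A>. \<forall>f' \<in> Hom C A' X. \<exists>g \<in> Hom C A' (Dom C f). f \<cdot>\<^bsub>C\<^esub> g = f')"

definition complete_left_cotorsion_pair :: "('o, 'm) ab_cat \<Rightarrow> 'o set \<Rightarrow> 'o set \<Rightarrow> bool" where
  "complete_left_cotorsion_pair C \<A> \<B> \<longleftrightarrow> \<A> = left_perp C 1 \<B> \<and>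
    (\<forall>X \<in> Obj C. \<exists>f k. precover C \<A> X f \<and> epi_arr C f \<and> is_kernel C k f \<and> Dom C k \<in> \<B>)"

definition left_n_cotorsion_pair ::
    "('o, 'm) ab_cat \<Rightarrow> nat \<Rightarrow> 'o set \<Rightarrow> 'o set \<Rightarrow> bool" where
  "left_n_cotorsion_pair C n \<A> \<B> \<longleftrightarrow>
    closed_under_direct_summands C \<A> \<and>
    (\<forall>i \<in> {1..n}. \<forall>A \<in> \<A>. \<forall>B \<in> \<B>. Ext_vanishes C i A B) \<and>
    has_approximations C \<A> (resolution_class C \<B> (n - 1))"

end

theory Submission
  imports Defs
begin

text \<open>
  If \<open>X\<close> lies in all \<open>\<^sup>\<bottom>\<^sup>i\<B>\<close>, \<open>1 \<le> i \<le> n\<close>, dimension shifting along a \<open>\<B>\<close>-resolution of \<open>K\<close> of length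
  at most \<open>n - 1\<close> gives \<open>Ext\<^sup>1(X, K) = 0\<close>, so the approximation \<open>0 \<rightarrow> K \<rightarrow> A \<rightarrow> X \<rightarrow> 0\<close> splits and
  \<open>X\<close> is a summand of \<open>A\<close>.

  Without enough projectives, the shift \<open>Ext\<^sup>n(X, B) = 0 = Ext\<^sup>n\<^sup>+\<^sup>1(X, K') \<Longrightarrow> Ext\<^sup>n(X, K) = 0\<close> for
  \<open>0 \<rightarrow> K' \<rightarrow> B \<rightarrow> K \<rightarrow> 0\<close> rests on a criterion that eliminates the zigzags of Yoneda equivalence: an
  extension \<open>S\<close> of \<open>X\<close> by \<open>Y\<close> is trivial iff some extension \<open>P\<close> of \<open>X\<close> of the same length maps to it over
  the identity of \<open>X\<close> and the zero morphism into \<open>Y\<close>. This property passes along a morphism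
  \<open>S' \<rightarrow> S\<close> in both directions. From \<open>P \<rightarrow> S\<close> one gets \<open>P' \<rightarrow> S'\<close> by a common refinement of \<open>P\<close>
  and \<open>S'\<close>, since after a further refinement the two resulting morphisms to \<open>S\<close> are homotopic.
\<close>

section \<open>Preadditive structure, kernels and cokernels\<close>

text \<open>Exact sequences are cut into short exact pieces because a pullback at the right end or a
  pushout at the left end then alters a single piece, and because the inductions run over the
  syzygies, which a list of morphisms hides. Syzygies are fixed only up to isomorphism, so one list
  may be the splice of several chains.

  In the criterion the left end of \<open>P\<close> is free. Hence the property passes forward along
  a morphism by mere composition. A link of a zigzag may also point backward, and
  \<open>P \<rightarrow> S\<close> has no reason to lift along \<open>S' \<rightarrow> S\<close>:
  the terms of \<open>P\<close> are not projective, so every lift along an epi has to be bought by a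
  refinement. Two morphisms over the identity differ by one over zero, which is where the homotopy
  starts.

  Conversely, a null extension and a trivial one are joined by a single roof. Once vanishing means
  that every chain is null, dimension shifting, splitting and lifting become pullback and pushout
  arguments on witnesses, in place of the long exact sequence. A resolution of length at most
  \<open>n - 1\<close> moves \<open>Ext\<close> from degree 1 to degree at most \<open>n\<close>;
  this is where the two bounds meet.\<close>

lemma Hom_iff: "f \<in> Hom C X Y \<longleftrightarrow> f \<in> Arr C \<and> Dom C f = X \<and> Cod C f = Y"
  by (simp add: Hom_def)

context abelian_category
begin

abbreviation comp (infixl "\<odot>" 75) where "g \<odot> f \<equiv> g \<cdot>\<^bsub>C\<^esub> f"

abbreviation add_arr (infixl "\<oplus>" 65) where "f \<oplus> g \<equiv> Add C f g"

lemma Id_simps [simp]: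
  assumes "X \<in> Obj C"
  shows "Id C X \<in> Arr C" "Dom C (Id C X) = X" "Cod C (Id C X) = X"
  using Id_in_Hom [OF assms] by (auto simp: Hom_iff)

lemma Comp_simps [simp]:
  assumes "f \<in> Arr C" "g \<in> Arr C" "Dom C g = Cod C f"
  shows "g \<odot> f \<in> Arr C" "Dom C (g \<odot> f) = Dom C f" "Cod C (g \<odot> f) = Cod C g"
  using Comp_in_Hom [of f "Dom C f" "Cod C f" g "Cod C g"] assms by (auto simp: Hom_iff)

lemmas Dom_Cod_in_Obj [simp] = Dom_in_Obj Cod_in_Obj

lemma Comp_Id' [simp]: "\<lbrakk>f \<in> Arr C; Dom C f = X\<rbrakk> \<Longrightarrow> f \<odot> Id C X = f"
  by (rule Comp_Id) (auto simp: Hom_iff)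

lemma Id_Comp' [simp]: "\<lbrakk>f \<in> Arr C; Cod C f = X\<rbrakk> \<Longrightarrow> Id C X \<odot> f = f"
  by (rule Id_Comp) (auto simp: Hom_iff)

lemma Comp_assoc' [simp]:
  "\<lbrakk>f \<in> Arr C; g \<in> Arr C; h \<in> Arr C; Dom C g = Cod C f; Dom C h = Cod C g\<rbrakk>
    \<Longrightarrow> (h \<odot> g) \<odot> f = h \<odot> (g \<odot> f)"
  by (rule Comp_assoc) (auto simp: Hom_iff)

lemma Comp_eq_reassoc:
  assumes "a \<odot> b = c" "x \<in> Arr C" "b \<in> Arr C" "a \<in> Arr C" "Dom C b = Cod C x" "Dom C a = Cod C b"
  shows "a \<odot> (b \<odot> x) = c \<odot> x"
  using assms by auto

section \<open>Additive calculus in the Hom groups\<close>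

definition neg where "neg f = inv\<^bsub>hom_group C (Dom C f) (Cod C f)\<^esub> f"

lemma Zero_in_Hom: "\<lbrakk>X \<in> Obj C; Y \<in> Obj C\<rbrakk> \<Longrightarrow> Zero C X Y \<in> Hom C X Y"
  using monoid.one_closed [of "hom_group C X Y"] hom_comm_group [of X Y]
  by (auto simp: hom_group_def comm_group_def group_def)

lemma Zero_simps [simp]:
  assumes "X \<in> Obj C" "Y \<in> Obj C"
  shows "Zero C X Y \<in> Arr C" "Dom C (Zero C X Y) = X" "Cod C (Zero C X Y) = Y"
  using Zero_in_Hom [OF assms] by (auto simp: Hom_iff)

lemma hom_ops:
  assumes "f \<in> Hom C X Y"
  shows "Zero C X Y \<oplus> f = f" "f \<oplus> Zero C X Y = f" "neg f \<in> Hom C X Y"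
    "f \<oplus> neg f = Zero C X Y" "neg f \<oplus> f = Zero C X Y"
    "g \<in> Hom C X Y \<Longrightarrow> f \<oplus> g \<in> Hom C X Y"
    "g \<in> Hom C X Y \<Longrightarrow> f \<oplus> g = g \<oplus> f"
    "\<lbrakk>g \<in> Hom C X Y; h \<in> Hom C X Y\<rbrakk> \<Longrightarrow> (f \<oplus> g) \<oplus> h = f \<oplus> (g \<oplus> h)"
proof -
  have XY: "X \<in> Obj C" "Y \<in> Obj C" "Dom C f = X" "Cod C f = Y"
    using assms by (auto simp: Hom_iff)
  interpret G: comm_group "hom_group C X Y"
    by (rule hom_comm_group) (use XY in auto)
  have [simp]: "carrier (hom_group C X Y) = Hom C X Y" "mult (hom_group C X Y) = Add C"
    "one (hom_group C X Y) = Zero C X Y"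
    by (auto simp: hom_group_def)
  show "Zero C X Y \<oplus> f = f" "f \<oplus> Zero C X Y = f" "neg f \<in> Hom C X Y"
    "f \<oplus> neg f = Zero C X Y" "neg f \<oplus> f = Zero C X Y"
    using G.l_one [of f] G.r_one [of f] G.inv_closed [of f] G.r_inv [of f] G.l_inv [of f] assms XY
    by (auto simp: neg_def)
  show "f \<oplus> g \<in> Hom C X Y" if "g \<in> Hom C X Y" using G.m_closed [of f g] assms that by simp
  show "f \<oplus> g = g \<oplus> f" if "g \<in> Hom C X Y" using G.m_comm [of f g] assms that by simp
  show "(f \<oplus> g) \<oplus> h = f \<oplus> (g \<oplus> h)" if "g \<in> Hom C X Y" "h \<in> Hom C X Y"
    using G.m_assoc [of f g h] assms that by simp
qed

lemma Add_simps [simp]: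
  assumes "f \<in> Arr C" "g \<in> Arr C" "Dom C f = Dom C g" "Cod C f = Cod C g"
  shows "f \<oplus> g \<in> Arr C" "Dom C (f \<oplus> g) = Dom C g" "Cod C (f \<oplus> g) = Cod C g"
  using hom_ops(6) [of f "Dom C g" "Cod C g" g] assms by (auto simp: Hom_iff)

lemma neg_simps [simp]:
  assumes "f \<in> Arr C"
  shows "neg f \<in> Arr C" "Dom C (neg f) = Dom C f" "Cod C (neg f) = Cod C f"
  using hom_ops(3) [of f] assms by (auto simp: Hom_iff)

lemma Add_Zero [simp]:
  "\<lbrakk>f \<in> Arr C; Dom C f = X; Cod C f = Y\<rbrakk> \<Longrightarrow> f \<oplus> Zero C X Y = f"
  "\<lbrakk>f \<in> Arr C; Dom C f = X; Cod C f = Y\<rbrakk> \<Longrightarrow> Zero C X Y \<oplus> f = f"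
  using hom_ops(1,2) [of f] by (auto simp: Hom_iff)

lemma Add_neg [simp]:
  "f \<in> Arr C \<Longrightarrow> f \<oplus> neg f = Zero C (Dom C f) (Cod C f)"
  "f \<in> Arr C \<Longrightarrow> neg f \<oplus> f = Zero C (Dom C f) (Cod C f)"
  using hom_ops(4,5) [of f] by (auto simp: Hom_iff)

lemma Add_assoc:
  "\<lbrakk>f \<in> Arr C; g \<in> Arr C; h \<in> Arr C; Dom C f = Dom C h; Cod C f = Cod C h; Dom C g = Dom C h; Cod C g = Cod C h\<rbrakk>
    \<Longrightarrow> (f \<oplus> g) \<oplus> h = f \<oplus> (g \<oplus> h)"
  using hom_ops(8) [of f "Dom C h" "Cod C h" g h] by (auto simp: Hom_iff)

lemma Comp_Add [simp]:
  "\<lbrakk>f \<in> Arr C; f' \<in> Arr C; g \<in> Arr C; Dom C f = Dom C f'; Cod C f = Cod C f'; Dom C g = Cod C f'\<rbrakk>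
    \<Longrightarrow> g \<odot> (f \<oplus> f') = g \<odot> f \<oplus> g \<odot> f'"
  by (rule Comp_Add_right) (auto simp: Hom_iff)

lemma Add_Comp [simp]:
  "\<lbrakk>g \<in> Arr C; g' \<in> Arr C; f \<in> Arr C; Dom C g = Dom C g'; Cod C g = Cod C g'; Dom C g' = Cod C f\<rbrakk>
    \<Longrightarrow> (g \<oplus> g') \<odot> f = g \<odot> f \<oplus> g' \<odot> f"
  by (rule Comp_Add_left) (auto simp: Hom_iff)

text \<open>Source of the rules for composing with zero: by bilinearity such a composite equals its
  own double.\<close>

lemma Add_idem_eq_Zero:
  assumes "f \<in> Arr C" "f \<oplus> f = f"
  shows "f = Zero C (Dom C f) (Cod C f)"
proof -
  have "f = f \<oplus> (f \<oplus> neg f)" using assms(1) by simp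
  also have "\<dots> = (f \<oplus> f) \<oplus> neg f" using assms(1) by (subst Add_assoc) auto
  finally show ?thesis using assms by simp
qed

lemma Comp_Zero [simp]:
  assumes "g \<in> Arr C" "Dom C g = Y" "X \<in> Obj C"
  shows "g \<odot> Zero C X Y = Zero C X (Cod C g)"
proof -
  have Y: "Y \<in> Obj C" using assms by auto
  have "g \<odot> Zero C X Y \<oplus> g \<odot> Zero C X Y = g \<odot> (Zero C X Y \<oplus> Zero C X Y)"
    using assms Y by (subst Comp_Add) auto
  then have "g \<odot> Zero C X Y \<oplus> g \<odot> Zero C X Y = g \<odot> Zero C X Y" using assms Y by simp
  from Add_idem_eq_Zero [OF _ this] show ?thesis using assms Y by simp
qed

lemma Zero_Comp [simp]:
  assumes "f \<in> Arr C" "Cod C f = Y" "Z \<in> Obj C"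
  shows "Zero C Y Z \<odot> f = Zero C (Dom C f) Z"
proof -
  have Y: "Y \<in> Obj C" using assms by auto
  have "Zero C Y Z \<odot> f \<oplus> Zero C Y Z \<odot> f = (Zero C Y Z \<oplus> Zero C Y Z) \<odot> f"
    using assms Y by (subst Add_Comp) auto
  then have "Zero C Y Z \<odot> f \<oplus> Zero C Y Z \<odot> f = Zero C Y Z \<odot> f" using assms Y by simp
  from Add_idem_eq_Zero [OF _ this] show ?thesis using assms Y by simp
qed

lemma Add_eq_Zero_imp:
  assumes "f \<in> Arr C" "g \<in> Arr C" "Dom C f = Dom C g" "Cod C f = Cod C g"
    and "f \<oplus> g = Zero C (Dom C g) (Cod C g)"
  shows "f = neg g"
proof -
  have "f = f \<oplus> (g \<oplus> neg g)" using assms(1-4) by simp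
  also have "\<dots> = (f \<oplus> g) \<oplus> neg g" using assms(1-4) by (subst Add_assoc) auto
  also have "\<dots> = neg g" using assms by simp
  finally show ?thesis .
qed

lemma Comp_neg [simp]:
  assumes "f \<in> Arr C" "g \<in> Arr C" "Dom C g = Cod C f"
  shows "g \<odot> neg f = neg (g \<odot> f)"
proof (rule Add_eq_Zero_imp)
  have "g \<odot> neg f \<oplus> g \<odot> f = g \<odot> (neg f \<oplus> f)" using assms by (subst Comp_Add) auto
  then show "g \<odot> neg f \<oplus> g \<odot> f = Zero C (Dom C (g \<odot> f)) (Cod C (g \<odot> f))" using assms by simp
qed (use assms in auto)

lemma neg_Comp [simp]:
  assumes "f \<in> Arr C" "g \<in> Arr C" "Dom C g = Cod C f"
  shows "neg g \<odot> f = neg (g \<odot> f)"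
proof (rule Add_eq_Zero_imp)
  have "neg g \<odot> f \<oplus> g \<odot> f = (neg g \<oplus> g) \<odot> f" using assms by (subst Add_Comp) auto
  then show "neg g \<odot> f \<oplus> g \<odot> f = Zero C (Dom C (g \<odot> f)) (Cod C (g \<odot> f))" using assms by simp
qed (use assms in auto)

lemma neg_neg [simp]:
  assumes "f \<in> Arr C" shows "neg (neg f) = f"
  by (rule sym, rule Add_eq_Zero_imp) (use assms in auto)

lemma neg_Zero [simp]:
  assumes "X \<in> Obj C" "Y \<in> Obj C" shows "neg (Zero C X Y) = Zero C X Y"
  by (rule sym, rule Add_eq_Zero_imp) (use assms in auto)

lemma Add_neg_eq_Zero_imp:
  assumes "f \<in> Arr C" "g \<in> Arr C" "Dom C f = Dom C g" "Cod C f = Cod C g"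
    and "f \<oplus> neg g = Zero C (Dom C g) (Cod C g)"
  shows "f = g"
  using Add_eq_Zero_imp [of f "neg g"] assms by simp

section \<open>Monomorphisms, epimorphisms, kernels and cokernels\<close>

lemma mono_arrI:
  assumes "f \<in> Arr C"
    and "\<And>X g. \<lbrakk>g \<in> Arr C; Dom C g = X; Cod C g = Dom C f; f \<odot> g = Zero C X (Cod C f)\<rbrakk>
      \<Longrightarrow> g = Zero C X (Dom C f)"
  shows "mono_arr C f"
  unfolding mono_arr_def
proof (intro conjI allI ballI impI)
  fix X g h assume g: "g \<in> Hom C X (Dom C f)" and h: "h \<in> Hom C X (Dom C f)" and eq: "f \<odot> g = f \<odot> h"
  have "f \<odot> (g \<oplus> neg h) = Zero C X (Cod C f)"
    using g h eq assms(1) by (auto simp: Hom_iff)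
  then have "g \<oplus> neg h = Zero C X (Dom C f)"
    using g h assms(1) by - (rule assms(2), auto simp: Hom_iff)
  then show "g = h" using g h assms(1) by - (rule Add_neg_eq_Zero_imp, auto simp: Hom_iff)
qed (fact assms(1))

lemma epi_arrI:
  assumes "f \<in> Arr C"
    and "\<And>Y g. \<lbrakk>g \<in> Arr C; Dom C g = Cod C f; Cod C g = Y; g \<odot> f = Zero C (Dom C f) Y\<rbrakk>
      \<Longrightarrow> g = Zero C (Cod C f) Y"
  shows "epi_arr C f"
  unfolding epi_arr_def
proof (intro conjI allI ballI impI)
  fix Y g h assume g: "g \<in> Hom C (Cod C f) Y" and h: "h \<in> Hom C (Cod C f) Y" and eq: "g \<odot> f = h \<odot> f"
  have "(g \<oplus> neg h) \<odot> f = Zero C (Dom C f) Y"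
    using g h eq assms(1) by (auto simp: Hom_iff)
  then have "g \<oplus> neg h = Zero C (Cod C f) Y"
    using g h assms(1) by - (rule assms(2), auto simp: Hom_iff)
  then show "g = h" using g h assms(1) by - (rule Add_neg_eq_Zero_imp, auto simp: Hom_iff)
qed (fact assms(1))

lemma mono_arrD:
  "\<lbrakk>mono_arr C f; f \<odot> g = f \<odot> h; g \<in> Arr C; h \<in> Arr C; Cod C g = Dom C f; Cod C h = Dom C f;
    Dom C g = Dom C h\<rbrakk> \<Longrightarrow> g = h"
  by (simp add: mono_arr_def Hom_def)

lemma epi_arrD:
  "\<lbrakk>epi_arr C f; g \<odot> f = h \<odot> f; g \<in> Arr C; h \<in> Arr C; Dom C g = Cod C f; Dom C h = Cod C f;
    Cod C g = Cod C h\<rbrakk> \<Longrightarrow> g = h"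
  by (simp add: epi_arr_def Hom_def)

lemma epi_arr_Comp:
  assumes "epi_arr C f" "epi_arr C g" "Dom C g = Cod C f"
  shows "epi_arr C (g \<odot> f)"
proof -
  have fg: "f \<in> Arr C" "g \<in> Arr C" using assms by (auto simp: epi_arr_def)
  show ?thesis
  proof (rule epi_arrI)
    fix Y h assume h: "h \<in> Arr C" "Dom C h = Cod C (g \<odot> f)" "Cod C h = Y"
      "h \<odot> (g \<odot> f) = Zero C (Dom C (g \<odot> f)) Y"
    have "h \<odot> g = Zero C (Dom C g) Y"
      by (rule epi_arrD [OF assms(1)]) (use h fg assms(3) in auto)
    then have "h = Zero C (Cod C g) Y"
      by - (rule epi_arrD [OF assms(2)], use h fg assms(3) in auto)
    then show "h = Zero C (Cod C (g \<odot> f)) Y" using fg assms(3) by simp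
  qed (use fg assms(3) in auto)
qed

lemma epi_arr_cancel:
  assumes "epi_arr C (g \<odot> f)" "f \<in> Arr C" "g \<in> Arr C" "Dom C g = Cod C f"
  shows "epi_arr C g"
proof (rule epi_arrI)
  fix Y h assume h: "h \<in> Arr C" "Dom C h = Cod C g" "Cod C h = Y" "h \<odot> g = Zero C (Dom C g) Y"
  have "h \<odot> (g \<odot> f) = Zero C (Dom C f) Y"
    using h assms by (metis Comp_assoc' Zero_Comp Cod_in_Obj)
  then show "h = Zero C (Cod C g) Y"
    by - (rule epi_arrD [OF assms(1)], use h assms in auto)
qed (fact assms(3))

lemma is_kernel_simps:
  assumes "is_kernel C k f"
  shows "f \<in> Arr C" "k \<in> Arr C" "Cod C k = Dom C f" "f \<odot> k = Zero C (Dom C k) (Cod C f)"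
  using assms by (auto simp: is_kernel_def)

lemma is_cokernel_simps:
  assumes "is_cokernel C c f"
  shows "f \<in> Arr C" "c \<in> Arr C" "Dom C c = Cod C f" "c \<odot> f = Zero C (Dom C f) (Cod C c)"
  using assms by (auto simp: is_cokernel_def)

lemma is_kernel_lift:
  assumes "is_kernel C k f" "g \<in> Arr C" "Cod C g = Dom C f" "f \<odot> g = Zero C (Dom C g) (Cod C f)"
  obtains u where "u \<in> Arr C" "Dom C u = Dom C g" "Cod C u = Dom C k" "k \<odot> u = g"
proof -
  have "g \<in> Hom C (Dom C g) (Dom C f)" using assms by (simp add: Hom_iff)
  then have "\<exists>!u. u \<in> Hom C (Dom C g) (Dom C k) \<and> k \<odot> u = g"
    using assms(1,4) unfolding is_kernel_def by blast
  then obtain u where "u \<in> Hom C (Dom C g) (Dom C k)" "k \<odot> u = g" by blast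
  then show ?thesis by (intro that) (simp_all add: Hom_iff)
qed

lemma is_cokernel_desc:
  assumes "is_cokernel C c f" "g \<in> Arr C" "Dom C g = Cod C f" "g \<odot> f = Zero C (Dom C f) (Cod C g)"
  obtains u where "u \<in> Arr C" "Dom C u = Cod C c" "Cod C u = Cod C g" "u \<odot> c = g"
proof -
  have "g \<in> Hom C (Cod C f) (Cod C g)" using assms by (simp add: Hom_iff)
  then have "\<exists>!u. u \<in> Hom C (Cod C c) (Cod C g) \<and> u \<odot> c = g"
    using assms(1,4) unfolding is_cokernel_def by blast
  then obtain u where "u \<in> Hom C (Cod C c) (Cod C g)" "u \<odot> c = g" by blast
  then show ?thesis by (intro that) (simp_all add: Hom_iff)
qed

lemma is_kernel_mono:
  assumes "is_kernel C k f" shows "mono_arr C k"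
proof (rule mono_arrI)
  note k = is_kernel_simps [OF assms]
  fix X g assume g: "g \<in> Arr C" "Dom C g = X" "Cod C g = Dom C k" "k \<odot> g = Zero C X (Cod C k)"
  have X: "X \<in> Obj C" using g by auto
  then have "Zero C X (Dom C f) \<in> Hom C X (Dom C f)" "f \<odot> Zero C X (Dom C f) = Zero C X (Cod C f)"
    using k by (simp_all add: Hom_iff)
  then have "\<exists>!u. u \<in> Hom C X (Dom C k) \<and> k \<odot> u = Zero C X (Dom C f)"
    using assms unfolding is_kernel_def by blast
  moreover have "g \<in> Hom C X (Dom C k)" "k \<odot> g = Zero C X (Dom C f)"
    "Zero C X (Dom C k) \<in> Hom C X (Dom C k)" "k \<odot> Zero C X (Dom C k) = Zero C X (Dom C f)"
    using g k X by (simp_all add: Hom_iff)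
  ultimately show "g = Zero C X (Dom C k)" by blast
qed (use is_kernel_simps [OF assms] in auto)

lemma is_cokernel_epi:
  assumes "is_cokernel C c f" shows "epi_arr C c"
proof (rule epi_arrI)
  note c = is_cokernel_simps [OF assms]
  fix Y g assume g: "g \<in> Arr C" "Dom C g = Cod C c" "Cod C g = Y" "g \<odot> c = Zero C (Dom C c) Y"
  have Y: "Y \<in> Obj C" using g by auto
  then have "Zero C (Cod C f) Y \<in> Hom C (Cod C f) Y" "Zero C (Cod C f) Y \<odot> f = Zero C (Dom C f) Y"
    using c by (simp_all add: Hom_iff)
  then have "\<exists>!u. u \<in> Hom C (Cod C c) Y \<and> u \<odot> c = Zero C (Cod C f) Y"
    using assms unfolding is_cokernel_def by blast
  moreover have "g \<in> Hom C (Cod C c) Y" "g \<odot> c = Zero C (Cod C f) Y"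
    "Zero C (Cod C c) Y \<in> Hom C (Cod C c) Y" "Zero C (Cod C c) Y \<odot> c = Zero C (Cod C f) Y"
    using g c Y by (simp_all add: Hom_iff)
  ultimately show "g = Zero C (Cod C c) Y" by blast
qed (use is_cokernel_simps [OF assms] in auto)

lemma is_kernelI:
  assumes "f \<in> Arr C" "mono_arr C k" "Cod C k = Dom C f" "f \<odot> k = Zero C (Dom C k) (Cod C f)"
    and "\<And>g. \<lbrakk>g \<in> Arr C; Cod C g = Dom C f; f \<odot> g = Zero C (Dom C g) (Cod C f)\<rbrakk>
      \<Longrightarrow> \<exists>u \<in> Arr C. Dom C u = Dom C g \<and> Cod C u = Dom C k \<and> k \<odot> u = g"
  shows "is_kernel C k f"
proof -
  have "\<exists>!u. u \<in> Hom C X (Dom C k) \<and> k \<odot> u = g"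
    if "g \<in> Hom C X (Dom C f)" "f \<odot> g = Zero C X (Cod C f)" for X g
  proof -
    from that obtain u where u: "u \<in> Arr C" "Dom C u = X" "Cod C u = Dom C k" "k \<odot> u = g"
      using assms(5) [of g] by (auto simp: Hom_iff)
    then show ?thesis
      using mono_arrD [OF assms(2)] by (auto simp: Hom_iff)
  qed
  then show ?thesis using assms(1-4) by (auto simp: is_kernel_def mono_arr_def)
qed

lemma is_cokernelI:
  assumes "f \<in> Arr C" "epi_arr C c" "Dom C c = Cod C f" "c \<odot> f = Zero C (Dom C f) (Cod C c)"
    and "\<And>g. \<lbrakk>g \<in> Arr C; Dom C g = Cod C f; g \<odot> f = Zero C (Dom C f) (Cod C g)\<rbrakk>
      \<Longrightarrow> \<exists>u \<in> Arr C. Dom C u = Cod C c \<and> Cod C u = Cod C g \<and> u \<odot> c = g"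
  shows "is_cokernel C c f"
proof -
  have "\<exists>!u. u \<in> Hom C (Cod C c) Y \<and> u \<odot> c = g"
    if "g \<in> Hom C (Cod C f) Y" "g \<odot> f = Zero C (Dom C f) Y" for Y g
  proof -
    from that obtain u where u: "u \<in> Arr C" "Dom C u = Cod C c" "Cod C u = Y" "u \<odot> c = g"
      using assms(5) [of g] by (auto simp: Hom_iff)
    then show ?thesis
      using epi_arrD [OF assms(2)] by (auto simp: Hom_iff)
  qed
  then show ?thesis using assms(1-4) by (auto simp: is_cokernel_def epi_arr_def)
qed

text \<open>Normality gives only that \<open>f\<close> is a cokernel of some \<open>g\<close>. This
  \<open>g\<close> factors through \<open>k\<close>, so whatever kills \<open>k\<close> also kills
  \<open>g\<close> and descends along \<open>f\<close>.\<close>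

lemma epi_is_cokernel_of_kernel:
  assumes "epi_arr C f" "is_kernel C k f"
  shows "is_cokernel C f k"
proof -
  obtain g where g: "is_cokernel C f g" using epi_normal [OF assms(1)] by blast
  note k = is_kernel_simps [OF assms(2)] and g' = is_cokernel_simps [OF g]
  obtain v where v: "v \<in> Arr C" "Dom C v = Dom C g" "Cod C v = Dom C k" "k \<odot> v = g"
    by (rule is_kernel_lift [OF assms(2), of g]) (use g' in auto)
  show ?thesis
  proof (rule is_cokernelI)
    fix h assume h: "h \<in> Arr C" "Dom C h = Cod C k" "h \<odot> k = Zero C (Dom C k) (Cod C h)"
    have "h \<odot> (k \<odot> v) = (h \<odot> k) \<odot> v" using h k v by (subst Comp_assoc') auto
    then have "h \<odot> g = Zero C (Dom C g) (Cod C h)" using h k v by simp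
    then show "\<exists>u\<in>Arr C. Dom C u = Cod C f \<and> Cod C u = Cod C h \<and> u \<odot> f = h"
      using is_cokernel_desc [OF g, of h] h k g' by metis
  qed (use assms k in auto)
qed

lemma mono_is_kernel_of_cokernel:
  assumes "mono_arr C k" "is_cokernel C f k"
  shows "is_kernel C k f"
proof -
  obtain g where g: "is_kernel C k g" using mono_normal [OF assms(1)] by blast
  note f = is_cokernel_simps [OF assms(2)] and g' = is_kernel_simps [OF g]
  obtain v where v: "v \<in> Arr C" "Dom C v = Cod C f" "Cod C v = Cod C g" "v \<odot> f = g"
    by (rule is_cokernel_desc [OF assms(2), of g]) (use g' in auto)
  show ?thesis
  proof (rule is_kernelI)
    fix h assume h: "h \<in> Arr C" "Cod C h = Dom C f" "f \<odot> h = Zero C (Dom C h) (Cod C f)"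
    have "(v \<odot> f) \<odot> h = v \<odot> (f \<odot> h)" using h f v by (subst Comp_assoc') auto
    then have "g \<odot> h = Zero C (Dom C h) (Cod C g)" using h f v by simp
    then show "\<exists>u\<in>Arr C. Dom C u = Dom C h \<and> Cod C u = Dom C k \<and> k \<odot> u = h"
      using is_kernel_lift [OF g, of h] h f g' by metis
  qed (use assms f in auto)
qed

section \<open>Short exact sequences\<close>

definition ses where "ses k f \<longleftrightarrow> is_kernel C k f \<and> is_cokernel C f k"

lemma ses_simps:
  assumes "ses k f"
  shows "f \<in> Arr C" "k \<in> Arr C" "Cod C k = Dom C f" "f \<odot> k = Zero C (Dom C k) (Cod C f)"
    "mono_arr C k" "epi_arr C f" "is_kernel C k f" "is_cokernel C f k"
  using assms is_kernel_simps is_kernel_mono is_cokernel_epi by (auto simp: ses_def)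

lemma epi_kernel_ses: "\<lbrakk>epi_arr C f; is_kernel C k f\<rbrakk> \<Longrightarrow> ses k f"
  using epi_is_cokernel_of_kernel by (auto simp: ses_def)

lemma mono_cokernel_ses: "\<lbrakk>mono_arr C k; is_cokernel C f k\<rbrakk> \<Longrightarrow> ses k f"
  using mono_is_kernel_of_cokernel by (auto simp: ses_def)

section \<open>Pullbacks and pushouts\<close>

lemma is_biproduct_simps:
  assumes "is_biproduct C X Y M i j p q"
  shows "i \<in> Arr C" "Dom C i = X" "Cod C i = M" "j \<in> Arr C" "Dom C j = Y" "Cod C j = M"
    "p \<in> Arr C" "Dom C p = M" "Cod C p = X" "q \<in> Arr C" "Dom C q = M" "Cod C q = Y"
    "p \<odot> i = Id C X" "q \<odot> j = Id C Y" "q \<odot> i = Zero C X Y" "p \<odot> j = Zero C Y X"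
    "i \<odot> p \<oplus> j \<odot> q = Id C M"
    "\<And>x. \<lbrakk>x \<in> Arr C; Cod C x = X\<rbrakk> \<Longrightarrow> p \<odot> (i \<odot> x) = x"
    "\<And>x. \<lbrakk>x \<in> Arr C; Cod C x = Y\<rbrakk> \<Longrightarrow> q \<odot> (j \<odot> x) = x"
    "\<And>x. \<lbrakk>x \<in> Arr C; Cod C x = X\<rbrakk> \<Longrightarrow> q \<odot> (i \<odot> x) = Zero C (Dom C x) Y"
    "\<And>x. \<lbrakk>x \<in> Arr C; Cod C x = Y\<rbrakk> \<Longrightarrow> p \<odot> (j \<odot> x) = Zero C (Dom C x) X"
    "X \<in> Obj C" "Y \<in> Obj C" "M \<in> Obj C"
proof -
  show b: "i \<in> Arr C" "Dom C i = X" "Cod C i = M" "j \<in> Arr C" "Dom C j = Y" "Cod C j = M"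
    "p \<in> Arr C" "Dom C p = M" "Cod C p = X" "q \<in> Arr C" "Dom C q = M" "Cod C q = Y"
    "p \<odot> i = Id C X" "q \<odot> j = Id C Y" "q \<odot> i = Zero C X Y" "p \<odot> j = Zero C Y X"
    "i \<odot> p \<oplus> j \<odot> q = Id C M"
    using assms by (simp_all add: is_biproduct_def Hom_iff)
  show o: "X \<in> Obj C" "Y \<in> Obj C" "M \<in> Obj C" using b by auto
  fix x assume x: "x \<in> Arr C"
  show "p \<odot> (i \<odot> x) = x" if "Cod C x = X"
    using Comp_eq_reassoc [OF b(13), of x] b x that by simp
  show "q \<odot> (j \<odot> x) = x" if "Cod C x = Y"
    using Comp_eq_reassoc [OF b(14), of x] b x that by simp
  show "q \<odot> (i \<odot> x) = Zero C (Dom C x) Y" if "Cod C x = X"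
    using Comp_eq_reassoc [OF b(15), of x] b x o that by simp
  show "p \<odot> (j \<odot> x) = Zero C (Dom C x) X" if "Cod C x = Y"
    using Comp_eq_reassoc [OF b(16), of x] b x o that by simp
qed

lemma is_biproduct_ext:
  assumes "is_biproduct C X Y M i j p q" "x \<in> Arr C" "y \<in> Arr C" "Dom C x = Dom C y"
    "Cod C x = M" "Cod C y = M" "p \<odot> x = p \<odot> y" "q \<odot> x = q \<odot> y"
  shows "x = y"
proof -
  note b = is_biproduct_simps [OF assms(1)]
  have "z = i \<odot> (p \<odot> z) \<oplus> j \<odot> (q \<odot> z)" if "z \<in> Arr C" "Cod C z = M" for z
    using arg_cong [OF b(17), of "\<lambda>t. t \<odot> z"] that b(1-12,22-24) by simp
  from this [of x] this [of y] show ?thesis using assms(2-) by simp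
qed

lemma is_biproduct_ext':
  assumes "is_biproduct C X Y M i j p q" "x \<in> Arr C" "y \<in> Arr C" "Cod C x = Cod C y"
    "Dom C x = M" "Dom C y = M" "x \<odot> i = y \<odot> i" "x \<odot> j = y \<odot> j"
  shows "x = y"
proof -
  note b = is_biproduct_simps [OF assms(1)]
  have "z = (z \<odot> i) \<odot> p \<oplus> (z \<odot> j) \<odot> q" if "z \<in> Arr C" "Dom C z = M" for z
    using arg_cong [OF b(17), of "\<lambda>t. z \<odot> t"] that b(1-12,22-24) by simp
  from this [of x] this [of y] show ?thesis using assms(2-) by simp
qed

text \<open>The pullback is the kernel \<open>m\<close> of the difference \<open>d\<close> of
  \<open>f q\<close> and \<open>\<alpha> p\<close> on a biproduct. Since \<open>d j = f\<close>, the
  map \<open>d\<close> is epi and therefore the cokernel of \<open>m\<close>; this is what makes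
  epis stable under pullback.\<close>

lemma pullback:
  assumes "\<alpha> \<in> Arr C" "epi_arr C f" "Cod C \<alpha> = Cod C f"
  obtains a s where "a \<in> Arr C" "s \<in> Arr C" "Dom C s = Dom C a" "Cod C a = Dom C \<alpha>"
    "Cod C s = Dom C f" "f \<odot> s = \<alpha> \<odot> a" "epi_arr C a"
    "\<forall>W. \<forall>g \<in> Hom C W (Dom C a). \<forall>h \<in> Hom C W (Dom C a). a \<odot> g = a \<odot> h \<and> s \<odot> g = s \<odot> h \<longrightarrow> g = h"
    "\<forall>W. \<forall>g \<in> Hom C W (Dom C \<alpha>). \<forall>h \<in> Hom C W (Dom C f). \<alpha> \<odot> g = f \<odot> h \<longrightarrow>
      (\<exists>w \<in> Hom C W (Dom C a). a \<odot> w = g \<and> s \<odot> w = h)"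
proof -
  have f: "f \<in> Arr C" using assms by (simp add: epi_arr_def)
  obtain M i j p q where B: "is_biproduct C (Dom C \<alpha>) (Dom C f) M i j p q"
    using ex_biproduct [of "Dom C \<alpha>" "Dom C f"] assms f by auto
  note b = is_biproduct_simps [OF B]
  define d where "d = f \<odot> q \<oplus> neg (\<alpha> \<odot> p)"
  have d: "d \<in> Arr C" "Dom C d = M" "Cod C d = Cod C f"
    using b(1-12,22-24) f assms by (auto simp: d_def)
  have dj: "d \<odot> j = f" using b f assms by (simp add: d_def)
  have "epi_arr C d" by (rule epi_arr_cancel [of d j]) (use dj assms d b in auto)
  moreover obtain m where m: "is_kernel C m d" using ex_kernel d by blast
  ultimately have dm: "is_cokernel C d m" by (rule epi_is_cokernel_of_kernel)
  note k = is_kernel_simps [OF m]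
  define a where "a = p \<odot> m"
  define s where "s = q \<odot> m"
  have as: "a \<in> Arr C" "s \<in> Arr C" "Dom C a = Dom C m" "Dom C s = Dom C m" "Cod C a = Dom C \<alpha>"
    "Cod C s = Dom C f"
    using k d b by (simp_all add: a_def s_def)
  have fs: "f \<odot> s = \<alpha> \<odot> a"
  proof (rule Add_neg_eq_Zero_imp)
    have "d \<odot> m = f \<odot> s \<oplus> neg (\<alpha> \<odot> a)"
      using k(2,3) d b(1-12,22-24) f assms by (simp add: d_def s_def a_def)
    then show "f \<odot> s \<oplus> neg (\<alpha> \<odot> a) = Zero C (Dom C (\<alpha> \<odot> a)) (Cod C (\<alpha> \<odot> a))"
      using k d as assms by simp
  qed (use as f assms in auto)
  have "epi_arr C a"
  proof (rule epi_arrI)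
    fix Y g assume g: "g \<in> Arr C" "Dom C g = Cod C a" "Cod C g = Y" "g \<odot> a = Zero C (Dom C a) Y"
    \<comment> \<open>A map \<open>g\<close> killing \<open>a\<close> gives \<open>g p\<close>
      killing \<open>m\<close>, which descends along \<open>d\<close>. Restricted along
      \<open>j\<close>, the descended map becomes \<open>w f\<close>, and it vanishes because
      \<open>p j\<close> does.\<close>
    obtain w where w: "w \<in> Arr C" "Dom C w = Cod C d" "Cod C w = Y" "w \<odot> d = g \<odot> p"
      by (rule is_cokernel_desc [OF dm, of "g \<odot> p"]) (use g b as d k in \<open>auto simp: a_def\<close>)
    have "w \<odot> f = w \<odot> (d \<odot> j)" by (simp add: dj)
    also have "\<dots> = (w \<odot> d) \<odot> j" using w(1-3) d b by simp
    also have "\<dots> = Zero C (Dom C f) Y" using w g as b by simp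
    finally have "w = Zero C (Cod C f) Y"
      by - (rule epi_arrD [OF assms(2)], use w d f g in auto)
    then have "g \<odot> p = Zero C M Y" using w d g f by auto
    then have "(g \<odot> p) \<odot> i = Zero C (Dom C \<alpha>) Y" using b g by auto
    then show "g = Zero C (Cod C a) Y" using b g as by simp
  qed (fact as)
  show ?thesis
  proof (rule that [of a s])
    show "\<forall>W. \<forall>g \<in> Hom C W (Dom C a). \<forall>h \<in> Hom C W (Dom C a). a \<odot> g = a \<odot> h \<and> s \<odot> g = s \<odot> h \<longrightarrow> g = h"
    proof (intro allI ballI impI, elim conjE)
      fix W g h assume "g \<in> Hom C W (Dom C a)" "h \<in> Hom C W (Dom C a)" "a \<odot> g = a \<odot> h"
        "s \<odot> g = s \<odot> h"
      then have g: "g \<in> Arr C" "h \<in> Arr C" "Dom C g = Dom C h" "Cod C g = Dom C a"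
        "Cod C h = Dom C a"
        "a \<odot> g = a \<odot> h" "s \<odot> g = s \<odot> h" by (simp_all add: Hom_iff)
      have "m \<odot> g = m \<odot> h"
        by (rule is_biproduct_ext [OF B]) (use g as k d b in \<open>auto simp: a_def s_def\<close>)
      then show "g = h" by (rule mono_arrD [OF is_kernel_mono [OF m]]) (use g as in auto)
    qed
    show "\<forall>W. \<forall>g \<in> Hom C W (Dom C \<alpha>). \<forall>h \<in> Hom C W (Dom C f). \<alpha> \<odot> g = f \<odot> h \<longrightarrow>
      (\<exists>w \<in> Hom C W (Dom C a). a \<odot> w = g \<and> s \<odot> w = h)"
    proof (intro allI ballI impI)
      fix W g h assume gh: "g \<in> Hom C W (Dom C \<alpha>)" "h \<in> Hom C W (Dom C f)" "\<alpha> \<odot> g = f \<odot> h"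
      then have g: "g \<in> Arr C" "h \<in> Arr C" "Dom C g = Dom C h" "Cod C g = Dom C \<alpha>"
        "Cod C h = Dom C f"
        "\<alpha> \<odot> g = f \<odot> h" by (simp_all add: Hom_iff)
      have "d \<odot> (i \<odot> g \<oplus> j \<odot> h) = Zero C (Dom C h) (Cod C f)"
        using b f assms g by (simp add: d_def)
      then obtain w where w: "w \<in> Arr C" "Dom C w = Dom C h" "Cod C w = Dom C m"
        "m \<odot> w = i \<odot> g \<oplus> j \<odot> h"
        using is_kernel_lift [OF m, of "i \<odot> g \<oplus> j \<odot> h"] d b g by auto
      have "a \<odot> w = g" "s \<odot> w = h"
        using w b k d g by (simp_all add: a_def s_def)
      then show "\<exists>w \<in> Hom C W (Dom C a). a \<odot> w = g \<and> s \<odot> w = h"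
        using w as gh by (intro bexI [of _ w]) (simp_all add: Hom_iff)
    qed
  qed (use as fs \<open>epi_arr C a\<close> in auto)
qed

text \<open>The kernel object does not change: the pair of the zero map and \<open>k\<close> is
  compatible and induces \<open>k'\<close>. This lets a chain keep all its pieces to the left of the
  one pulled back.\<close>

lemma pullback_ses:
  assumes "ses k f" "\<alpha> \<in> Arr C" "Cod C \<alpha> = Cod C f"
  obtains k' a s where "ses k' a" "s \<in> Arr C" "Dom C s = Dom C a" "Cod C a = Dom C \<alpha>"
    "Cod C s = Dom C f" "f \<odot> s = \<alpha> \<odot> a" "Dom C k' = Dom C k" "s \<odot> k' = k"
proof -
  note e = ses_simps [OF assms(1)]
  obtain a s where as: "a \<in> Arr C" "s \<in> Arr C" "Dom C s = Dom C a" "Cod C a = Dom C \<alpha>"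
    "Cod C s = Dom C f" "f \<odot> s = \<alpha> \<odot> a" "epi_arr C a"
    and ext: "\<forall>W. \<forall>g \<in> Hom C W (Dom C a). \<forall>h \<in> Hom C W (Dom C a). a \<odot> g = a \<odot> h \<and> s \<odot> g = s \<odot> h \<longrightarrow> g = h"
    and ex: "\<forall>W. \<forall>g \<in> Hom C W (Dom C \<alpha>). \<forall>h \<in> Hom C W (Dom C f). \<alpha> \<odot> g = f \<odot> h \<longrightarrow>
      (\<exists>w \<in> Hom C W (Dom C a). a \<odot> w = g \<and> s \<odot> w = h)"
    by (rule pullback [OF assms(2) e(6) assms(3)]) (rule that)
  have "\<exists>w \<in> Hom C (Dom C k) (Dom C a). a \<odot> w = Zero C (Dom C k) (Dom C \<alpha>) \<and> s \<odot> w = k"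
    by (rule ex [THEN spec, rule_format]) (use e assms in \<open>simp_all add: Hom_iff\<close>)
  then obtain k' where k': "k' \<in> Arr C" "Dom C k' = Dom C k" "Cod C k' = Dom C a"
    "a \<odot> k' = Zero C (Dom C k) (Dom C \<alpha>)" "s \<odot> k' = k"
    by (auto simp: Hom_iff)
  have "is_kernel C k' a"
  proof (rule is_kernelI)
    show "mono_arr C k'"
    proof (rule mono_arrI)
      fix X g assume g: "g \<in> Arr C" "Dom C g = X" "Cod C g = Dom C k'"
        "k' \<odot> g = Zero C X (Cod C k')"
      have X: "X \<in> Obj C" using g by auto
      have "k \<odot> g = s \<odot> (k' \<odot> g)" using Comp_eq_reassoc [OF k'(5), of g] g k' as by simp
      then have "k \<odot> g = Zero C X (Cod C k)" using g X k'(1-3) as(1-5) e by simp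
      then show "g = Zero C X (Dom C k')"
        by - (rule mono_arrD [OF e(5)], use g k' e in auto)
    qed (fact k')
  next
    fix g assume g: "g \<in> Arr C" "Cod C g = Dom C a" "a \<odot> g = Zero C (Dom C g) (Cod C a)"
    have "f \<odot> (s \<odot> g) = \<alpha> \<odot> (a \<odot> g)"
      using Comp_eq_reassoc [OF as(6), of g] g as e assms by simp
    then have "f \<odot> (s \<odot> g) = Zero C (Dom C g) (Cod C f)" using g as assms by simp
    then obtain w where w: "w \<in> Arr C" "Dom C w = Dom C g" "Cod C w = Dom C k" "k \<odot> w = s \<odot> g"
      using is_kernel_lift [OF e(7), of "s \<odot> g"] g as by auto
    have "a \<odot> (k' \<odot> w) = a \<odot> g" "s \<odot> (k' \<odot> w) = s \<odot> g"
      using Comp_eq_reassoc [OF k'(4), of w] Comp_eq_reassoc [OF k'(5), of w] w k' as g assms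
        by simp_all
    moreover have "k' \<odot> w \<in> Hom C (Dom C g) (Dom C a)" "g \<in> Hom C (Dom C g) (Dom C a)"
      using w k' as g by (simp_all add: Hom_iff)
    ultimately have "k' \<odot> w = g" using ext by blast
    then show "\<exists>u\<in>Arr C. Dom C u = Dom C g \<and> Cod C u = Dom C k' \<and> k' \<odot> u = g"
      using w k' by auto
  qed (use k' as in auto)
  then have "ses k' a" using as by (intro epi_kernel_ses)
  then show ?thesis by (rule that) (use as k' in auto)
qed

text \<open>The pushout is the cokernel \<open>c\<close> of the map \<open>m\<close> with components
  \<open>k\<close> and \<open>-u\<close>. As \<open>k\<close> is mono, so is \<open>m\<close>, which
  is then a kernel of \<open>c\<close>; this makes \<open>k'\<close> mono. Only the existence half
  of the universal property is recorded.\<close>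

lemma pushout_ses:
  assumes "ses k f" "u \<in> Arr C" "Dom C u = Dom C k"
  obtains k' f' v where "ses k' f'" "v \<in> Arr C" "Dom C v = Dom C f" "Cod C v = Dom C f'"
    "Dom C k' = Cod C u" "Cod C f' = Cod C f" "v \<odot> k = k' \<odot> u" "f' \<odot> v = f"
    "\<forall>W. \<forall>g \<in> Hom C (Dom C f) W. \<forall>h \<in> Hom C (Cod C u) W. g \<odot> k = h \<odot> u \<longrightarrow>
      (\<exists>w \<in> Hom C (Dom C f') W. w \<odot> v = g \<and> w \<odot> k' = h)"
proof -
  note e = ses_simps [OF assms(1)]
  obtain M i j p q where B: "is_biproduct C (Dom C f) (Cod C u) M i j p q"
    using ex_biproduct [of "Dom C f" "Cod C u"] assms e by auto
  note b = is_biproduct_simps [OF B]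
  define m where "m = i \<odot> k \<oplus> neg (j \<odot> u)"
  have m: "m \<in> Arr C" "Dom C m = Dom C k" "Cod C m = M"
    using b(1-12,22-24) e assms by (auto simp: m_def)
  have pm: "p \<odot> m = k" and qm: "q \<odot> m = neg u" using b e assms by (simp_all add: m_def)
  have monom: "mono_arr C m"
  proof (rule mono_arrI)
    fix X g assume g: "g \<in> Arr C" "Dom C g = X" "Cod C g = Dom C m" "m \<odot> g = Zero C X (Cod C m)"
    have X: "X \<in> Obj C" using g by auto
    have "k \<odot> g = p \<odot> (m \<odot> g)" using Comp_eq_reassoc [OF pm, of g] g m b by simp
    then have "k \<odot> g = Zero C X (Cod C k)" using g m b e X by auto
    then show "g = Zero C X (Dom C m)"
      by - (rule mono_arrD [OF e(5)], use g m e in auto)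
  qed (fact m)
  obtain c where c: "is_cokernel C c m" using ex_cokernel m by blast
  note c' = is_cokernel_simps [OF c] is_cokernel_epi [OF c]
  have mc: "is_kernel C m c" using mono_is_kernel_of_cokernel [OF monom c] .
  define v where "v = c \<odot> i"
  define k' where "k' = c \<odot> j"
  have vk: "v \<in> Arr C" "k' \<in> Arr C" "Dom C v = Dom C f" "Dom C k' = Cod C u" "Cod C v = Cod C c"
    "Cod C k' = Cod C c"
    using c' m b by (simp_all add: v_def k'_def)
  have vkku: "v \<odot> k = k' \<odot> u"
  proof (rule Add_neg_eq_Zero_imp)
    have "c \<odot> m = v \<odot> k \<oplus> neg (k' \<odot> u)"
      using c' m b(1-12,22-24) e assms by (simp add: m_def v_def k'_def)
    then show "v \<odot> k \<oplus> neg (k' \<odot> u) = Zero C (Dom C (k' \<odot> u)) (Cod C (k' \<odot> u))"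
      using c' m vk assms by simp
  qed (use vk e assms in auto)
  obtain f' where f': "f' \<in> Arr C" "Dom C f' = Cod C c" "Cod C f' = Cod C f" "f' \<odot> c = f \<odot> p"
  proof (rule is_cokernel_desc [OF c, of "f \<odot> p"])
    show "(f \<odot> p) \<odot> m = Zero C (Dom C m) (Cod C (f \<odot> p))" using b e m pm by simp
  qed (use b e m in auto)
  have f'v: "f' \<odot> v = f" using Comp_eq_reassoc [OF f'(4), of i] f' c' m b e by (simp add: v_def)
  have f'k': "f' \<odot> k' = Zero C (Cod C u) (Cod C f)"
    using Comp_eq_reassoc [OF f'(4), of j] f' c' m b e by (simp add: k'_def)
  have "mono_arr C k'"
  proof (rule mono_arrI)
    fix X g assume g: "g \<in> Arr C" "Dom C g = X" "Cod C g = Dom C k'" "k' \<odot> g = Zero C X (Cod C k')"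
    have X: "X \<in> Obj C" using g by auto
    \<comment> \<open>If \<open>k'\<close> kills \<open>g\<close>, then \<open>c\<close> kills
      \<open>j g\<close>, which factors through \<open>m\<close>. The first component of the
      factorization gives \<open>k w = 0\<close>, so \<open>w\<close> and with it \<open>g\<close>
      vanish.\<close>
    obtain w where w: "w \<in> Arr C" "Dom C w = X" "Cod C w = Dom C m" "m \<odot> w = j \<odot> g"
      by (rule is_kernel_lift [OF mc, of "j \<odot> g"]) (use g c' m b vk in \<open>auto simp: k'_def\<close>)
    have "k \<odot> w = p \<odot> (m \<odot> w)" using Comp_eq_reassoc [OF pm, of w] w m b by simp
    also have "\<dots> = Zero C X (Cod C k)" using w b g vk e by simp
    finally have "w = Zero C X (Dom C k)"
      by - (rule mono_arrD [OF e(5)], use w m e X in auto)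
    then have "j \<odot> g = Zero C X M" using w m X by auto
    then have "q \<odot> (j \<odot> g) = Zero C X (Cod C u)" using b X by simp
    then show "g = Zero C X (Dom C k')" using b g vk by simp
  qed (fact vk)
  moreover have "is_cokernel C f' k'"
  proof (rule is_cokernelI)
    have "epi_arr C (f' \<odot> v)" using e f'v by simp
    then show "epi_arr C f'" by (rule epi_arr_cancel) (use vk f' in auto)
  next
    fix g assume g: "g \<in> Arr C" "Dom C g = Cod C k'" "g \<odot> k' = Zero C (Dom C k') (Cod C g)"
    have "g \<odot> (k' \<odot> u) = Zero C (Dom C k) (Cod C g)"
      using Comp_eq_reassoc [OF g(3), of u] g vk assms by simp
    then have "(g \<odot> v) \<odot> k = Zero C (Dom C k) (Cod C g)" using g vk vkku e by simp
    then obtain w where w: "w \<in> Arr C" "Dom C w = Cod C f" "Cod C w = Cod C g" "w \<odot> f = g \<odot> v"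
      using is_cokernel_desc [OF e(8), of "g \<odot> v"] g vk e by auto
    have wf: "w \<odot> f' \<in> Arr C" "Dom C (w \<odot> f') = Cod C c" "Cod C (w \<odot> f') = Cod C g"
      using w f' by auto
    \<comment> \<open>Equality is tested on the two summands before the epi \<open>c\<close> is
      cancelled.\<close>
    have "(w \<odot> f') \<odot> c = g \<odot> c"
    proof (rule is_biproduct_ext' [OF B])
      show "((w \<odot> f') \<odot> c) \<odot> i = (g \<odot> c) \<odot> i"
        using w f' c' m b e g vk f'v by (simp add: v_def)
      show "((w \<odot> f') \<odot> c) \<odot> j = (g \<odot> c) \<odot> j"
        using w f' c' m b e g vk f'k' by (simp add: k'_def)
    qed (use wf c' m g vk in \<open>simp_all del: Comp_assoc'\<close>)
    then have "w \<odot> f' = g" by (rule epi_arrD [OF c'(5)]) (use wf c' g vk in auto)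
    then show "\<exists>u\<in>Arr C. Dom C u = Cod C f' \<and> Cod C u = Cod C g \<and> u \<odot> f' = g"
      using w f' by auto
  qed (use f' vk f'k' in auto)
  ultimately have "ses k' f'" by (rule mono_cokernel_ses)
  then show ?thesis
  proof (rule that [of k' f' v])
    show "\<forall>W. \<forall>g \<in> Hom C (Dom C f) W. \<forall>h \<in> Hom C (Cod C u) W. g \<odot> k = h \<odot> u \<longrightarrow>
      (\<exists>w \<in> Hom C (Dom C f') W. w \<odot> v = g \<and> w \<odot> k' = h)"
    proof (intro allI ballI impI)
      fix W g h assume gh: "g \<in> Hom C (Dom C f) W" "h \<in> Hom C (Cod C u) W" "g \<odot> k = h \<odot> u"
      then have g: "g \<in> Arr C" "h \<in> Arr C" "Cod C g = Cod C h" "Dom C g = Dom C f"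
        "Dom C h = Cod C u"
        "g \<odot> k = h \<odot> u" by (simp_all add: Hom_iff)
      have "(g \<odot> p \<oplus> h \<odot> q) \<odot> m = Zero C (Dom C m) (Cod C h)"
        using g b m assms e pm qm by simp
      then obtain w where w: "w \<in> Arr C" "Dom C w = Cod C c" "Cod C w = Cod C h"
        "w \<odot> c = g \<odot> p \<oplus> h \<odot> q"
        using is_cokernel_desc [OF c, of "g \<odot> p \<oplus> h \<odot> q"] g b m by auto
      have "w \<odot> v = g" "w \<odot> k' = h"
        using Comp_eq_reassoc [OF w(4), of i] Comp_eq_reassoc [OF w(4), of j] w c' m b g
        by (simp_all add: v_def k'_def)
      then show "\<exists>w \<in> Hom C (Dom C f') W. w \<odot> v = g \<and> w \<odot> k' = h"
        using w f' gh by (auto simp: Hom_iff)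
    qed
  qed (use vk f' vkku f'v in auto)
qed

section \<open>Yoneda composites of short exact sequences\<close>

text \<open>
  Lists are read from the right end of the extension: \<open>(k\<^sub>1, f\<^sub>1)\<close> is the short exact sequence ending in
  \<open>X\<close>, and \<open>(k\<^sub>2, f\<^sub>2)\<close> ends in the kernel object of \<open>f\<^sub>1\<close>. In \<open>chain_mor \<alpha> S S' \<beta>\<close> the morphism \<open>\<alpha>\<close> acts
  on the right ends and \<open>\<beta>\<close> on the left ends.
\<close>

fun ses_chain where
  "ses_chain X [] Y \<longleftrightarrow> X \<in> Obj C \<and> X = Y"
| "ses_chain X ((k, f) # S) Y \<longleftrightarrow> ses k f \<and> Cod C f = X \<and> ses_chain (Dom C k) S Y"

fun chain_mor where
  "chain_mor \<alpha> [] [] \<beta> \<longleftrightarrow> \<alpha> \<in> Arr C \<and> \<alpha> = \<beta>"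
| "chain_mor \<alpha> ((k, f) # S) ((k', f') # S') \<beta> \<longleftrightarrow> \<alpha> \<in> Hom C (Cod C f) (Cod C f') \<and>
    (\<exists>h \<in> Hom C (Dom C f) (Dom C f'). \<exists>\<gamma> \<in> Hom C (Dom C k) (Dom C k').
      f' \<odot> h = \<alpha> \<odot> f \<and> h \<odot> k = k' \<odot> \<gamma> \<and> chain_mor \<gamma> S S' \<beta>)"
| "chain_mor _ _ _ _ \<longleftrightarrow> False"

lemma ses_chain_Obj: "ses_chain X S Y \<Longrightarrow> X \<in> Obj C \<and> Y \<in> Obj C"
  by (induction X S Y rule: ses_chain.induct) (auto dest: ses_simps(1,2))

lemma ses_chain_append: "ses_chain X (A @ B) Y \<longleftrightarrow> (\<exists>Z. ses_chain X A Z \<and> ses_chain Z B Y)"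
proof (induction A arbitrary: X)
  case Nil
  then show ?case using ses_chain_Obj by auto
qed auto

lemma chain_mor_length: "chain_mor \<alpha> S S' \<beta> \<Longrightarrow> length S = length S'"
  by (induction \<alpha> S S' \<beta> rule: chain_mor.induct) auto

lemma chain_mor_ConsI:
  assumes "\<alpha> \<in> Hom C (Cod C f) (Cod C f')" "h \<in> Hom C (Dom C f) (Dom C f')"
    "\<gamma> \<in> Hom C (Dom C k) (Dom C k')"
    "f' \<odot> h = \<alpha> \<odot> f" "h \<odot> k = k' \<odot> \<gamma>" "chain_mor \<gamma> S S' \<beta>"
  shows "chain_mor \<alpha> ((k, f) # S) ((k', f') # S') \<beta>"
  using assms by auto

lemma chain_mor_ConsE:
  assumes "chain_mor \<alpha> (e # S) S'' \<beta>"
  obtains k f k' f' S' h \<gamma> where "e = (k, f)" "S'' = (k', f') # S'" "\<alpha> \<in> Hom C (Cod C f) (Cod C f')"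
    "h \<in> Hom C (Dom C f) (Dom C f')" "\<gamma> \<in> Hom C (Dom C k) (Dom C k')"
    "f' \<odot> h = \<alpha> \<odot> f" "h \<odot> k = k' \<odot> \<gamma>" "chain_mor \<gamma> S S' \<beta>"
  using assms by (cases "(\<alpha>, e # S, S'', \<beta>)" rule: chain_mor.cases) auto

lemma chain_mor_NilE:
  assumes "chain_mor \<alpha> [] S'' \<beta>"
  obtains "S'' = []" "\<beta> = \<alpha>" "\<alpha> \<in> Arr C"
  using assms by (cases S'') auto

lemma chain_mor_types:
  assumes "chain_mor \<alpha> S S' \<beta>" "ses_chain X S Y" "ses_chain X' S' Y'" "\<alpha> \<in> Hom C X X'"
  shows "\<beta> \<in> Hom C Y Y'"
  using assms
proof (induction S arbitrary: \<alpha> S' X X')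
  case Nil
  then show ?case by (auto elim: chain_mor_NilE)
next
  case (Cons e S)
  from Cons.prems(1) show ?case
    by (rule chain_mor_ConsE) (use Cons in auto)
qed

lemma chain_mor_Id: "ses_chain X S Y \<Longrightarrow> chain_mor (Id C X) S S (Id C Y)"
proof (induction S arbitrary: X)
  case (Cons e S)
  obtain k f where e: "e = (k, f)" by force
  note s = ses_simps [of k f]
  have "chain_mor (Id C (Dom C k)) S S (Id C Y)" using Cons e by auto
  then show ?case using Cons.prems s unfolding e
    by (intro chain_mor_ConsI [where h = "Id C (Dom C f)" and \<gamma> = "Id C (Dom C k)"]) (auto simp: Hom_iff)
qed auto

lemma chain_mor_comp:
  assumes "chain_mor \<alpha> S S' \<beta>" "chain_mor \<alpha>' S' S'' \<beta>'" "ses_chain X S Y" "ses_chain X' S' Y'"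
    "ses_chain X'' S'' Y''"
    "\<alpha> \<in> Hom C X X'" "\<alpha>' \<in> Hom C X' X''"
  shows "chain_mor (\<alpha>' \<odot> \<alpha>) S S'' (\<beta>' \<odot> \<beta>)"
  using assms
proof (induction S arbitrary: \<alpha> S' X X' \<alpha>' S'' X'')
  case Nil
  then show ?case by (auto elim!: chain_mor_NilE simp: Hom_iff)
next
  case (Cons e S)
  from Cons.prems(1) obtain k f k' f' T' h \<gamma> where 1: "e = (k, f)" "S' = (k', f') # T'"
    "h \<in> Hom C (Dom C f) (Dom C f')" "\<gamma> \<in> Hom C (Dom C k) (Dom C k')"
    "f' \<odot> h = \<alpha> \<odot> f" "h \<odot> k = k' \<odot> \<gamma>" "chain_mor \<gamma> S T' \<beta>"
    by (rule chain_mor_ConsE)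
  from Cons.prems(2) obtain k'' f'' T'' h' \<gamma>' where 2: "S'' = (k'', f'') # T''"
    "h' \<in> Hom C (Dom C f') (Dom C f'')" "\<gamma>' \<in> Hom C (Dom C k') (Dom C k'')"
    "f'' \<odot> h' = \<alpha>' \<odot> f'" "h' \<odot> k' = k'' \<odot> \<gamma>'" "chain_mor \<gamma>' T' T'' \<beta>'"
    unfolding 1 by (rule chain_mor_ConsE) auto
  have s: "ses k f" "ses k' f'" "ses k'' f''" "Cod C f = X" "Cod C f' = X'" "Cod C f'' = X''"
    "ses_chain (Dom C k) S Y" "ses_chain (Dom C k') T' Y'" "ses_chain (Dom C k'') T'' Y''"
    using Cons.prems 1 2 by auto
  note ss = ses_simps(1-3) [OF s(1)] ses_simps(1-3) [OF s(2)] ses_simps(1-3) [OF s(3)]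
  have t: "chain_mor (\<gamma>' \<odot> \<gamma>) S T'' (\<beta>' \<odot> \<beta>)"
    by (rule Cons.IH [OF 1(7) 2(6) s(7-9) 1(4) 2(3)])
  have ar: "h \<in> Arr C" "Dom C h = Dom C f" "Cod C h = Dom C f'" "h' \<in> Arr C" "Dom C h' = Dom C f'"
    "Cod C h' = Dom C f''"
    "\<gamma> \<in> Arr C" "Dom C \<gamma> = Dom C k" "Cod C \<gamma> = Dom C k'" "\<gamma>' \<in> Arr C" "Dom C \<gamma>' = Dom C k'"
      "Cod C \<gamma>' = Dom C k''"
    "\<alpha> \<in> Arr C" "Dom C \<alpha> = X" "Cod C \<alpha> = X'" "\<alpha>' \<in> Arr C" "Dom C \<alpha>' = X'" "Cod C \<alpha>' = X''"
    using 1 2 Cons.prems by (simp_all add: Hom_iff)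
  have "f'' \<odot> (h' \<odot> h) = (\<alpha>' \<odot> \<alpha>) \<odot> f"
    using Comp_eq_reassoc [OF 2(4), of h] 1(5) ar ss s by simp
  moreover have "(h' \<odot> h) \<odot> k = k'' \<odot> (\<gamma>' \<odot> \<gamma>)"
    using Comp_eq_reassoc [OF 2(5), of \<gamma>] 1(6) ar ss s by simp
  ultimately show ?case
    using t ar s unfolding 1 2
    by (intro chain_mor_ConsI [where h = "h' \<odot> h" and \<gamma> = "\<gamma>' \<odot> \<gamma>"]) (simp_all add: Hom_iff)
qed

lemma diff_comp_eq:
  assumes "a \<odot> b = c \<odot> d" "a' \<odot> b = c \<odot> d'"
    and "a \<in> Arr C" "b \<in> Arr C" "c \<in> Arr C" "d \<in> Arr C" "a' \<in> Arr C" "d' \<in> Arr C"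
    and "Dom C a = Cod C b" "Dom C a' = Cod C b" "Cod C a' = Cod C a" "Dom C c = Cod C d"
      "Cod C d' = Cod C d"
      "Dom C d' = Dom C d"
  shows "(a \<oplus> neg a') \<odot> b = c \<odot> (d \<oplus> neg d')"
  using assms by simp

text \<open>Chain morphisms subtract componentwise. Applied with equal right ends, this yields a
  morphism over zero, the input of the homotopy argument.\<close>

lemma chain_mor_diff:
  assumes "chain_mor \<alpha> S S' \<beta>" "chain_mor \<alpha>' S S' \<beta>'" "ses_chain X S Y" "ses_chain X' S' Y'"
    "\<alpha> \<in> Hom C X X'" "\<alpha>' \<in> Hom C X X'"
  shows "chain_mor (\<alpha> \<oplus> neg \<alpha>') S S' (\<beta> \<oplus> neg \<beta>')"
  using assms
proof (induction S arbitrary: \<alpha> S' X X' \<alpha>')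
  case Nil
  then show ?case by (auto elim!: chain_mor_NilE simp: Hom_iff)
next
  case (Cons e S)
  from Cons.prems(1) obtain k f k' f' T' h \<gamma> where 1: "e = (k, f)" "S' = (k', f') # T'"
    "h \<in> Hom C (Dom C f) (Dom C f')" "\<gamma> \<in> Hom C (Dom C k) (Dom C k')"
    "f' \<odot> h = \<alpha> \<odot> f" "h \<odot> k = k' \<odot> \<gamma>" "chain_mor \<gamma> S T' \<beta>"
    by (rule chain_mor_ConsE)
  from Cons.prems(2) obtain h' \<gamma>' where 2:
    "h' \<in> Hom C (Dom C f) (Dom C f')" "\<gamma>' \<in> Hom C (Dom C k) (Dom C k')"
    "f' \<odot> h' = \<alpha>' \<odot> f" "h' \<odot> k = k' \<odot> \<gamma>'" "chain_mor \<gamma>' S T' \<beta>'"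
    unfolding 1 by (rule chain_mor_ConsE) auto
  have s: "ses k f" "ses k' f'" "Cod C f = X" "Cod C f' = X'"
    "ses_chain (Dom C k) S Y" "ses_chain (Dom C k') T' Y'"
    using Cons.prems 1 2 by auto
  note ss = ses_simps(1-3) [OF s(1)] ses_simps(1-3) [OF s(2)]
  have t: "chain_mor (\<gamma> \<oplus> neg \<gamma>') S T' (\<beta> \<oplus> neg \<beta>')"
    by (rule Cons.IH [OF 1(7) 2(5) s(5-6) 1(4) 2(2)])
  have ar: "h \<in> Arr C" "Dom C h = Dom C f" "Cod C h = Dom C f'" "h' \<in> Arr C" "Dom C h' = Dom C f"
    "Cod C h' = Dom C f'"
    "\<gamma> \<in> Arr C" "Dom C \<gamma> = Dom C k" "Cod C \<gamma> = Dom C k'" "\<gamma>' \<in> Arr C" "Dom C \<gamma>' = Dom C k"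
      "Cod C \<gamma>' = Dom C k'"
    "\<alpha> \<in> Arr C" "Dom C \<alpha> = X" "Cod C \<alpha> = X'" "\<alpha>' \<in> Arr C" "Dom C \<alpha>' = X" "Cod C \<alpha>' = X'"
    using 1 2 Cons.prems by (simp_all add: Hom_iff)
  have "(h \<oplus> neg h') \<odot> k = k' \<odot> (\<gamma> \<oplus> neg \<gamma>')"
    by (rule diff_comp_eq) (use 1(6) 2(4) ar ss in simp_all)
  moreover have "(\<alpha> \<oplus> neg \<alpha>') \<odot> f = f' \<odot> (h \<oplus> neg h')"
    by (rule diff_comp_eq) (use 1(5) 2(3) s ar ss in simp_all)
  ultimately show ?case
    using t ar s unfolding 1
    by (intro chain_mor_ConsI [where h = "h \<oplus> neg h'" and \<gamma> = "\<gamma> \<oplus> neg \<gamma>'"])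
      (simp_all add: Hom_iff del: Comp_Add Add_Comp)
qed

text \<open>Mostly used to isolate the leftmost piece, where pushouts and corrections take
  place.\<close>

lemma chain_mor_append:
  assumes "length A = length A'"
  shows "chain_mor \<alpha> (A @ B) (A' @ B') \<beta> \<longleftrightarrow> (\<exists>\<gamma>. chain_mor \<alpha> A A' \<gamma> \<and> chain_mor \<gamma> B B' \<beta>)"
  using assms
proof (induction A A' arbitrary: \<alpha> rule: list_induct2)
  case Nil
  have "\<alpha> \<in> Arr C" if "chain_mor \<alpha> B B' \<beta>"
    using that by (cases "(\<alpha>, B, B', \<beta>)" rule: chain_mor.cases) (auto simp: Hom_iff)
  then show ?case by auto
next
  case (Cons x xs y ys)
  then show ?case by (cases x; cases y) auto
qed

section \<open>Base change of chains at either end\<close>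

lemma ses_chain_pullback_ne:
  assumes "ses_chain X S Y" "\<alpha> \<in> Hom C X' X" "S \<noteq> []"
  obtains S' where "ses_chain X' S' Y" "length S' = length S" "chain_mor \<alpha> S' S (Id C Y)"
proof -
  obtain k f T where S: "S = (k, f) # T" using assms(3) by (cases S) auto
  have 1: "ses k f" "Cod C f = X" "ses_chain (Dom C k) T Y" using assms S by auto
  have \<alpha>: "\<alpha> \<in> Arr C" "Dom C \<alpha> = X'" "Cod C \<alpha> = X" using assms by (auto simp: Hom_iff)
  have c: "Cod C \<alpha> = Cod C f" using 1 \<alpha> by simp
  obtain k' a s where p: "ses k' a" "s \<in> Arr C" "Dom C s = Dom C a" "Cod C a = Dom C \<alpha>"
    "Cod C s = Dom C f" "f \<odot> s = \<alpha> \<odot> a" "Dom C k' = Dom C k" "s \<odot> k' = k"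
    by (rule pullback_ses [OF 1(1) \<alpha>(1) c])
  note e = ses_simps(1-3) [OF 1(1)]
  show ?thesis
  proof (rule that [of "(k', a) # T"])
    show "chain_mor \<alpha> ((k', a) # T) S (Id C Y)"
      using p 1(2) \<alpha> e chain_mor_Id [OF 1(3)] unfolding S
      by (intro chain_mor_ConsI [where h = s and \<gamma> = "Id C (Dom C k)"]) (simp_all add: Hom_iff)
  qed (use S p 1 \<alpha> in auto)
qed

text \<open>The variant for inductions whose tail may be empty: pulling back the empty chain along
  \<open>\<alpha>\<close> moves the left end as well, so \<open>\<beta>\<close> is
  \<open>\<alpha>\<close> there and an identity otherwise.\<close>

lemma ses_chain_pullback:
  assumes "ses_chain X S Y" "\<alpha> \<in> Hom C X' X"
  obtains S' N \<beta> where "ses_chain X' S' N" "length S' = length S" "chain_mor \<alpha> S' S \<beta>"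
    "\<beta> \<in> Hom C N Y"
proof (cases "S = []")
  case True
  then show ?thesis using that [of "[]" X' \<alpha>] assms by (auto simp: Hom_iff)
next
  case False
  from ses_chain_pullback_ne [OF assms False] obtain S' where
    "ses_chain X' S' Y" "length S' = length S" "chain_mor \<alpha> S' S (Id C Y)" .
  then show ?thesis using that ses_chain_Obj [OF assms(1)] Id_in_Hom by blast
qed

text \<open>Only the leftmost piece is pushed out. The last conclusion extends the universal
  property from this piece to whole chains: a morphism whose left component factors through
  \<open>u\<close> factors through the new chain, over the same \<open>\<alpha>\<close>.\<close>

lemma ses_chain_pushout:
  assumes "ses_chain X S Y" "u \<in> Hom C Y B" "S \<noteq> []"
  obtains S' where "ses_chain X S' B" "length S' = length S"
    "\<forall>X' T Z g \<alpha>. ses_chain X' T Z \<longrightarrow> g \<in> Hom C B Z \<longrightarrow> chain_mor \<alpha> S T (g \<odot> u) \<longrightarrow> chain_mor \<alpha> S' T g"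
proof -
  obtain A k f where S: "S = A @ [(k, f)]" using assms(3) by (metis rev_exhaust surj_pair)
  obtain L where 1: "ses_chain X A L" "ses k f" "Cod C f = L" "Dom C k = Y"
    using assms S by (auto simp: ses_chain_append)
  have u: "u \<in> Arr C" "Dom C u = Y" "Cod C u = B" using assms by (auto simp: Hom_iff)
  have du: "Dom C u = Dom C k" using u 1 by simp
  obtain k' f' v where p: "ses k' f'" "v \<in> Arr C" "Dom C v = Dom C f" "Cod C v = Dom C f'"
    "Dom C k' = Cod C u" "Cod C f' = Cod C f" "v \<odot> k = k' \<odot> u" "f' \<odot> v = f"
    and univ: "\<forall>W. \<forall>g \<in> Hom C (Dom C f) W. \<forall>h \<in> Hom C (Cod C u) W. g \<odot> k = h \<odot> u \<longrightarrow>
      (\<exists>w \<in> Hom C (Dom C f') W. w \<odot> v = g \<and> w \<odot> k' = h)"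
    by (rule pushout_ses [OF 1(2) u(1) du])
  note e = ses_simps(1-6) [OF 1(2)] and e' = ses_simps(1-6) [OF p(1)]
  have B: "B \<in> Obj C" using u by auto
  show ?thesis
  proof (rule that [of "A @ [(k', f')]"])
    show "ses_chain X (A @ [(k', f')]) B" using 1 p u B by (auto simp: ses_chain_append)
    show "length (A @ [(k', f')]) = length S" by (simp add: S)
    show "\<forall>X' T Z g \<alpha>. ses_chain X' T Z \<longrightarrow> g \<in> Hom C B Z \<longrightarrow> chain_mor \<alpha> S T (g \<odot> u) \<longrightarrow> chain_mor \<alpha> (A @ [(k', f')]) T g"
    proof (intro allI impI)
      fix X' T Z g \<alpha> assume T: "ses_chain X' T Z" and g: "g \<in> Hom C B Z" and m: "chain_mor \<alpha> S T (g \<odot> u)"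
      have "length T = Suc (length A)" using chain_mor_length [OF m] S by simp
      then obtain A' l q where T': "T = A' @ [(l, q)]" "length A' = length A"
        by (metis length_Suc_conv_rev surj_pair)
      obtain M where t: "ses_chain X' A' M" "ses l q" "Cod C q = M" "Dom C l = Z"
        using T T' by (auto simp: ses_chain_append)
      note et = ses_simps(1-3) [OF t(2)]
      obtain \<gamma> h where \<gamma>: "chain_mor \<alpha> A A' \<gamma>" "\<gamma> \<in> Hom C L M" "h \<in> Hom C (Dom C f) (Dom C q)"
        "q \<odot> h = \<gamma> \<odot> f" "h \<odot> k = l \<odot> (g \<odot> u)"
        using m 1 t unfolding S T'(1) chain_mor_append [OF T'(2) [symmetric]] by auto
      have "h \<odot> k = (l \<odot> g) \<odot> u" using \<gamma> g u et t by (simp add: Hom_iff)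
      moreover have "l \<odot> g \<in> Hom C (Cod C u) (Dom C q)" using g u et t by (simp add: Hom_iff)
      ultimately obtain w where w: "w \<in> Hom C (Dom C f') (Dom C q)" "w \<odot> v = h" "w \<odot> k' = l \<odot> g"
        using univ \<gamma>(3) by blast
      have a: "g \<in> Arr C" "Dom C g = B" "Cod C g = Z" "\<gamma> \<in> Arr C" "Dom C \<gamma> = L" "Cod C \<gamma> = M"
        "w \<in> Arr C" "Dom C w = Dom C f'" "Cod C w = Dom C q"
        using g \<gamma> w by (simp_all add: Hom_iff)
      \<comment> \<open>The map \<open>w\<close> on the pushout induces some \<open>z\<close> on the
        right end of the piece. It must be the old \<open>\<gamma>\<close>, so that the pieces
        further right still fit; this follows by cancelling \<open>f = f' v\<close>.\<close>
      have "(q \<odot> w) \<odot> k' = Zero C B M"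
        using Comp_eq_reassoc [OF ses_simps(4) [OF t(2)], of g] w(3) a et t p(5) u e' B ses_chain_Obj [OF t(1)] by simp
      then obtain z where z: "z \<in> Arr C" "Dom C z = Cod C f'" "Cod C z = M" "z \<odot> f' = q \<odot> w"
        using is_cokernel_desc [OF ses_simps(8) [OF p(1)], of "q \<odot> w"] a et t p u e' by auto
      have "z \<odot> f = (z \<odot> f') \<odot> v" using z(1-3) p e' by simp
      also have "\<dots> = \<gamma> \<odot> f" using z(4) w(2) \<gamma>(4) a et p by simp
      finally have "z = \<gamma>" by - (rule epi_arrD [OF e(6)], use z a p 1 in auto)
      then have "q \<odot> w = \<gamma> \<odot> f'" using z by simp
      then have "chain_mor \<gamma> [(k', f')] [(l, q)] g"
        using w \<gamma>(2) g t 1 p u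
          by (intro chain_mor_ConsI [where h = w and \<gamma> = g]) (auto simp: Hom_iff)
      then show "chain_mor \<alpha> (A @ [(k', f')]) T g"
        unfolding T'(1) chain_mor_append [OF T'(2) [symmetric]] using \<gamma>(1) by blast
    qed
  qed
qed

section \<open>Null chains\<close>

text \<open>The pullback of the two rightmost epis over \<open>X\<close> has an epi to
  \<open>X\<close>, whose kernel maps to both syzygies. Both tails are pulled back to that kernel,
  where they have a common right end and the induction applies.\<close>

lemma ses_chain_common_refinement:
  assumes "ses_chain X S Y" "ses_chain X S' Y'" "length S = n" "length S' = n"
  shows "\<exists>P N a b. ses_chain X P N \<and> length P = n \<and> chain_mor (Id C X) P S a \<and> chain_mor (Id C X) P S' b"
  using assms
proof (induction n arbitrary: X S S' Y Y')
  case 0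
  then show ?case
    by (intro exI [of _ "[]"] exI [of _ X] exI [of _ "Id C X"]) auto
next
  case (Suc n)
  obtain k f T k' f' T' where S: "S = (k, f) # T" "S' = (k', f') # T'" "length T = n"
    "length T' = n"
    using Suc.prems(3,4) by (metis length_Suc_conv surj_pair)
  have s: "ses k f" "ses k' f'" "Cod C f = X" "Cod C f' = X" "ses_chain (Dom C k) T Y"
    "ses_chain (Dom C k') T' Y'"
    using Suc.prems S by auto
  note e = ses_simps(1-6) [OF s(1)] and e' = ses_simps(1-6) [OF s(2)]
  have c: "Cod C f = Cod C f'" using s by simp
  obtain a b where p: "a \<in> Arr C" "b \<in> Arr C" "Dom C b = Dom C a" "Cod C a = Dom C f"
    "Cod C b = Dom C f'" "f' \<odot> b = f \<odot> a" "epi_arr C a"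
    by (rule pullback [OF e(1) e'(6) c]) (rule that)
  have fa: "f \<odot> a \<in> Arr C" "Dom C (f \<odot> a) = Dom C a" "Cod C (f \<odot> a) = X" using p e s by auto
  obtain m where m: "is_kernel C m (f \<odot> a)" using ex_kernel fa by blast
  have ms: "ses m (f \<odot> a)" by (rule epi_kernel_ses [OF epi_arr_Comp m]) (use p e in auto)
  have m': "m \<in> Arr C" "Cod C m = Dom C a" "Dom C m \<in> Obj C" "f \<odot> (a \<odot> m) = Zero C (Dom C m) X"
    using ses_simps [OF ms] fa p e by auto
  obtain \<gamma> where \<gamma>: "\<gamma> \<in> Arr C" "Dom C \<gamma> = Dom C m" "Cod C \<gamma> = Dom C k" "k \<odot> \<gamma> = a \<odot> m"
    by (rule is_kernel_lift [OF ses_simps(7) [OF s(1)], of "a \<odot> m"]) (use m' p s in auto)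
  have "f' \<odot> (b \<odot> m) = Zero C (Dom C m) X"
    using Comp_eq_reassoc [OF p(6), of m] m' p e e' by simp
  then obtain \<gamma>' where \<gamma>': "\<gamma>' \<in> Arr C" "Dom C \<gamma>' = Dom C m" "Cod C \<gamma>' = Dom C k'" "k' \<odot> \<gamma>' = b \<odot> m"
    using is_kernel_lift [OF ses_simps(7) [OF s(2)], of "b \<odot> m"] m' p s by auto
  have h: "\<gamma> \<in> Hom C (Dom C m) (Dom C k)" "\<gamma>' \<in> Hom C (Dom C m) (Dom C k')"
    "Id C (Dom C m) \<in> Hom C (Dom C m) (Dom C m)"
    using \<gamma> \<gamma>' m' by (simp_all add: Hom_iff)
  obtain U N1 b1 where U: "ses_chain (Dom C m) U N1" "length U = length T" "chain_mor \<gamma> U T b1"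
    by (rule ses_chain_pullback [OF s(5) h(1)])
  obtain U' N1' b1' where U': "ses_chain (Dom C m) U' N1'" "length U' = length T'"
    "chain_mor \<gamma>' U' T' b1'"
    by (rule ses_chain_pullback [OF s(6) h(2)])
  from Suc.IH [OF U(1) U'(1)] U(2) U'(2) S obtain P N c d where P: "ses_chain (Dom C m) P N"
    "length P = n"
    "chain_mor (Id C (Dom C m)) P U c" "chain_mor (Id C (Dom C m)) P U' d" by auto
  have "chain_mor (\<gamma> \<odot> Id C (Dom C m)) P T (b1 \<odot> c)"
    "chain_mor (\<gamma>' \<odot> Id C (Dom C m)) P T' (b1' \<odot> d)"
    using chain_mor_comp [OF P(3) U(3) P(1) U(1) s(5) h(3) h(1)] chain_mor_comp [OF P(4) U'(3) P(1) U'(1) s(6) h(3) h(2)]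
    by auto
  then have q: "chain_mor \<gamma> P T (b1 \<odot> c)" "chain_mor \<gamma>' P T' (b1' \<odot> d)"
    using \<gamma> \<gamma>' by auto
  have X: "X \<in> Obj C" using s e by auto
  have "chain_mor (Id C X) ((m, f \<odot> a) # P) S (b1 \<odot> c)"
    unfolding S(1)
      by (rule chain_mor_ConsI [OF _ _ h(1) _ _ q(1), where h = a]) (use X \<gamma> p fa s e in \<open>auto simp: Hom_iff\<close>)
  moreover have "chain_mor (Id C X) ((m, f \<odot> a) # P) S' (b1' \<odot> d)"
    unfolding S(2)
      by (rule chain_mor_ConsI [OF _ _ h(2) _ _ q(2), where h = b]) (use X \<gamma>' p fa s e in \<open>auto simp: Hom_iff\<close>)
  moreover have "ses_chain X ((m, f \<odot> a) # P) N" using ms P s fa by simp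
  ultimately show ?case using P(2) by (metis length_Cons)
qed

text \<open>One step of a homotopy: replacing \<open>h\<close> by \<open>h - \<sigma> f\<close>
  makes the right component zero and does not alter the restriction to \<open>k\<close>, because
  \<open>f k = 0\<close>. Everything further left, including \<open>\<beta>\<close>, is
  kept.\<close>

lemma chain_mor_shift:
  assumes "chain_mor (f' \<odot> \<sigma>) ((k, f) # S) ((k', f') # S') \<beta>" "ses k f" "ses k' f'"
    "\<sigma> \<in> Hom C (Cod C f) (Dom C f')"
  shows "chain_mor (Zero C (Cod C f) (Cod C f')) ((k, f) # S) ((k', f') # S') \<beta>"
proof -
  obtain h \<gamma> where h: "h \<in> Hom C (Dom C f) (Dom C f')" "\<gamma> \<in> Hom C (Dom C k) (Dom C k')"
    "f' \<odot> h = (f' \<odot> \<sigma>) \<odot> f" "h \<odot> k = k' \<odot> \<gamma>" "chain_mor \<gamma> S S' \<beta>"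
    using assms(1) by auto
  note e = ses_simps(1-4) [OF assms(2)] and e' = ses_simps(1-4) [OF assms(3)]
  have a: "h \<in> Arr C" "Dom C h = Dom C f" "Cod C h = Dom C f'" "\<sigma> \<in> Arr C" "Dom C \<sigma> = Cod C f"
    "Cod C \<sigma> = Dom C f'"
    "\<gamma> \<in> Arr C" "Dom C \<gamma> = Dom C k" "Cod C \<gamma> = Dom C k'"
    using h assms by (auto simp: Hom_iff)
  have "f' \<odot> (h \<oplus> neg (\<sigma> \<odot> f)) = Zero C (Cod C f) (Cod C f') \<odot> f" using h(3) a e e' by simp
  moreover have "(h \<oplus> neg (\<sigma> \<odot> f)) \<odot> k = k' \<odot> \<gamma>" using h(4) a e e' by simp
  ultimately show ?thesis
    by - (rule chain_mor_ConsI [OF _ _ h(2) _ _ h(5), where h = "h \<oplus> neg (\<sigma> \<odot> f)"], use a e e' in \<open>simp_all add: Hom_iff\<close>)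
qed

text \<open>
  A homotopy is built from the right: \<open>P\<^sub>1 \<rightarrow> S\<^sub>1\<close> factors through \<open>t : P\<^sub>1 \<rightarrow> L\<close> with \<open>L\<close> the kernel
  object, and pulling \<open>S\<^sub>2 \<rightarrow> L\<close> back along \<open>t\<close> refines \<open>P\<^sub>1\<close> until \<open>t\<close> lifts to \<open>S\<^sub>2\<close>; subtracting
  the lift leaves a morphism over zero one step further left. The equation for \<open>c \<odot> r\<close> is the last
  instance of the homotopy.
\<close>

lemma ses_chain_null_homotopy:
  assumes "ses_chain X' P N" "ses_chain X S Y" "chain_mor (Zero C X' X) P S c" "length P = Suc n"
  shows "\<exists>P' N' r t. ses_chain X' P' N' \<and> length P' = Suc n \<and> chain_mor (Id C X') P' P r \<and>
    t \<in> Hom C (Cod C (fst (last P'))) Y \<and> c \<odot> r = t \<odot> fst (last P')"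
  using assms
proof (induction n arbitrary: X' X P S N c)
  case (0 X' X P S N c)
  have "length S = Suc 0" using chain_mor_length [OF 0(3)] 0 by simp
  then obtain pk pf k f where P: "P = [(pk, pf)]" "S = [(k, f)]"
    using 0(4) by (metis length_0_conv length_Suc_conv surj_pair)
  have s: "ses pk pf" "Cod C pf = X'" "Dom C pk = N" "ses k f" "Cod C f = X" "Dom C k = Y"
    using 0 P by auto
  note e = ses_simps [OF s(1)] and e' = ses_simps [OF s(4)]
  have o: "X \<in> Obj C" "X' \<in> Obj C" "N \<in> Obj C" using s e e' by auto
  obtain h where h: "h \<in> Arr C" "Dom C h = Dom C pf" "Cod C h = Dom C f" "c \<in> Arr C" "Dom C c = N"
    "Cod C c = Y"
    "f \<odot> h = Zero C X' X \<odot> pf" "h \<odot> pk = k \<odot> c"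
    using 0(3) s unfolding P by (auto simp: Hom_iff)
  \<comment> \<open>Since \<open>f h = 0\<close>, the map \<open>h\<close> factors through the
    kernel \<open>k\<close>; cancelling \<open>k\<close> turns the left component into
    \<open>t pk\<close>. No refinement is made here, so \<open>P\<close> itself and the identity
    serve.\<close>
  obtain t where t: "t \<in> Arr C" "Dom C t = Dom C pf" "Cod C t = Y" "k \<odot> t = h"
    by (rule is_kernel_lift [OF e'(7), of h]) (use h s e o in auto)
  have "k \<odot> c = k \<odot> (t \<odot> pk)"
    using Comp_eq_reassoc [OF t(4), of pk] h t s e e' by simp
  then have "c = t \<odot> pk" by - (rule mono_arrD [OF e'(5)], use h t s e in auto)
  then have "c \<odot> Id C N = t \<odot> fst (last P)" using P h by simp
  moreover have "t \<in> Hom C (Cod C (fst (last P))) Y" using t P e by (simp add: Hom_iff)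
  ultimately show ?case using 0 chain_mor_Id [OF 0(1)] by blast
next
  case (Suc n X' X P S N c)
  have "length S = Suc (Suc n)" using chain_mor_length [OF Suc.prems(3)] Suc.prems by simp
  then obtain k f S0 where S0: "S = (k, f) # S0" "length S0 = Suc n"
    by (metis length_Suc_conv surj_pair)
  from S0(2) obtain k2 f2 S2 where "S0 = (k2, f2) # S2" by (metis length_Suc_conv surj_pair)
  moreover obtain pk pf P1 where "P = (pk, pf) # P1" "length P1 = Suc n"
    using Suc.prems(4) by (metis length_Suc_conv surj_pair)
  ultimately have P: "P = (pk, pf) # P1" "S = (k, f) # (k2, f2) # S2" "length P1 = Suc n"
    using S0 by simp_all
  define S1 where "S1 = (k2, f2) # S2"
  have s: "ses pk pf" "Cod C pf = X'" "ses_chain (Dom C pk) P1 N" "ses k f" "Cod C f = X"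
    "ses_chain (Dom C k) S1 Y"
    "ses k2 f2" "Cod C f2 = Dom C k"
    using Suc.prems P by (auto simp: S1_def)
  note e = ses_simps [OF s(1)] and e' = ses_simps [OF s(4)] and e2 = ses_simps [OF s(7)]
  have o: "X \<in> Obj C" "X' \<in> Obj C" using s e e' by auto
  obtain h \<gamma> where h: "h \<in> Arr C" "Dom C h = Dom C pf" "Cod C h = Dom C f"
    "\<gamma> \<in> Arr C" "Dom C \<gamma> = Dom C pk" "Cod C \<gamma> = Dom C k"
    "f \<odot> h = Zero C X' X \<odot> pf" "h \<odot> pk = k \<odot> \<gamma>" and mor1: "chain_mor \<gamma> P1 S1 c"
    using Suc.prems(3) s unfolding P S1_def [symmetric] by (auto simp: Hom_iff)
  obtain t where t: "t \<in> Arr C" "Dom C t = Dom C pf" "Cod C t = Dom C k" "k \<odot> t = h"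
    by (rule is_kernel_lift [OF e'(7), of h]) (use h s e o in auto)
  have "k \<odot> \<gamma> = k \<odot> (t \<odot> pk)"
    using Comp_eq_reassoc [OF t(4), of pk] h t s e e' by simp
  then have \<gamma>: "\<gamma> = t \<odot> pk" by - (rule mono_arrD [OF e'(5)], use h t s e in auto)
  have ct: "Cod C t = Cod C f2" using t s by simp
  obtain a b where p: "a \<in> Arr C" "b \<in> Arr C" "Dom C b = Dom C a" "Cod C a = Dom C t"
    "Cod C b = Dom C f2" "f2 \<odot> b = t \<odot> a" "epi_arr C a"
    by (rule pullback [OF t(1) e2(6) ct]) (rule that)
  have pa: "pf \<odot> a \<in> Arr C" "Dom C (pf \<odot> a) = Dom C a" "Cod C (pf \<odot> a) = X'" using p t e s by auto
  obtain m where m: "is_kernel C m (pf \<odot> a)" using ex_kernel pa by blast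
  have ms: "ses m (pf \<odot> a)" by (rule epi_kernel_ses [OF epi_arr_Comp m]) (use p t e in auto)
  have m': "m \<in> Arr C" "Cod C m = Dom C a" "Dom C m \<in> Obj C" "pf \<odot> (a \<odot> m) = Zero C (Dom C m) X'"
    using ses_simps [OF ms] pa p t e by auto
  obtain \<rho> where \<rho>: "\<rho> \<in> Arr C" "Dom C \<rho> = Dom C m" "Cod C \<rho> = Dom C pk" "pk \<odot> \<rho> = a \<odot> m"
    by (rule is_kernel_lift [OF e(7), of "a \<odot> m"]) (use m' p t s in auto)
  define M where "M = Dom C m"
  have hom: "\<rho> \<in> Hom C M (Dom C pk)" "\<gamma> \<in> Hom C (Dom C pk) (Dom C k)" "Id C M \<in> Hom C M M"
    using \<rho> h m' by (simp_all add: Hom_iff M_def)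
  obtain U N1 b1 where U: "ses_chain M U N1" "length U = length P1" "chain_mor \<rho> U P1 b1"
    "b1 \<in> Hom C N1 N"
    by (rule ses_chain_pullback [OF s(3) hom(1)])
  have U1: "chain_mor (\<gamma> \<odot> \<rho>) U S1 (c \<odot> b1)"
    by (rule chain_mor_comp [OF U(3) mor1 U(1) s(3) s(6) hom(1,2)])
  \<comment> \<open>On the syzygy of the refinement, \<open>\<gamma>\<close> lifts through
    \<open>f2\<close>: \<open>t pk \<rho> = t a m = f2 b m\<close>. This is the hypothesis of
    \<open>chain_mor_shift\<close>.\<close>
  have "\<gamma> \<odot> \<rho> = f2 \<odot> (b \<odot> m)"
    using Comp_eq_reassoc [OF p(6), of m] \<gamma> t p m' \<rho> e e2 by simp
  then have U2: "chain_mor (f2 \<odot> (b \<odot> m)) U S1 (c \<odot> b1)" using U1 by simp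
  obtain uk uf U' where U': "U = (uk, uf) # U'" using U(2) P(3) by (metis length_Suc_conv surj_pair)
  have us: "ses uk uf" "Cod C uf = M" using U(1) U' by auto
  have "b \<odot> m \<in> Hom C (Cod C uf) (Dom C f2)" using p m' us by (simp add: Hom_iff M_def)
  from chain_mor_shift [OF _ us(1) s(7) this] U2
  have U3: "chain_mor (Zero C M (Dom C k)) U S1 (c \<odot> b1)" unfolding U' S1_def us(2) s(8) by blast
  have "length U = Suc n" using U(2) P(3) by simp
  from Suc.IH [OF U(1) s(6) U3 this]
  obtain P2 N2 r u where P2: "ses_chain M P2 N2" "length P2 = Suc n" "chain_mor (Id C M) P2 U r"
    "u \<in> Hom C (Cod C (fst (last P2))) Y" "(c \<odot> b1) \<odot> r = u \<odot> fst (last P2)" by blast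
  have r: "r \<in> Hom C N2 N1" by (rule chain_mor_types [OF P2(3) P2(1) U(1) hom(3)])
  have c: "c \<in> Hom C N Y" by (rule chain_mor_types [OF mor1 s(3) s(6) hom(2)])
  have q: "chain_mor \<rho> P2 P1 (b1 \<odot> r)"
    using chain_mor_comp [OF P2(3) U(3) P2(1) U(1) s(3) hom(3) hom(1)] \<rho> by (simp add: M_def)
  let ?P = "(m, pf \<odot> a) # P2"
  have "ses_chain X' ?P N2" using ms P2(1) pa by (simp add: M_def)
  moreover have "chain_mor (Id C X') ?P P (b1 \<odot> r)"
    unfolding P(1) by (rule chain_mor_ConsI [OF _ _ _ _ _ q, where h = a])
      (use o \<rho> p pa s e t hom in \<open>auto simp: Hom_iff M_def\<close>)
  moreover have "last ?P = last P2" using P2(2) by auto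
  moreover have "c \<odot> (b1 \<odot> r) = u \<odot> fst (last P2)"
    using P2(5) c r U(4) by (simp add: Hom_iff)
  moreover have "length ?P = Suc (Suc n)" using P2 by simp
  ultimately show ?case using P2(4) by metis
qed

text \<open>The last correction of a homotopy: subtracting \<open>k t\<close> from the leftmost
  middle component kills the left end, and \<open>f k = 0\<close> leaves the square to its right
  intact.\<close>

lemma chain_mor_zero_of_factor:
  assumes "chain_mor \<alpha> P S c" "ses_chain X' P N" "ses_chain X S Y" "P \<noteq> []"
    "t \<in> Hom C (Cod C (fst (last P))) Y" "c = t \<odot> fst (last P)"
  shows "chain_mor \<alpha> P S (Zero C N Y)"
proof -
  obtain A pk pf where P: "P = A @ [(pk, pf)]" using assms(4) by (metis rev_exhaust surj_pair)
  have "length S = Suc (length A)" using chain_mor_length [OF assms(1)] P by simp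
  then obtain B k f where S: "S = B @ [(k, f)]" "length A = length B"
    by (metis length_Suc_conv_rev surj_pair)
  obtain L M where s: "ses_chain X' A L" "ses pk pf" "Cod C pf = L" "Dom C pk = N"
    "ses_chain X B M" "ses k f" "Cod C f = M" "Dom C k = Y"
    using assms(2,3) P S by (auto simp: ses_chain_append)
  obtain \<gamma> h where \<gamma>: "chain_mor \<alpha> A B \<gamma>" "\<gamma> \<in> Hom C L M" "h \<in> Hom C (Dom C pf) (Dom C f)"
    "f \<odot> h = \<gamma> \<odot> pf" "h \<odot> pk = k \<odot> c"
    using assms(1) s unfolding P S(1) chain_mor_append [OF S(2)] by auto
  note e = ses_simps(1-4) [OF s(2)] and e' = ses_simps(1-4) [OF s(6)]
  have t: "t \<in> Arr C" "Dom C t = Dom C pf" "Cod C t = Y" "c = t \<odot> pk"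
    using assms(5,6) P e by (simp_all add: Hom_iff)
  have a: "h \<in> Arr C" "Dom C h = Dom C pf" "Cod C h = Dom C f" "\<gamma> \<in> Arr C" "Dom C \<gamma> = L"
    "Cod C \<gamma> = M"
    using \<gamma> by (simp_all add: Hom_iff)
  have o: "L \<in> Obj C" "M \<in> Obj C" "N \<in> Obj C" "Y \<in> Obj C" using s e e' by auto
  have kt: "f \<odot> (k \<odot> t) = Zero C (Dom C pf) M"
    using Comp_eq_reassoc [OF e'(4), of t] t e' s o e by simp
  have "f \<odot> (h \<oplus> neg (k \<odot> t)) = \<gamma> \<odot> pf" using kt \<gamma>(4) a t e e' s o by simp
  moreover have "(h \<oplus> neg (k \<odot> t)) \<odot> pk = k \<odot> Zero C N Y" using \<gamma>(5) a t e e' s o by simp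
  ultimately have "chain_mor \<gamma> [(pk, pf)] [(k, f)] (Zero C N Y)"
    using a t e e' s o
    by (intro chain_mor_ConsI [where h = "h \<oplus> neg (k \<odot> t)" and \<gamma> = "Zero C N Y"]) (simp_all add: Hom_iff)
  then show ?thesis using \<gamma>(1) unfolding P S(1) chain_mor_append [OF S(2)] by blast
qed

text \<open>The criterion that replaces triviality. \<open>N\<close> is left free because refining a
  chain changes its left end; equality of lengths is enforced by \<open>chain_mor\<close>.\<close>

definition null_chain where
  "null_chain X S Y \<longleftrightarrow> (\<exists>P N. ses_chain X P N \<and> chain_mor (Id C X) P S (Zero C N Y))"

text \<open>Composition with a witness suffices, and the left component may be arbitrary since it is
  applied to zero.\<close>

lemma null_chain_mor:
  assumes "null_chain X S Y" "ses_chain X S Y" "ses_chain X S' Y'" "chain_mor (Id C X) S S' \<beta>"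
  shows "null_chain X S' Y'"
proof -
  obtain P N where P: "ses_chain X P N" "chain_mor (Id C X) P S (Zero C N Y)"
    using assms(1) by (auto simp: null_chain_def)
  have o: "X \<in> Obj C" "N \<in> Obj C" "Y' \<in> Obj C" using ses_chain_Obj P assms(3) by blast+
  have i: "Id C X \<in> Hom C X X" using o by (simp add: Hom_iff)
  have "\<beta> \<in> Hom C Y Y'" by (rule chain_mor_types [OF assms(4,2,3) i])
  then have "\<beta> \<odot> Zero C N Y = Zero C N Y'" using o by (simp add: Hom_iff)
  moreover have "chain_mor (Id C X \<odot> Id C X) P S' (\<beta> \<odot> Zero C N Y)"
    by (rule chain_mor_comp [OF P(2) assms(4) P(1) assms(2,3) i i])
  ultimately show ?thesis using P(1) o by (auto simp: null_chain_def)
qed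

lemma null_chain_mor_back:
  assumes "null_chain X S Y" "ses_chain X S Y" "ses_chain X S' Y" "S \<noteq> []"
    "chain_mor (Id C X) S' S (Id C Y)"
  shows "null_chain X S' Y"
proof -
  obtain P N where P: "ses_chain X P N" "chain_mor (Id C X) P S (Zero C N Y)"
    using assms(1) by (auto simp: null_chain_def)
  have o: "X \<in> Obj C" "N \<in> Obj C" "Y \<in> Obj C" using ses_chain_Obj P assms(3) by blast+
  have i: "Id C X \<in> Hom C X X" using o by (simp add: Hom_iff)
  have l: "length P = length S" "length S' = length S" using chain_mor_length P(2) assms(5) by auto
  obtain Q M a b where Q: "ses_chain X Q M" "length Q = length S" "chain_mor (Id C X) Q P a"
    "chain_mor (Id C X) Q S' b"
    using ses_chain_common_refinement [OF P(1) assms(3) l] by blast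
  have ab: "a \<in> Hom C M N" "b \<in> Hom C M Y"
    using chain_mor_types [OF Q(3) Q(1) P(1) i] chain_mor_types [OF Q(4) Q(1) assms(3) i] .
  have M: "M \<in> Obj C" using ses_chain_Obj Q by blast
  have "chain_mor (Id C X \<odot> Id C X) Q S (Id C Y \<odot> b)"
    by (rule chain_mor_comp [OF Q(4) assms(5) Q(1) assms(3,2) i i])
  then have 1: "chain_mor (Id C X) Q S b" using o ab by (simp add: Hom_iff)
  have "chain_mor (Id C X \<odot> Id C X) Q S (Zero C N Y \<odot> a)"
    by (rule chain_mor_comp [OF Q(3) P(2) Q(1) P(1) assms(2) i i])
  then have 2: "chain_mor (Id C X) Q S (Zero C M Y)" using o ab by (simp add: Hom_iff)
  \<comment> \<open>Through \<open>S'\<close> and through \<open>P\<close> the refinement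
    \<open>Q\<close> maps to \<open>S\<close> in two ways, with left components \<open>b\<close> and
    zero. Their difference keeps \<open>b\<close> on the left and is zero on the right.\<close>
  have "chain_mor (Id C X \<oplus> neg (Id C X)) Q S (b \<oplus> neg (Zero C M Y))"
    by (rule chain_mor_diff [OF 1 2 Q(1) assms(2) i i])
  then have 3: "chain_mor (Zero C X X) Q S b" using o ab M by (simp add: Hom_iff)
  obtain n where n: "length Q = Suc n" using Q(2) assms(4) by (metis length_0_conv not0_implies_Suc)
  from ses_chain_null_homotopy [OF Q(1) assms(2) 3 n] obtain P' N' r t where P':
    "ses_chain X P' N'" "length P' = Suc n" "chain_mor (Id C X) P' Q r"
    "t \<in> Hom C (Cod C (fst (last P'))) Y" "b \<odot> r = t \<odot> fst (last P')" by blast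
  \<comment> \<open>The homotopy was built towards \<open>S\<close>, but its outcome, the
    factorization of \<open>b r\<close>, mentions only the left end \<open>Y\<close>. It can
    therefore correct the morphism to \<open>S'\<close>, which has the same left component
    \<open>b\<close>.\<close>
  have "chain_mor (Id C X \<odot> Id C X) P' S' (b \<odot> r)"
    by (rule chain_mor_comp [OF P'(3) Q(4) P'(1) Q(1) assms(3) i i])
  then have "chain_mor (Id C X) P' S' (b \<odot> r)" using o by simp
  then have "chain_mor (Id C X) P' S' (Zero C N' Y)"
    by (rule chain_mor_zero_of_factor [OF _ P'(1) assms(3) _ P'(4,5)]) (use P'(2) in auto)
  then show ?thesis using P'(1) by (auto simp: null_chain_def)
qed

section \<open>Extensions as chains\<close>

text \<open>
  \<open>splice_rev\<close> lists the morphisms of the spliced exact sequence from right to left, after composing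
  the rightmost one with \<open>m\<close>.
\<close>

fun splice_rev where
  "splice_rev m [] = [m]"
| "splice_rev m ((k, f) # S) = (m \<odot> f) # splice_rev k S"

text \<open>The family \<open>h\<close> of an \<open>extension_morphism\<close> in recursive form:
  inner components are quantified away, \<open>a\<close> is the rightmost and \<open>b\<close> the
  leftmost one, and the lists run from right to left.\<close>

fun ladder where
  "ladder a [] [] b \<longleftrightarrow> a = b"
| "ladder a (f # fs) (g # gs) b \<longleftrightarrow> a \<in> Hom C (Cod C f) (Cod C g) \<and>
    (\<exists>h \<in> Hom C (Dom C f) (Dom C g). a \<odot> f = g \<odot> h \<and> ladder h fs gs b)"
| "ladder _ _ _ _ \<longleftrightarrow> False"

lemma length_splice_rev [simp]: "length (splice_rev m S) = Suc (length S)"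
  by (induction m S rule: splice_rev.induct) auto

text \<open>Syzygies disappear in the splice: apart from the left end, only middle terms remain as
  domains. This translates the condition on the terms of a resolution.\<close>

lemma Dom_splice_rev:
  assumes "ses_chain (Dom C m) S Y" "m \<in> Arr C"
  shows "Dom C ` set (splice_rev m S) = insert Y (Dom C ` snd ` set S)"
  using assms
proof (induction m S rule: splice_rev.induct)
  case (2 m k f S)
  then show ?case using ses_simps(1-3) [of k f] by auto
qed auto

text \<open>The rightmost morphism is composed with a general \<open>m\<close>, since after one step
  the recursion continues with the inclusion of the next syzygy.\<close>

lemma chain_mor_imp_ladder:
  assumes "chain_mor \<gamma> S S' b" "ses_chain L S Y" "ses_chain L' S' Y'" "\<gamma> \<in> Hom C L L'"
    "m \<in> Hom C L A" "m' \<in> Hom C L' A'" "a \<in> Hom C A A'" "a \<odot> m = m' \<odot> \<gamma>"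
  shows "ladder a (splice_rev m S) (splice_rev m' S') b"
  using assms
proof (induction S arbitrary: \<gamma> S' L L' m m' a A A')
  case Nil
  then show ?case by (auto elim!: chain_mor_NilE simp: Hom_iff)
next
  case (Cons e S)
  from Cons.prems(1) obtain k f k' f' T' h \<delta> where 1: "e = (k, f)" "S' = (k', f') # T'"
    "h \<in> Hom C (Dom C f) (Dom C f')" "\<delta> \<in> Hom C (Dom C k) (Dom C k')"
    "f' \<odot> h = \<gamma> \<odot> f" "h \<odot> k = k' \<odot> \<delta>" "chain_mor \<delta> S T' b"
    by (rule chain_mor_ConsE)
  have s: "ses k f" "ses k' f'" "Cod C f = L" "Cod C f' = L'" "ses_chain (Dom C k) S Y"
    "ses_chain (Dom C k') T' Y'"
    using Cons.prems 1 by auto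
  note e = ses_simps(1-3) [OF s(1)] and e' = ses_simps(1-3) [OF s(2)]
  have k: "k \<in> Hom C (Dom C k) (Dom C f)" "k' \<in> Hom C (Dom C k') (Dom C f')"
    using e e' by (simp_all add: Hom_iff)
  have "ladder h (splice_rev k S) (splice_rev k' T') b"
    by (rule Cons.IH [OF 1(7) s(5,6) 1(4) k 1(3,6)])
  moreover have "a \<odot> (m \<odot> f) = (m' \<odot> f') \<odot> h"
    using Comp_eq_reassoc [OF Cons.prems(8), of f] Cons.prems(4-7) 1(3,5) e e' s
      by (simp add: Hom_iff)
  ultimately show ?case
    using Cons.prems(4-7) 1(3) e e' s unfolding 1 by (auto simp: Hom_iff)
qed

text \<open>A ladder has no syzygy components; they are reconstructed from the left. Given
  \<open>\<delta>\<close> on the next syzygy, \<open>f' h\<close> kills \<open>k\<close> and hence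
  descends along its cokernel \<open>f\<close> to \<open>\<gamma>\<close>.\<close>

lemma ladder_imp_mor:
  assumes "ladder a (splice_rev m S) (splice_rev m' S') b" "ses_chain L S Y" "ses_chain L' S' Y'"
    "m \<in> Hom C L A" "m' \<in> Hom C L' A'" "a \<in> Hom C A A'" "length S = length S'"
  shows "\<exists>\<gamma> \<in> Hom C L L'. a \<odot> m = m' \<odot> \<gamma> \<and> chain_mor \<gamma> S S' b"
  using assms
proof (induction S arbitrary: S' L L' m m' a A A')
  case Nil
  then show ?case by (auto simp: Hom_iff)
next
  case (Cons e S)
  obtain k f where 1: "e = (k, f)" by force
  obtain k' f' T' where 2: "S' = (k', f') # T'" "length S = length T'"
    using Cons.prems(7)
      by (metis length_Suc_conv list.size(4) add_Suc_right add.right_neutral surj_pair)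
  have s: "ses k f" "ses k' f'" "Cod C f = L" "Cod C f' = L'" "ses_chain (Dom C k) S Y"
    "ses_chain (Dom C k') T' Y'"
    using Cons.prems 1 2 by auto
  note e = ses_simps [OF s(1)] and e' = ses_simps [OF s(2)]
  have k: "k \<in> Hom C (Dom C k) (Dom C f)" "k' \<in> Hom C (Dom C k') (Dom C f')"
    using e e' by (simp_all add: Hom_iff)
  have m: "m \<in> Arr C" "Dom C m = L" "Cod C m = A" "m' \<in> Arr C" "Dom C m' = L'" "Cod C m' = A'"
    "a \<in> Arr C" "Dom C a = A" "Cod C a = A'"
    using Cons.prems by (simp_all add: Hom_iff)
  have D: "Dom C (m \<odot> f) = Dom C f" "Dom C (m' \<odot> f') = Dom C f'" using m e e' s by simp_all
  obtain h where h: "h \<in> Hom C (Dom C f) (Dom C f')" "a \<odot> (m \<odot> f) = (m' \<odot> f') \<odot> h"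
    "ladder h (splice_rev k S) (splice_rev k' T') b"
    using Cons.prems(1) unfolding 1 2 splice_rev.simps ladder.simps D by blast
  obtain \<delta> where \<delta>: "\<delta> \<in> Hom C (Dom C k) (Dom C k')" "h \<odot> k = k' \<odot> \<delta>" "chain_mor \<delta> S T' b"
    using Cons.IH [OF h(3) s(5,6) k h(1) 2(2)] by blast
  have d: "\<delta> \<in> Arr C" "Dom C \<delta> = Dom C k" "Cod C \<delta> = Dom C k'" "h \<in> Arr C" "Dom C h = Dom C f"
    "Cod C h = Dom C f'"
    using h \<delta> by (simp_all add: Hom_iff)
  have o: "L' \<in> Obj C" "L \<in> Obj C" "Dom C k \<in> Obj C" using m e by auto
  have "f' \<odot> (k' \<odot> \<delta>) = Zero C (Dom C k) L'"
    using Comp_eq_reassoc [OF e'(4), of \<delta>] d e e' s o by simp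
  then have "(f' \<odot> h) \<odot> k = Zero C (Dom C k) L'" using \<delta>(2) d e e' by simp
  then obtain \<gamma> where \<gamma>: "\<gamma> \<in> Arr C" "Dom C \<gamma> = L" "Cod C \<gamma> = L'" "\<gamma> \<odot> f = f' \<odot> h"
    using is_cokernel_desc [OF e(8), of "f' \<odot> h"] d e e' s by auto
  have "(a \<odot> m) \<odot> f = (m' \<odot> \<gamma>) \<odot> f" using h(2) \<gamma> m d e e' s by simp
  then have "a \<odot> m = m' \<odot> \<gamma>" by - (rule epi_arrD [OF e(6)], use \<gamma> m e s in auto)
  moreover have "chain_mor \<gamma> ((k, f) # S) ((k', f') # T') b"
    by (rule chain_mor_ConsI [OF _ h(1) \<delta>(1) _ \<delta>(2,3)]) (use \<gamma> s in \<open>simp_all add: Hom_iff\<close>)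
  moreover have "\<gamma> \<in> Hom C L L'" using \<gamma> by (simp add: Hom_iff)
  ultimately show ?case unfolding 1 2 by blast
qed

lemma ladder_rev:
  "ladder a (rev fs) (rev gs) b \<longleftrightarrow> length fs = length gs \<and> (\<exists>h. h 0 = b \<and> h (length fs) = a \<and>
    (\<forall>i < length fs. h i \<in> Hom C (Dom C (fs ! i)) (Dom C (gs ! i)) \<and>
      h (Suc i) \<in> Hom C (Cod C (fs ! i)) (Cod C (gs ! i)) \<and>
      h (Suc i) \<odot> (fs ! i) = (gs ! i) \<odot> h i))" (is "_ \<longleftrightarrow> _ \<and> (\<exists>h. ?P fs gs h a)")
proof (induction fs arbitrary: gs a rule: rev_induct)
  case Nil
  show ?case by (cases "rev gs") auto
next
  case (snoc f fs)
  show ?case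
  proof (cases gs rule: rev_cases)
    case Nil
    then show ?thesis by simp
  next
    case (snoc gs' g)
    have eq: "(\<exists>h. ?P (fs @ [f]) (gs' @ [g]) h a) \<longleftrightarrow>
      a \<in> Hom C (Cod C f) (Cod C g) \<and> (\<exists>c \<in> Hom C (Dom C f) (Dom C g). a \<odot> f = g \<odot> c \<and> (\<exists>h. ?P fs gs' h c))"
      (is "?L \<longleftrightarrow> ?R") if l: "length fs = length gs'"
    proof
      assume ?L
      then obtain h where h: "h 0 = b" "h (Suc (length fs)) = a"
        "\<forall>i < Suc (length fs). h i \<in> Hom C (Dom C ((fs @ [f]) ! i)) (Dom C ((gs' @ [g]) ! i)) \<and>
      h (Suc i) \<in> Hom C (Cod C ((fs @ [f]) ! i)) (Cod C ((gs' @ [g]) ! i)) \<and>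
      h (Suc i) \<odot> ((fs @ [f]) ! i) = ((gs' @ [g]) ! i) \<odot> h i" by auto
      have "?P fs gs' h (h (length fs))" using h l by (auto simp: nth_append dest: less_SucI)
      moreover have "h (length fs) \<in> Hom C (Dom C f) (Dom C g)" "a \<in> Hom C (Cod C f) (Cod C g)"
        "a \<odot> f = g \<odot> h (length fs)"
        using h(3) [rule_format, of "length fs"] h(2) l by (auto simp: nth_append)
      ultimately show ?R by blast
    next
      assume ?R
      then obtain c h where h: "a \<in> Hom C (Cod C f) (Cod C g)" "c \<in> Hom C (Dom C f) (Dom C g)"
        "a \<odot> f = g \<odot> c" "?P fs gs' h c" by blast
      have "?P (fs @ [f]) (gs' @ [g]) (h (Suc (length fs) := a)) a"
        using h l by (auto simp: nth_append less_Suc_eq)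
      then show ?L by blast
    qed
    have "ladder a (rev (fs @ [f])) (rev (gs' @ [g])) b \<longleftrightarrow> length fs = length gs' \<and>
      a \<in> Hom C (Cod C f) (Cod C g) \<and> (\<exists>c \<in> Hom C (Dom C f) (Dom C g). a \<odot> f = g \<odot> c \<and> (\<exists>h. ?P fs gs' h c))"
      unfolding rev_append rev.simps append.simps ladder.simps snoc.IH by blast
    moreover have "length (fs @ [f]) = length (gs' @ [g]) \<longleftrightarrow> length fs = length gs'" by simp
    ultimately show ?thesis using eq unfolding snoc by blast
  qed
qed

lemma extension_morphism_iff:
  assumes "length fs = Suc n" "length gs = Suc n"
  shows "(\<exists>h. extension_morphism C n X Y fs gs h) \<longleftrightarrow> ladder (Id C X) (rev fs) (rev gs) (Id C Y)"
  using assms unfolding ladder_rev extension_morphism_def by (simp add: less_Suc_eq_le)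

section \<open>Cutting exact sequences into short exact ones and splicing them back\<close>

lemma zero_object_simps:
  assumes "zero_object C Z"
  shows "Z \<in> Obj C" "Id C Z = Zero C Z Z"
    "\<lbrakk>f \<in> Arr C; Dom C f = Z\<rbrakk> \<Longrightarrow> f = Zero C Z (Cod C f)"
    "\<lbrakk>f \<in> Arr C; Cod C f = Z\<rbrakk> \<Longrightarrow> f = Zero C (Dom C f) Z"
proof -
  show Z: "Z \<in> Obj C" using assms by (simp add: zero_object_def)
  have 1: "f = g" if "f \<in> Hom C Z X" "g \<in> Hom C Z X" "X \<in> Obj C" for f g X
    using assms that unfolding zero_object_def by blast
  have 2: "f = g" if "f \<in> Hom C X Z" "g \<in> Hom C X Z" "X \<in> Obj C" for f g X
    using assms that unfolding zero_object_def by blast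
  show "Id C Z = Zero C Z Z" by (rule 1 [of _ Z]) (use Z in \<open>auto simp: Hom_iff\<close>)
  show "f = Zero C Z (Cod C f)" if "f \<in> Arr C" "Dom C f = Z"
    by (rule 1 [of _ "Cod C f"]) (use Z that in \<open>auto simp: Hom_iff\<close>)
  show "f = Zero C (Dom C f) Z" if "f \<in> Arr C" "Cod C f = Z"
    by (rule 2 [of _ "Dom C f"]) (use Z that in \<open>auto simp: Hom_iff\<close>)
qed

lemma exact_at_Arr: "exact_at C f g \<Longrightarrow> f \<in> Arr C \<and> g \<in> Arr C"
  unfolding exact_at_def is_image_def by (auto dest: is_kernel_simps is_cokernel_simps)

text \<open>The point is that \<open>e\<close> is epi. If \<open>w e = 0\<close> and
  \<open>\<kappa>\<close> is the kernel of \<open>w\<close>, then \<open>f\<close> factors through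
  the mono \<open>m \<kappa>\<close>, the kernel of some \<open>d\<close>. As \<open>d\<close> kills
  \<open>f\<close>, it factors through the cokernel \<open>c\<close> and so kills \<open>m\<close>;
  hence \<open>m\<close> factors through \<open>m \<kappa>\<close>, \<open>\<kappa>\<close> has a
  right inverse, and \<open>w\<close> is zero.\<close>

lemma exact_at_factor:
  assumes "exact_at C f g"
  obtains m e where "is_kernel C m g" "epi_arr C e" "e \<in> Arr C" "Dom C e = Dom C f"
    "Cod C e = Dom C m" "m \<odot> e = f"
proof -
  obtain m c where c: "is_cokernel C c f" "is_kernel C m c" and m: "is_kernel C m g"
    using assms by (auto simp: exact_at_def is_image_def)
  note c' = is_cokernel_simps [OF c(1)] and m' = is_kernel_simps [OF c(2)]
  have mm: "mono_arr C m" by (rule is_kernel_mono [OF m])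
  obtain e where e: "e \<in> Arr C" "Dom C e = Dom C f" "Cod C e = Dom C m" "m \<odot> e = f"
    by (rule is_kernel_lift [OF c(2), of f]) (use c' in auto)
  have "epi_arr C e"
  proof (rule epi_arrI)
    fix W w assume w: "w \<in> Arr C" "Dom C w = Cod C e" "Cod C w = W" "w \<odot> e = Zero C (Dom C e) W"
    obtain \<kappa> where \<kappa>: "is_kernel C \<kappa> w" using ex_kernel w by blast
    note k = is_kernel_simps [OF \<kappa>]
    obtain u where u: "u \<in> Arr C" "Dom C u = Dom C e" "Cod C u = Dom C \<kappa>" "\<kappa> \<odot> u = e"
      by (rule is_kernel_lift [OF \<kappa>, of e]) (use w e in auto)
    have mk: "m \<odot> \<kappa> \<in> Arr C" "Dom C (m \<odot> \<kappa>) = Dom C \<kappa>" "Cod C (m \<odot> \<kappa>) = Cod C m"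
      using k m' w e by simp_all
    have "mono_arr C (m \<odot> \<kappa>)"
    proof (rule mono_arrI)
      fix V v assume v: "v \<in> Arr C" "Dom C v = V" "Cod C v = Dom C (m \<odot> \<kappa>)"
        "(m \<odot> \<kappa>) \<odot> v = Zero C V (Cod C (m \<odot> \<kappa>))"
      have V: "V \<in> Obj C" using v by auto
      have "\<kappa> \<odot> v = Zero C V (Cod C \<kappa>)"
        by (rule mono_arrD [OF mm]) (use v V mk m' k w e in auto)
      then show "v = Zero C V (Dom C (m \<odot> \<kappa>))"
        by - (rule mono_arrD [OF is_kernel_mono [OF \<kappa>]], use v V mk k in auto)
    qed (fact mk)
    moreover obtain d where d: "is_cokernel C d (m \<odot> \<kappa>)" using ex_cokernel mk by blast
    ultimately have kd: "is_kernel C (m \<odot> \<kappa>) d" by (rule mono_is_kernel_of_cokernel)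
    note d' = is_cokernel_simps [OF d]
    have "d \<odot> ((m \<odot> \<kappa>) \<odot> u) = Zero C (Dom C f) (Cod C d)"
      using Comp_eq_reassoc [OF d'(4), of u] d' u mk e by (simp del: Comp_assoc')
    then have "d \<odot> f = Zero C (Dom C f) (Cod C d)" using u e k m' w by simp
    then obtain v where v: "v \<in> Arr C" "Dom C v = Cod C c" "Cod C v = Cod C d" "v \<odot> c = d"
      using is_cokernel_desc [OF c(1), of d] d' mk m' c' by auto
    have "v \<odot> (c \<odot> m) = d \<odot> m" by (rule Comp_eq_reassoc) (use v m' c' in simp_all)
    then have "d \<odot> m = Zero C (Dom C m) (Cod C d)" using m'(2-4) v(1-3) by simp
    then obtain z where z: "z \<in> Arr C" "Dom C z = Dom C m" "Cod C z = Dom C \<kappa>" "(m \<odot> \<kappa>) \<odot> z = m"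
      using is_kernel_lift [OF kd, of m] m' d' mk by auto
    have "\<kappa> \<odot> z = Id C (Dom C m)"
      by (rule mono_arrD [OF mm]) (use z k m' w e in auto)
    then have "w = w \<odot> (\<kappa> \<odot> z)" using w e by simp
    also have "\<dots> = Zero C (Cod C e) W"
      using Comp_eq_reassoc [OF k(4), of z] z k w e by auto
    finally show "w = Zero C (Cod C e) W" .
  qed (fact e)
  then show ?thesis using that m e by blast
qed

text \<open>The image of \<open>m e\<close> is \<open>m\<close>: a cokernel of \<open>m e\<close>
  kills \<open>m\<close> because \<open>e\<close> is epi, and it kills nothing more because the
  cokernel of \<open>m\<close> factors through it.\<close>

lemma exact_at_Comp:
  assumes "is_kernel C m g" "epi_arr C e" "Cod C e = Dom C m"
  shows "exact_at C (m \<odot> e) g"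
proof -
  note m = is_kernel_simps [OF assms(1)]
  have e: "e \<in> Arr C" using assms by (simp add: epi_arr_def)
  have me: "m \<odot> e \<in> Arr C" "Dom C (m \<odot> e) = Dom C e" "Cod C (m \<odot> e) = Cod C m"
    using m e assms by auto
  obtain c where c: "is_cokernel C c (m \<odot> e)" using ex_cokernel me by blast
  note c' = is_cokernel_simps [OF c]
  have mm: "mono_arr C m" by (rule is_kernel_mono [OF assms(1)])
  have cm: "c \<odot> m = Zero C (Dom C m) (Cod C c)"
    by (rule epi_arrD [OF assms(2)]) (use c' me m e assms in auto)
  obtain d where d: "is_cokernel C d m" using ex_cokernel m by blast
  note d' = is_cokernel_simps [OF d]
  have "d \<odot> (m \<odot> e) = Zero C (Dom C m) (Cod C d) \<odot> e"
    by (rule Comp_eq_reassoc) (use d' m e assms in simp_all)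
  then have "d \<odot> (m \<odot> e) = Zero C (Dom C (m \<odot> e)) (Cod C d)" using d' m e assms by simp
  then obtain v where v: "v \<in> Arr C" "Dom C v = Cod C c" "Cod C v = Cod C d" "v \<odot> c = d"
    using is_cokernel_desc [OF c, of d] d'(2,3) me(3) by metis
  have "is_kernel C m c"
  proof (rule is_kernelI)
    fix h assume h: "h \<in> Arr C" "Cod C h = Dom C c" "c \<odot> h = Zero C (Dom C h) (Cod C c)"
    have "d \<odot> h = Zero C (Dom C h) (Cod C d)"
      using Comp_eq_reassoc [OF v(4), of h] v h c' by simp
    then obtain u where "u \<in> Arr C" "Dom C u = Dom C h" "Cod C u = Dom C m" "m \<odot> u = h"
      using is_kernel_lift [OF mono_is_kernel_of_cokernel [OF mm d], of h] h c' me d' by auto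
    then show "\<exists>u\<in>Arr C. Dom C u = Dom C h \<and> Cod C u = Dom C m \<and> m \<odot> u = h" by blast
  qed (use c' me m mm cm in auto)
  then show ?thesis using c assms(1) by (auto simp: exact_at_def is_image_def)
qed


text \<open>\<open>Id C X\<close> stands in for the inclusion of a syzygy at the right end, so the
  rightmost morphism is the epi of the first piece.\<close>

definition splice where "splice X S = rev (splice_rev (Id C X) S)"

fun exact_chain where
  "exact_chain g [] z \<longleftrightarrow> exact_at C z g"
| "exact_chain g (r # rs) z \<longleftrightarrow> exact_at C r g \<and> exact_chain r rs z"

lemma exact_chain_Arr: "exact_chain g rs z \<Longrightarrow> insert g (insert z (set rs)) \<subseteq> Arr C"
  by (induction g rs z rule: exact_chain.induct) (auto dest: exact_at_Arr)

lemma exact_chain_iff_successively: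
  "exact_chain g rs z \<longleftrightarrow> successively (\<lambda>f h. exact_at C f h) (z # rev rs @ [g])"
proof (induction g rs z rule: exact_chain.induct)
  case (2 g r rs z)
  have "successively (\<lambda>f h. exact_at C f h) ((z # rev rs @ [r]) @ [g]) \<longleftrightarrow>
    successively (\<lambda>f h. exact_at C f h) (z # rev rs @ [r]) \<and> exact_at C r g"
    by (subst successively_append_iff) auto
  then show ?case using 2 by auto
qed auto

lemma exact_seq_iff_exact_chain:
  "exact_seq C (z # fs @ [w]) \<longleftrightarrow> exact_chain w (rev fs) z"
  using exact_chain_Arr [of w "rev fs" z]
  unfolding exact_seq_def exact_chain_iff_successively successively_conv_nth by auto

text \<open>Each \<open>r\<close> factors as an epi \<open>e\<close> followed by the kernel
  \<open>m\<close> of its right neighbour. The kernel \<open>k\<close> of \<open>r\<close> supplied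
  by the induction is also a kernel of \<open>e\<close>, as \<open>m\<close> is mono, so
  \<open>(k, e)\<close> is a short exact piece.\<close>

lemma exact_chain_imp_splice:
  assumes "exact_chain g rs (Zero C Z Y)" "zero_object C Z" "rs \<noteq> []" "Y = Dom C (last rs)"
  shows "\<exists>m S. is_kernel C m g \<and> ses_chain (Dom C m) S Y \<and> length rs = Suc (length S) \<and> rs = splice_rev m S"
  using assms
proof (induction rs arbitrary: g)
  case (Cons r rs)
  note Z = zero_object_simps [OF Cons.prems(2)]
  have r: "exact_at C r g" using Cons.prems by simp
  then have rA: "r \<in> Arr C" using exact_at_Arr by blast
  show ?case
  proof (cases rs)
    case Nil
    have Y: "Y = Dom C r" "Y \<in> Obj C" and zr: "exact_at C (Zero C Z Y) r"
      using Cons.prems Nil rA by auto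
    obtain m e where m: "is_kernel C m r" "epi_arr C e" "e \<in> Arr C" "Dom C e = Dom C (Zero C Z Y)"
      "Cod C e = Dom C m"
      by (rule exact_at_factor [OF zr]) (rule that)
    note m' = is_kernel_simps [OF m(1)]
    have o: "Dom C m \<in> Obj C" using m' by auto
    have "e = Zero C Z (Dom C m)" using Z(3) [OF m(3)] m Z Y by simp
    then have i: "Id C (Dom C m) = Zero C (Dom C m) (Dom C m)"
      by - (rule epi_arrD [OF m(2)], use m o Z in auto)
    have rmono: "mono_arr C r"
    proof (rule mono_arrI)
      fix X x assume x: "x \<in> Arr C" "Dom C x = X" "Cod C x = Dom C r" "r \<odot> x = Zero C X (Cod C r)"
      obtain u where u: "u \<in> Arr C" "Dom C u = X" "Cod C u = Dom C m" "m \<odot> u = x"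
        by (rule is_kernel_lift [OF m(1), of x]) (use x in auto)
      have X: "X \<in> Obj C" using x by auto
      have "u = Id C (Dom C m) \<odot> u" using u by simp
      also have "\<dots> = Zero C X (Dom C m)" unfolding i using u o by simp
      finally show "x = Zero C X (Dom C r)" using u m' X by auto
    qed (fact rA)
    \<comment> \<open>Exactness provides a kernel \<open>m2\<close> of \<open>g\<close> that is also
      a kernel of \<open>c\<close>. The mono \<open>r\<close> is a kernel of \<open>c\<close> too,
      so \<open>r\<close> and \<open>m2\<close> factor through each other and \<open>r\<close> is a
      kernel of \<open>g\<close>.\<close>
    obtain m2 c where c: "is_cokernel C c r" "is_kernel C m2 c" "is_kernel C m2 g"
      using r by (auto simp: exact_at_def is_image_def)
    note c' = is_cokernel_simps [OF c(1)] and m2 = is_kernel_simps [OF c(2)] is_kernel_simps [OF c(3)]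
    have rc: "is_kernel C r c" by (rule mono_is_kernel_of_cokernel [OF rmono c(1)])
    have "is_kernel C r g"
    proof (rule is_kernelI)
      obtain w where w: "w \<in> Arr C" "Dom C w = Dom C r" "Cod C w = Dom C m2" "m2 \<odot> w = r"
        by (rule is_kernel_lift [OF c(2), of r]) (use c' in auto)
      have "g \<odot> (m2 \<odot> w) = Zero C (Dom C m2) (Cod C g) \<odot> w"
        by (rule Comp_eq_reassoc) (use m2 w in simp_all)
      then show "g \<odot> r = Zero C (Dom C r) (Cod C g)" using w m2 by simp
    next
      fix h assume h: "h \<in> Arr C" "Cod C h = Dom C g" "g \<odot> h = Zero C (Dom C h) (Cod C g)"
      obtain w where w: "w \<in> Arr C" "Dom C w = Dom C h" "Cod C w = Dom C m2" "m2 \<odot> w = h"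
        by (rule is_kernel_lift [OF c(3), of h]) (use h in auto)
      have "c \<odot> (m2 \<odot> w) = Zero C (Dom C m2) (Cod C c) \<odot> w"
        by (rule Comp_eq_reassoc) (use m2 w in simp_all)
      then have "c \<odot> h = Zero C (Dom C h) (Cod C c)" using w m2 by simp
      then obtain u where "u \<in> Arr C" "Dom C u = Dom C h" "Cod C u = Dom C r" "r \<odot> u = h"
        using is_kernel_lift [OF rc, of h] h c' m2 by metis
      then show "\<exists>u\<in>Arr C. Dom C u = Dom C h \<and> Cod C u = Dom C r \<and> r \<odot> u = h" by blast
    qed (use m2 c' rmono in auto)
    then show ?thesis using Nil Y by (intro exI [of _ r] exI [of _ "[]"]) simp
  next
    case (Cons r' rs')
    then have "exact_chain r rs (Zero C Z Y)" "rs \<noteq> []" "Y = Dom C (last rs)"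
      using Cons.prems by auto
    from Cons.IH [OF this(1) Cons.prems(2) this(2,3)] obtain k S where
      k: "is_kernel C k r" "ses_chain (Dom C k) S Y" "length rs = Suc (length S)"
        "rs = splice_rev k S" by blast
    obtain m e where m: "is_kernel C m g" "epi_arr C e" "e \<in> Arr C" "Dom C e = Dom C r"
      "Cod C e = Dom C m" "m \<odot> e = r"
      by (rule exact_at_factor [OF r]) (rule that)
    note m' = is_kernel_simps [OF m(1)] and k' = is_kernel_simps [OF k(1)]
    have mm: "mono_arr C m" by (rule is_kernel_mono [OF m(1)])
    have cr: "Cod C r = Cod C m" using m m' by auto
    have "is_kernel C k e"
    proof (rule is_kernelI)
      show "e \<odot> k = Zero C (Dom C k) (Cod C e)"
      proof (rule mono_arrD [OF mm])
        have "m \<odot> (e \<odot> k) = r \<odot> k" by (rule Comp_eq_reassoc) (use m m' k' in simp_all)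
        then show "m \<odot> (e \<odot> k) = m \<odot> Zero C (Dom C k) (Cod C e)" using k' cr m m' by simp
      qed (use m m' k' in auto)
    next
      fix h assume h: "h \<in> Arr C" "Cod C h = Dom C e" "e \<odot> h = Zero C (Dom C h) (Cod C e)"
      have "m \<odot> (e \<odot> h) = r \<odot> h" by (rule Comp_eq_reassoc) (use m m' h in simp_all)
      then have "r \<odot> h = Zero C (Dom C h) (Cod C r)" using h m m' cr by simp
      then obtain u where "u \<in> Arr C" "Dom C u = Dom C h" "Cod C u = Dom C k" "k \<odot> u = h"
        using is_kernel_lift [OF k(1), of h] h m by metis
      then show "\<exists>u\<in>Arr C. Dom C u = Dom C h \<and> Cod C u = Dom C k \<and> k \<odot> u = h" by blast
    qed (use m k' is_kernel_mono [OF k(1)] in auto)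
    then have "ses k e" by (rule epi_kernel_ses [OF m(2)])
    then show ?thesis using m k by (intro exI [of _ m] exI [of _ "(k, e) # S"]) simp
  qed
qed simp

lemma mono_zero_kernel:
  assumes "mono_arr C m" "zero_object C Z"
  shows "is_kernel C (Zero C Z (Dom C m)) m"
proof -
  note Z = zero_object_simps [OF assms(2)]
  have m: "m \<in> Arr C" using assms by (simp add: mono_arr_def)
  show ?thesis
  proof (rule is_kernelI)
    show "mono_arr C (Zero C Z (Dom C m))"
      by (rule mono_arrI) (use Z m in auto)
  next
    fix g assume g: "g \<in> Arr C" "Cod C g = Dom C m" "m \<odot> g = Zero C (Dom C g) (Cod C m)"
    have "g = Zero C (Dom C g) (Dom C m)"
      by (rule mono_arrD [OF assms(1)]) (use g m in auto)
    then have "Zero C Z (Dom C m) \<odot> Zero C (Dom C g) Z = g" using g m Z by simp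
    then show "\<exists>u\<in>Arr C. Dom C u = Dom C g \<and> Cod C u = Dom C (Zero C Z (Dom C m)) \<and> Zero C Z (Dom C m) \<odot> u = g"
      using Z g m by (intro bexI [of _ "Zero C (Dom C g) Z"]) auto
  qed (use Z m in auto)
qed

lemma Id_epi: "X \<in> Obj C \<Longrightarrow> epi_arr C (Id C X)"
  by (rule epi_arrI) auto

lemma Id_mono: "X \<in> Obj C \<Longrightarrow> mono_arr C (Id C X)"
  by (rule mono_arrI) auto

lemma is_kernel_mono_Comp:
  assumes "is_kernel C k f" "mono_arr C m" "Dom C m = Cod C f"
  shows "is_kernel C k (m \<odot> f)"
proof -
  note f = is_kernel_simps [OF assms(1)]
  have m: "m \<in> Arr C" using assms by (simp add: mono_arr_def)
  show ?thesis
  proof (rule is_kernelI)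
    fix h assume h: "h \<in> Arr C" "Cod C h = Dom C (m \<odot> f)"
      "(m \<odot> f) \<odot> h = Zero C (Dom C h) (Cod C (m \<odot> f))"
    have "f \<odot> h = Zero C (Dom C h) (Cod C f)"
      by (rule mono_arrD [OF assms(2)]) (use h f m assms in auto)
    then obtain u where "u \<in> Arr C" "Dom C u = Dom C h" "Cod C u = Dom C k" "k \<odot> u = h"
      using is_kernel_lift [OF assms(1), of h] h f m assms by auto
    then show "\<exists>u\<in>Arr C. Dom C u = Dom C h \<and> Cod C u = Dom C k \<and> k \<odot> u = h" by blast
  qed (use f m assms is_kernel_mono [OF assms(1)] in auto)
qed

lemma splice_imp_exact_chain:
  assumes "is_kernel C m g" "ses_chain (Dom C m) S Y" "zero_object C Z"
  shows "exact_chain g (splice_rev m S) (Zero C Z Y)"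
  using assms
proof (induction S arbitrary: m g)
  case Nil
  note Z = zero_object_simps [OF Nil(3)] and m = is_kernel_simps [OF Nil(1)]
  have "is_kernel C (Zero C Z (Dom C m)) m"
    by (rule mono_zero_kernel [OF is_kernel_mono [OF Nil(1)] Nil(3)])
  from exact_at_Comp [OF this Id_epi [OF Z(1)]] have "exact_at C (Zero C Z (Dom C m)) m"
    using Z m by simp
  moreover have "exact_at C m g" using exact_at_Comp [OF Nil(1) Id_epi [of "Dom C m"]] m by simp
  ultimately show ?case using Nil by auto
next
  case (Cons e S)
  obtain k f where e: "e = (k, f)" by force
  have s: "ses k f" "Cod C f = Dom C m" "ses_chain (Dom C k) S Y" using Cons.prems e by auto
  note f = ses_simps [OF s(1)] and m = is_kernel_simps [OF Cons.prems(1)]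
  have mm: "mono_arr C m" by (rule is_kernel_mono [OF Cons.prems(1)])
  have "is_kernel C k (m \<odot> f)"
    by (rule is_kernel_mono_Comp [OF f(7) mm]) (use s in simp)
  from Cons.IH [OF this s(3) Cons.prems(3)] show ?case
    using exact_at_Comp [OF Cons.prems(1) f(6) s(2)] unfolding e by simp
qed

lemma Cod_last_splice: "X \<in> Obj C \<Longrightarrow> ses_chain X S Y \<Longrightarrow> Cod C (last (splice X S)) = X"
  by (cases "(Id C X, S)" rule: splice_rev.cases) (auto simp: splice_def dest: ses_simps(1))

lemma Dom_last_splice_rev:
  assumes "ses_chain (Dom C m) S Y" shows "Dom C (last (splice_rev m S)) = Y"
  using assms
proof (induction m S rule: splice_rev.induct)
  case (2 m k f S)
  then have "splice_rev k S \<noteq> []" by (metis length_splice_rev list.size(3) nat.distinct(1))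
  then show ?case using 2 by simp
qed auto

lemma extensions_iff:
  assumes "n \<ge> 1"
  shows "fs \<in> extensions C n X Y \<longleftrightarrow> (\<exists>S. ses_chain X S Y \<and> length S = n \<and> fs = splice X S)"
proof
  assume "fs \<in> extensions C n X Y"
  then obtain Z where fs: "length fs = Suc n" "zero_object C Z" "Dom C (hd fs) = Y"
    "Cod C (last fs) = X" "fs \<noteq> []"
    and ex: "exact_seq C (Zero C Z Y # fs @ [Zero C X Z])"
    by (auto simp: extensions_def bounded_exact_def)
  note Z = zero_object_simps [OF fs(2)]
  have ch: "exact_chain (Zero C X Z) (rev fs) (Zero C Z Y)"
    using ex exact_seq_iff_exact_chain by blast
  have Y: "Y = Dom C (last (rev fs))" using fs by (simp add: last_rev)
  obtain m S where m: "is_kernel C m (Zero C X Z)" "ses_chain (Dom C m) S Y"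
    "length fs = Suc (length S)" "rev fs = splice_rev m S"
    using exact_chain_imp_splice [OF ch fs(2) _ Y] fs(5) by auto
  have "last fs \<in> Arr C" using exact_chain_Arr [OF ch] fs(5) by auto
  then have X: "X \<in> Obj C" using fs(4) by auto
  note m' = is_kernel_simps [OF m(1)]
  have mX: "Cod C m = X" using m' X Z by simp
  \<comment> \<open>Cutting ends with a kernel \<open>m\<close> of the map from \<open>X\<close> to
    zero, an isomorphism onto \<open>X\<close> but not an identity. It is absorbed into the epi of
    the first piece, which exists because \<open>n\<close> is positive.\<close>
  obtain v where v: "v \<in> Arr C" "Dom C v = X" "Cod C v = Dom C m" "m \<odot> v = Id C X"
    by (rule is_kernel_lift [OF m(1), of "Id C X"]) (use X Z in auto)
  have em: "epi_arr C m" by (rule epi_arr_cancel [of m v]) (use v mX m' X Id_epi in auto)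
  obtain k f T where S: "S = (k, f) # T" "length T = n - 1"
    using m(3) fs(1) assms by (cases S) auto
  have s: "ses k f" "Cod C f = Dom C m" "ses_chain (Dom C k) T Y" using m(2) S by auto
  note f = ses_simps [OF s(1)]
  have mf: "m \<odot> f \<in> Arr C" "Dom C (m \<odot> f) = Dom C f" "Cod C (m \<odot> f) = X" using m' f s mX by simp_all
  have "is_kernel C k (m \<odot> f)"
    by (rule is_kernel_mono_Comp [OF f(7) is_kernel_mono [OF m(1)]]) (use s in simp)
  then have "ses k (m \<odot> f)" by (intro epi_kernel_ses epi_arr_Comp) (use em f s in auto)
  then have "ses_chain X ((k, m \<odot> f) # T) Y" using s mf by simp
  moreover have "rev fs = splice_rev (Id C X) ((k, m \<odot> f) # T)" using m(4) S mf X by simp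
  then have "fs = splice X ((k, m \<odot> f) # T)" unfolding splice_def by (metis rev_rev_ident)
  moreover have "length ((k, m \<odot> f) # T) = n" using S assms by simp
  ultimately show "\<exists>S. ses_chain X S Y \<and> length S = n \<and> fs = splice X S" by blast
next
  assume "\<exists>S. ses_chain X S Y \<and> length S = n \<and> fs = splice X S"
  then obtain S where S: "ses_chain X S Y" "length S = n" "fs = splice X S" by blast
  have X: "X \<in> Obj C" using ses_chain_Obj S by blast
  obtain Z where Z': "zero_object C Z" using ex_zero_object by blast
  note Z = zero_object_simps [OF Z']
  have "is_kernel C (Id C X) (Zero C X Z)"
    by (rule is_kernelI) (use X Z Id_mono in \<open>auto intro!: bexI\<close>)
  from splice_imp_exact_chain [OF this _ Z', of S Y]
  have "exact_seq C (Zero C Z Y # fs @ [Zero C X Z])"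
    using S X by (simp add: exact_seq_iff_exact_chain splice_def)
  moreover have l: "length fs = Suc n" using S by (simp add: splice_def)
  moreover have "fs \<noteq> []" using l by auto
  moreover have "Cod C (last fs) = X" using Cod_last_splice [OF X S(1)] S by simp
  moreover have "Dom C (hd fs) = Y"
    using Dom_last_splice_rev [of "Id C X" S Y] S X by (simp add: splice_def hd_rev)
  ultimately show "fs \<in> extensions C n X Y"
    using Z' unfolding extensions_def bounded_exact_def by blast
qed

lemma extension_step_iff:
  assumes "ses_chain X S Y" "ses_chain X S' Y" "length S = n" "length S' = n" "n \<ge> 1"
  shows "(splice X S, splice X S') \<in> extension_step C n X Y \<longleftrightarrow> chain_mor (Id C X) S S' (Id C Y)"
proof -
  have X: "X \<in> Obj C" using ses_chain_Obj assms(1) by blast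
  have i: "Id C X \<in> Hom C X X" using X by (simp add: Hom_iff)
  have "splice X S \<in> extensions C n X Y" "splice X S' \<in> extensions C n X Y"
    using assms extensions_iff [OF assms(5)] by blast+
  then have "(splice X S, splice X S') \<in> extension_step C n X Y \<longleftrightarrow>
    ladder (Id C X) (splice_rev (Id C X) S) (splice_rev (Id C X) S') (Id C Y)"
    using extension_morphism_iff [of "splice X S" n "splice X S'" X Y] assms
    by (simp add: extension_step_def splice_def)
  also have "\<dots> \<longleftrightarrow> chain_mor (Id C X) S S' (Id C Y)"
  proof
    assume "ladder (Id C X) (splice_rev (Id C X) S) (splice_rev (Id C X) S') (Id C Y)"
    from ladder_imp_mor [OF this assms(1,2) i i i] assms obtain \<gamma> where
      "\<gamma> \<in> Hom C X X" "Id C X \<odot> Id C X = Id C X \<odot> \<gamma>" "chain_mor \<gamma> S S' (Id C Y)" by auto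
    then show "chain_mor (Id C X) S S' (Id C Y)" using X by (simp add: Hom_iff)
  next
    assume "chain_mor (Id C X) S S' (Id C Y)"
    from chain_mor_imp_ladder [OF this assms(1,2) i i i i]
    show "ladder (Id C X) (splice_rev (Id C X) S) (splice_rev (Id C X) S') (Id C Y)" by simp
  qed
  finally show ?thesis .
qed

lemma null_chain_yoneda_equiv:
  assumes "(splice X S, gs) \<in> yoneda_equiv C n X Y" "ses_chain X S Y" "length S = n" "n \<ge> 1"
    "null_chain X S Y"
  shows "\<exists>S'. ses_chain X S' Y \<and> length S' = n \<and> gs = splice X S' \<and> null_chain X S' Y"
  using assms(1) unfolding yoneda_equiv_def
proof (induction rule: rtrancl_induct)
  case base
  then show ?case using assms by blast
next
  case (step gs hs)
  then obtain S' where S': "ses_chain X S' Y" "length S' = n" "gs = splice X S'"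
    "null_chain X S' Y" by blast
  have "hs \<in> extensions C n X Y" using step(2) by (auto simp: extension_step_def)
  then obtain T where T: "ses_chain X T Y" "length T = n" "hs = splice X T"
    using extensions_iff [OF assms(4)] by blast
  from step(2) have "chain_mor (Id C X) S' T (Id C Y) \<or> chain_mor (Id C X) T S' (Id C Y)"
    using extension_step_iff S' T assms(4) by auto
  moreover have "S' \<noteq> []" using S'(2) assms(4) by auto
  ultimately have "null_chain X T Y"
    using null_chain_mor [OF S'(4,1) T(1)] null_chain_mor_back [OF S'(4,1) T(1)] by auto
  then show ?case using T by blast
qed

section \<open>Vanishing of Ext\<close>

text \<open>Chains with equal splices may differ in their syzygies. The identity ladder between the
  splices becomes a chain morphism with identities at both ends.\<close>

lemma null_chain_splice_cong:
  assumes "splice X S = splice X T" "ses_chain X S Y" "ses_chain X T Y" "length S = n"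
    "length T = n" "n \<ge> 1" "null_chain X S Y"
  shows "null_chain X T Y"
proof -
  have "(splice X S, splice X S) \<in> extension_step C n X Y"
    using extension_step_iff [OF assms(2,2,4,4,6)] chain_mor_Id [OF assms(2)] by simp
  then have "chain_mor (Id C X) S T (Id C Y)"
    using extension_step_iff [OF assms(2,3,4,5,6)] assms(1) by simp
  then show ?thesis by (rule null_chain_mor [OF assms(7,2,3)])
qed

section \<open>Trivial extensions\<close>

lemma ses_Zero_Id:
  assumes "zero_object C Z" "X \<in> Obj C" shows "ses (Zero C Z X) (Id C X)"
  using epi_kernel_ses [OF Id_epi] mono_zero_kernel [OF Id_mono assms(1)] assms by simp

lemma ses_Id_Zero:
  assumes "zero_object C Z" "X \<in> Obj C" shows "ses (Id C X) (Zero C X Z)"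
proof (rule epi_kernel_ses)
  note Z = zero_object_simps [OF assms(1)]
  show "is_kernel C (Id C X) (Zero C X Z)"
    by (rule is_kernelI) (use assms Z Id_mono in \<open>auto intro!: bexI\<close>)
  show "epi_arr C (Zero C X Z)"
  proof (rule epi_arrI)
    fix Y g assume g: "g \<in> Arr C" "Dom C g = Cod C (Zero C X Z)" "Cod C g = Y"
    then have "Dom C g = Z" using assms Z by simp
    from Z(3) [OF g(1) this] show "g = Zero C (Cod C (Zero C X Z)) Y" using assms Z g by simp
  qed (use assms Z in simp)
qed

lemma ses_chain_zeros:
  assumes "zero_object C Z" shows "ses_chain Z (replicate j (Zero C Z Z, Zero C Z Z)) Z"
  using ses_Zero_Id [OF assms, of Z] zero_object_simps [OF assms] by (induction j) simp_all

text \<open>Zero pieces pad a witness to the length that \<open>chain_mor\<close> requires.\<close>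

lemma chain_mor_from_zeros:
  assumes "ses_chain L S Y" "zero_object C Z"
  shows "chain_mor (Zero C Z L) (replicate (length S) (Zero C Z Z, Zero C Z Z)) S (Zero C Z Y)"
  using assms(1)
proof (induction S arbitrary: L)
  case Nil
  then show ?case using zero_object_simps [OF assms(2)] by auto
next
  case (Cons e S)
  obtain k f where e: "e = (k, f)" by force
  have s: "ses k f" "Cod C f = L" "ses_chain (Dom C k) S Y" using Cons.prems e by auto
  note f = ses_simps(1-3) [OF s(1)] and Z = zero_object_simps(1) [OF assms(2)]
  have o: "L \<in> Obj C" "Dom C k \<in> Obj C" "Dom C f \<in> Obj C" using s f by auto
  show ?case unfolding e length_Cons replicate_Suc
    by (rule chain_mor_ConsI [OF _ _ _ _ _ Cons.IH [OF s(3)], where h = "Zero C Z (Dom C f)"])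
      (use o f s Z in \<open>simp_all add: Hom_iff\<close>)
qed

lemma chain_mor_to_zeros:
  assumes "ses_chain L S Y" "zero_object C Z"
  shows "chain_mor (Zero C L Z) S (replicate (length S) (Zero C Z Z, Zero C Z Z)) (Zero C Y Z)"
  using assms(1)
proof (induction S arbitrary: L)
  case Nil
  then show ?case using zero_object_simps [OF assms(2)] by auto
next
  case (Cons e S)
  obtain k f where e: "e = (k, f)" by force
  have s: "ses k f" "Cod C f = L" "ses_chain (Dom C k) S Y" using Cons.prems e by auto
  note f = ses_simps(1-3) [OF s(1)] and Z = zero_object_simps(1) [OF assms(2)]
  have o: "L \<in> Obj C" "Dom C k \<in> Obj C" "Dom C f \<in> Obj C" using s f by auto
  show ?case unfolding e length_Cons replicate_Suc
    by (rule chain_mor_ConsI [OF _ _ _ _ _ Cons.IH [OF s(3)], where h = "Zero C (Dom C f) Z"])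
      (use o f s Z in \<open>simp_all add: Hom_iff\<close>)
qed

text \<open>The section \<open>s\<close> is the middle component of a morphism from
  \<open>0 \<rightarrow> X \<rightarrow> X\<close>; everything further left of this witness is
  zero.\<close>

lemma null_chain_of_section:
  assumes "ses_chain X ((k, f) # S) Y" "s \<in> Hom C X (Dom C f)" "f \<odot> s = Id C X"
  shows "null_chain X ((k, f) # S) Y"
proof -
  obtain Z where Z': "zero_object C Z" using ex_zero_object by blast
  note Z = zero_object_simps(1) [OF Z']
  have e: "ses k f" "Cod C f = X" "ses_chain (Dom C k) S Y" using assms by auto
  note f = ses_simps(1-3) [OF e(1)]
  have X: "X \<in> Obj C" using f e by auto
  let ?R = "replicate (length S) (Zero C Z Z, Zero C Z Z)"
  have "chain_mor (Id C X) ((Zero C Z X, Id C X) # ?R) ((k, f) # S) (Zero C Z Y)"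
    by (rule chain_mor_ConsI [OF _ _ _ _ _ chain_mor_from_zeros [OF e(3) Z'], where h = s])
      (use X f e Z assms(2,3) in \<open>simp_all add: Hom_iff\<close>)
  moreover have "ses_chain X ((Zero C Z X, Id C X) # ?R) Z"
    using ses_Zero_Id [OF Z' X] ses_chain_zeros [OF Z'] X Z by simp
  ultimately show ?thesis unfolding null_chain_def by blast
qed

text \<open>In length one nullity means splitting: the middle component \<open>h\<close> of a
  witness kills \<open>k'\<close>, so it descends along \<open>f'\<close> to a section.\<close>

lemma null_chain_single:
  assumes "null_chain X [(k, f)] Y" "ses_chain X [(k, f)] Y"
  obtains s where "s \<in> Hom C X (Dom C f)" "f \<odot> s = Id C X"
proof -
  obtain P N where P: "ses_chain X P N" "chain_mor (Id C X) P [(k, f)] (Zero C N Y)"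
    using assms by (auto simp: null_chain_def)
  have "length P = Suc 0" using chain_mor_length [OF P(2)] by simp
  then obtain k' f' where P': "P = [(k', f')]" by (metis length_0_conv length_Suc_conv surj_pair)
  have e: "ses k' f'" "Cod C f' = X" "Dom C k' = N" "N \<in> Obj C" "ses k f" "Cod C f = X"
    "Dom C k = Y" "Y \<in> Obj C"
    using P assms P' ses_chain_Obj by auto
  note f = ses_simps [OF e(1)] ses_simps [OF e(5)]
  have X: "X \<in> Obj C" using e f by auto
  obtain h where h: "h \<in> Arr C" "Dom C h = Dom C f'" "Cod C h = Dom C f" "f \<odot> h = Id C X \<odot> f'"
    "h \<odot> k' = k \<odot> Zero C N Y"
    using P(2) unfolding P' by (auto simp: Hom_iff)
  obtain u where u: "u \<in> Arr C" "Dom C u = Cod C f'" "Cod C u = Cod C h" "u \<odot> f' = h"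
    by (rule is_cokernel_desc [OF f(8), of h]) (use h e f in auto)
  have "f \<odot> u = Id C X"
    by (rule epi_arrD [OF f(6)]) (use u h e f X in auto)
  then show ?thesis using that [of u] u h e by (simp add: Hom_iff)
qed

text \<open>\<open>W\<close> is general because the recursion consumes zero pieces from the right
  and replaces it by \<open>Z\<close>.\<close>

lemma splice_zeros:
  assumes "zero_object C Z" "Y \<in> Obj C" "W \<in> Obj C"
  shows "splice_rev (Zero C Z W) (replicate j (Zero C Z Z, Zero C Z Z) @ [(Id C Y, Zero C Y Z)]) =
    rev (map2 (Zero C) (Y # replicate j Z) (replicate j Z @ [W])) @ [Id C Y]"
  using assms(3)
proof (induction j arbitrary: W)
  case 0
  then show ?case using assms zero_object_simps [OF assms(1)] by simp
next
  case (Suc j)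
  have 1: "Y # replicate (Suc j) Z = (Y # replicate j Z) @ [Z]"
    by (simp add: replicate_append_same)
  have 2: "replicate (Suc j) Z @ [W] = (replicate j Z @ [Z]) @ [W]"
    by (simp add: replicate_append_same)
  have "rev (map2 (Zero C) (Y # replicate (Suc j) Z) (replicate (Suc j) Z @ [W])) =
    Zero C Z W # rev (map2 (Zero C) (Y # replicate j Z) (replicate j Z @ [Z]))"
    unfolding 1 2 by (subst zip_append) auto
  then show ?case
    using Suc.IH [of Z] Suc.prems zero_object_simps [OF assms(1)] by simp
qed

lemma is_biproduct_ses:
  assumes B: "is_biproduct C X Y M i j p q"
  shows "ses i q"
proof -
  note b = is_biproduct_simps [OF B]
  have "epi_arr C q" by (rule epi_arr_cancel [of q j]) (use b Id_epi in auto)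
  moreover have "is_kernel C i q"
  proof (rule is_kernelI)
    show "mono_arr C i"
    proof (rule mono_arrI)
      fix V g assume g: "g \<in> Arr C" "Dom C g = V" "Cod C g = Dom C i" "i \<odot> g = Zero C V (Cod C i)"
      have "p \<odot> (i \<odot> g) = Zero C V X" unfolding g(4) using g b by auto
      moreover have "p \<odot> (i \<odot> g) = g" using g(1-3) b by simp
      ultimately show "g = Zero C V (Dom C i)" using b by simp
    qed (use b in auto)
  next
    fix g assume g: "g \<in> Arr C" "Cod C g = Dom C q" "q \<odot> g = Zero C (Dom C g) (Cod C q)"
    have "i \<odot> (p \<odot> g) = g"
      by (rule is_biproduct_ext [OF B]) (use b g in auto)
    then show "\<exists>u\<in>Arr C. Dom C u = Dom C g \<and> Cod C u = Dom C i \<and> i \<odot> u = g"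
      using b g by (intro bexI [of _ "p \<odot> g"]) auto
  qed (use b in auto)
  ultimately show ?thesis by (rule epi_kernel_ses)
qed

text \<open>
  With \<open>P \<rightarrow> T\<close> witnessing that \<open>T\<close> is null and \<open>M\<close> the leftmost syzygy of \<open>P\<close>, the chain \<open>U\<close> is \<open>P\<close>
  with its last sequence replaced by \<open>0 \<rightarrow> Y \<rightarrow> Y \<oplus> M \<rightarrow> M \<rightarrow> 0\<close>.
\<close>

lemma trivial_extension_null_chain:
  assumes "trivial_extension C n X Y fs" "X \<in> Obj C" "Y \<in> Obj C" "n \<ge> 1"
  obtains S where "ses_chain X S Y" "length S = n" "fs = splice X S" "null_chain X S Y"
    "\<And>T. \<lbrakk>ses_chain X T Y; length T = n; null_chain X T Y\<rbrakk> \<Longrightarrow> \<exists>U. ses_chain X U Y \<and> length U = n \<and>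
      chain_mor (Id C X) U T (Id C Y) \<and> chain_mor (Id C X) U S (Id C Y)"
proof (cases "n = 1")
  case True
  then obtain M i j p q where B: "is_biproduct C Y X M i j p q" and fs: "fs = [i, q]"
    using assms(1) by (auto simp: trivial_extension_def)
  note b = is_biproduct_simps [OF B]
  have iq: "ses i q" by (rule is_biproduct_ses [OF B])
  have S: "ses_chain X [(i, q)] Y" using iq b by simp
  show ?thesis
  proof (rule that [OF S])
    show "fs = splice X [(i, q)]" using fs b by (simp add: splice_def)
    show "null_chain X [(i, q)] Y"
      by (rule null_chain_of_section [OF S, of j]) (use b in \<open>auto simp: Hom_iff\<close>)
    fix T assume T: "ses_chain X T Y" "length T = n" "null_chain X T Y"
    obtain k f where T': "T = [(k, f)]"
      using T(2) True by (metis One_nat_def length_0_conv length_Suc_conv surj_pair)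
    have e: "ses k f" "Cod C f = X" "Dom C k = Y" using T T' by auto
    note f = ses_simps(1-4) [OF e(1)]
    obtain s where s: "s \<in> Hom C X (Dom C f)" "f \<odot> s = Id C X"
      using null_chain_single T unfolding T' by blast
    have s': "s \<in> Arr C" "Dom C s = X" "Cod C s = Dom C f" using s by (auto simp: Hom_iff)
    \<comment> \<open>Together with the section \<open>s\<close>, the map \<open>k p + s q\<close>
      sends the split sequence to \<open>T\<close>, so that sequence itself serves as
      \<open>U\<close>.\<close>
    have "f \<odot> (k \<odot> p) = Zero C M X"
      using Comp_eq_reassoc [OF f(4), of p] b f e by simp
    moreover have "f \<odot> (s \<odot> q) = q" using Comp_eq_reassoc [OF s(2), of q] b f e s' by simp
    ultimately have fh: "f \<odot> (k \<odot> p \<oplus> s \<odot> q) = Id C X \<odot> q" using b f e s' by simp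
    have hi: "(k \<odot> p \<oplus> s \<odot> q) \<odot> i = k \<odot> Id C Y" using b f e s' by simp
    have "chain_mor (Id C X) [(i, q)] T (Id C Y)" unfolding T'
      by (rule chain_mor_ConsI [OF _ _ _ fh hi]) (use b f e s' in \<open>simp_all add: Hom_iff\<close>)
    then show "\<exists>U. ses_chain X U Y \<and> length U = n \<and> chain_mor (Id C X) U T (Id C Y) \<and> chain_mor (Id C X) U [(i, q)] (Id C Y)"
      using S chain_mor_Id [OF S] True assms(3) by (intro exI [of _ "[(i, q)]"]) simp
  qed (use True in simp)
next
  case False
  \<comment> \<open>The trivial extension is cut into one piece for \<open>X = X\<close>,
    \<open>j\<close> zero pieces and one piece for \<open>Y = Y\<close>, hence the offset 2.\<close>
  define j where "j = n - 2"
  have n: "n = Suc (Suc j)" using False assms(4) by (simp add: j_def)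
  obtain Z where Z': "zero_object C Z" and
    fs: "fs = Id C Y # map2 (Zero C) (Y # replicate j Z) (replicate j Z @ [X]) @ [Id C X]"
    using assms(1) False unfolding trivial_extension_def j_def by auto
  note Z = zero_object_simps(1) [OF Z']
  let ?R = "replicate j (Zero C Z Z, Zero C Z Z)"
  define S where "S = ((Zero C Z X, Id C X) # ?R) @ [(Id C Y, Zero C Y Z)]"
  have eA: "ses_chain X ((Zero C Z X, Id C X) # ?R) Z"
    using ses_Zero_Id [OF Z' assms(2)] ses_chain_zeros [OF Z'] assms Z by simp
  have eS: "ses_chain X S Y" unfolding S_def ses_chain_append
    using eA ses_Id_Zero [OF Z' assms(3)] assms Z by auto
  show ?thesis
  proof (rule that [OF eS])
    show "length S = n" by (simp add: S_def n)
    have "rev fs = splice_rev (Id C X) S"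
      unfolding fs S_def using splice_zeros [OF Z' assms(3,2), of j] assms by simp
    then show "fs = splice X S" unfolding splice_def by (metis rev_rev_ident)
    have "null_chain X ((Zero C Z X, Id C X) # (?R @ [(Id C Y, Zero C Y Z)])) Y"
      by (rule null_chain_of_section [of _ _ _ _ _ "Id C X"]) (use eS assms in \<open>auto simp: S_def Hom_iff\<close>)
    then show "null_chain X S Y" by (simp add: S_def)
    fix T assume T: "ses_chain X T Y" "length T = n" "null_chain X T Y"
    obtain P N where P: "ses_chain X P N" "chain_mor (Id C X) P T (Zero C N Y)"
      using T by (auto simp: null_chain_def)
    obtain B k f where B: "T = B @ [(k, f)]" "length B = Suc j"
      using T(2) n by (metis length_Suc_conv_rev surj_pair)
    have "length P = Suc (Suc j)" using chain_mor_length [OF P(2)] T n by simp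
    then obtain A pk pf where A: "P = A @ [(pk, pf)]" "length A = Suc j"
      by (metis length_Suc_conv_rev surj_pair)
    obtain M L where s: "ses_chain X A M" "ses pk pf" "Cod C pf = M" "Dom C pk = N"
      "ses_chain X B L" "ses k f" "Cod C f = L" "Dom C k = Y"
      using P(1) T(1) A B by (auto simp: ses_chain_append)
    have lAB: "length A = length B" using A B by simp
    obtain \<gamma> h where g: "chain_mor (Id C X) A B \<gamma>" "\<gamma> \<in> Hom C M L" "h \<in> Hom C (Dom C pf) (Dom C f)"
      "f \<odot> h = \<gamma> \<odot> pf" "h \<odot> pk = k \<odot> Zero C N Y"
      using P(2) s unfolding A(1) B(1) chain_mor_append [OF lAB] by auto
    note e = ses_simps [OF s(2)] and e' = ses_simps [OF s(6)]
    have o: "M \<in> Obj C" "L \<in> Obj C" "N \<in> Obj C" using s e e' by auto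
    have h: "h \<in> Arr C" "Dom C h = Dom C pf" "Cod C h = Dom C f" "\<gamma> \<in> Arr C" "Dom C \<gamma> = M"
      "Cod C \<gamma> = L"
      using g by (simp_all add: Hom_iff)
    \<comment> \<open>The left component of the witness is zero, so \<open>h\<close> kills
      \<open>pk\<close> and descends to a lift \<open>u\<close> of \<open>\<gamma>\<close> through
      \<open>f\<close>. On the biproduct, \<open>k p + u q\<close> then maps the new last piece to
      that of \<open>T\<close>.\<close>
    obtain u where u: "u \<in> Arr C" "Dom C u = M" "Cod C u = Dom C f" "u \<odot> pf = h"
      using is_cokernel_desc [OF e(8), of h] g(5) h e e' s o assms by auto
    have fu: "f \<odot> u = \<gamma>"
      by (rule epi_arrD [OF e(6)]) (use g(4) u h e e' s in auto)
    obtain W i i' p q where W: "is_biproduct C Y M W i i' p q" using ex_biproduct o assms by blast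
    note b = is_biproduct_simps [OF W]
    have iq: "ses i q" by (rule is_biproduct_ses [OF W])
    let ?U = "A @ [(i, q)]"
    have U: "ses_chain X ?U Y" using s(1) iq b by (auto simp: ses_chain_append)
    have "f \<odot> (k \<odot> p) = Zero C W L"
      using Comp_eq_reassoc [OF e'(4), of p] b e' s o by simp
    moreover have "f \<odot> (u \<odot> q) = \<gamma> \<odot> q" using Comp_eq_reassoc [OF fu, of q] b e' s u by simp
    ultimately have fh: "f \<odot> (k \<odot> p \<oplus> u \<odot> q) = \<gamma> \<odot> q" using b e' s u h by simp
    have hi: "(k \<odot> p \<oplus> u \<odot> q) \<odot> i = k \<odot> Id C Y" using b e' s u by simp
    have "chain_mor \<gamma> [(i, q)] [(k, f)] (Id C Y)"
      by (rule chain_mor_ConsI [OF _ _ _ fh hi]) (use b e' s u h in \<open>simp_all add: Hom_iff\<close>)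
    then have UT: "chain_mor (Id C X) ?U T (Id C Y)" unfolding B(1) chain_mor_append [OF lAB]
      using g(1) by blast
    obtain pk1 pf1 A1 where A1: "A = (pk1, pf1) # A1" "length A1 = j"
      using A(2) by (metis length_Suc_conv surj_pair)
    have s1: "ses pk1 pf1" "Cod C pf1 = X" "ses_chain (Dom C pk1) A1 M" using s(1) A1 by auto
    note e1 = ses_simps(1-4) [OF s1(1)]
    \<comment> \<open>The second leg of the roof: \<open>pf1\<close> covers \<open>X = X\<close>,
      zero maps fill the middle, and the projection \<open>p\<close> covers
      \<open>Y = Y\<close>.\<close>
    have "chain_mor (Zero C (Dom C pk1) Z) A1 ?R (Zero C M Z)"
      using chain_mor_to_zeros [OF s1(3) Z'] A1(2) by simp
    then have m1: "chain_mor (Id C X) A ((Zero C Z X, Id C X) # ?R) (Zero C M Z)"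
      unfolding A1(1)
        by - (rule chain_mor_ConsI [where h = pf1 and \<gamma> = "Zero C (Dom C pk1) Z"], use e1 s1 assms Z in \<open>simp_all add: Hom_iff\<close>)
    have m2: "chain_mor (Zero C M Z) [(i, q)] [(Id C Y, Zero C Y Z)] (Id C Y)"
      by (rule chain_mor_ConsI [where h = p and \<gamma> = "Id C Y"]) (use b Z in \<open>simp_all add: Hom_iff\<close>)
    have "length A = length ((Zero C Z X, Id C X) # ?R)" using A by simp
    from chain_mor_append [OF this] have "chain_mor (Id C X) ?U S (Id C Y)" unfolding S_def
      using m1 m2 by blast
    moreover have "length ?U = n" using A n by simp
    ultimately show "\<exists>U. ses_chain X U Y \<and> length U = n \<and> chain_mor (Id C X) U T (Id C Y) \<and> chain_mor (Id C X) U S (Id C Y)"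
      using U UT by blast
  qed
qed

section \<open>Vanishing of Ext as nullity of all chains\<close>

lemma ex_trivial_extension:
  assumes "X \<in> Obj C" "Y \<in> Obj C"
  shows "\<exists>fs. trivial_extension C n X Y fs"
proof (cases "n = 1")
  case True
  then show ?thesis using ex_biproduct [OF assms(2,1)] unfolding trivial_extension_def by auto
next
  case False
  then show ?thesis using ex_zero_object unfolding trivial_extension_def by auto
qed

lemma yoneda_equiv_refl: "(fs, fs) \<in> yoneda_equiv C n X Y"
  by (simp add: yoneda_equiv_def)

lemma yoneda_equiv_sym: "(fs, gs) \<in> yoneda_equiv C n X Y \<Longrightarrow> (gs, fs) \<in> yoneda_equiv C n X Y"
  unfolding yoneda_equiv_def by (metis symD sym_Un_converse sym_rtrancl)

lemma yoneda_equiv_trans: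
  "\<lbrakk>(fs, gs) \<in> yoneda_equiv C n X Y; (gs, hs) \<in> yoneda_equiv C n X Y\<rbrakk> \<Longrightarrow> (fs, hs) \<in> yoneda_equiv C n X Y"
  unfolding yoneda_equiv_def by (rule rtrancl_trans)

text \<open>If \<open>Ext\<close> vanishes, each extension is linked to a trivial one, which is
  null, and nullity travels along the zigzag. If all chains are null, each extension and each
  trivial one have a common roof, so there is only one class.\<close>

lemma Ext_vanishes_iff:
  assumes "X \<in> Obj C" "Y \<in> Obj C" "n \<ge> 1"
  shows "Ext_vanishes C n X Y \<longleftrightarrow> (\<forall>S. ses_chain X S Y \<longrightarrow> length S = n \<longrightarrow> null_chain X S Y)"
proof
  assume v: "Ext_vanishes C n X Y"
  show "\<forall>S. ses_chain X S Y \<longrightarrow> length S = n \<longrightarrow> null_chain X S Y"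
  proof (intro allI impI)
    fix S assume S: "ses_chain X S Y" "length S = n"
    then have "splice X S \<in> extensions C n X Y" using extensions_iff [OF assms(3)] by blast
    then have "yoneda_equiv C n X Y `` {splice X S} = Ext_zero C n X Y"
      using v unfolding Ext_vanishes_def Ext_def by (metis quotientI singletonD)
    then obtain t where t: "trivial_extension C n X Y t" "(t, splice X S) \<in> yoneda_equiv C n X Y"
      using yoneda_equiv_refl [of "splice X S" n X Y] unfolding Ext_zero_def by blast
    obtain T where T: "ses_chain X T Y" "length T = n" "t = splice X T" "null_chain X T Y"
      by (rule trivial_extension_null_chain [OF t(1) assms])
    obtain S' where "ses_chain X S' Y" "length S' = n" "splice X S = splice X S'"
      "null_chain X S' Y"
      using null_chain_yoneda_equiv [OF t(2) [unfolded T(3)] T(1,2) assms(3) T(4)] by blast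
    then show "null_chain X S Y" using null_chain_splice_cong [of X S' S Y n] S assms(3) by simp
  qed
next
  assume nul: "\<forall>S. ses_chain X S Y \<longrightarrow> length S = n \<longrightarrow> null_chain X S Y"
  have eqv: "(t, fs) \<in> yoneda_equiv C n X Y"
    if t: "trivial_extension C n X Y t" and fs: "fs \<in> extensions C n X Y" for t fs
  proof -
    obtain F where F: "ses_chain X F Y" "length F = n" "fs = splice X F"
      using fs extensions_iff [OF assms(3)] by blast
    then have nF: "null_chain X F Y" using nul by blast
    obtain T where T: "ses_chain X T Y" "length T = n" "t = splice X T" and
      univ: "\<And>T'. \<lbrakk>ses_chain X T' Y; length T' = n; null_chain X T' Y\<rbrakk> \<Longrightarrow> \<exists>U. ses_chain X U Y \<and> length U = n \<and>
        chain_mor (Id C X) U T' (Id C Y) \<and> chain_mor (Id C X) U T (Id C Y)"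
      by (rule trivial_extension_null_chain [OF t assms]) blast
    obtain U where U: "ses_chain X U Y" "length U = n" "chain_mor (Id C X) U F (Id C Y)"
      "chain_mor (Id C X) U T (Id C Y)"
      using univ [OF F(1,2) nF] by blast
    have "(splice X U, fs) \<in> extension_step C n X Y" "(splice X U, t) \<in> extension_step C n X Y"
      using extension_step_iff U F T assms(3) by simp_all
    then have "(splice X U, fs) \<in> yoneda_equiv C n X Y" "(splice X U, t) \<in> yoneda_equiv C n X Y"
      unfolding yoneda_equiv_def by auto
    then show ?thesis using yoneda_equiv_sym yoneda_equiv_trans by metis
  qed
  \<comment> \<open>The quotient has to equal a singleton, so it must also be inhabited; a trivial
    extension provides the member.\<close>
  obtain t where t: "trivial_extension C n X Y t" using ex_trivial_extension assms by blast
  obtain T where T: "ses_chain X T Y" "length T = n" "t = splice X T"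
    by (rule trivial_extension_null_chain [OF t assms])
  then have tE: "t \<in> extensions C n X Y" using extensions_iff [OF assms(3)] by blast
  have cls: "yoneda_equiv C n X Y `` {fs} = Ext_zero C n X Y" if fs: "fs \<in> extensions C n X Y" for fs
  proof
    show "yoneda_equiv C n X Y `` {fs} \<subseteq> Ext_zero C n X Y"
      unfolding Ext_zero_def using eqv [OF t fs] t yoneda_equiv_trans by blast
    show "Ext_zero C n X Y \<subseteq> yoneda_equiv C n X Y `` {fs}"
      unfolding Ext_zero_def using eqv fs yoneda_equiv_trans yoneda_equiv_sym by blast
  qed
  show "Ext_vanishes C n X Y"
    unfolding Ext_vanishes_def Ext_def
  proof
    show "extensions C n X Y // yoneda_equiv C n X Y \<subseteq> {Ext_zero C n X Y}"
      using cls by (auto simp: quotient_def)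
    show "{Ext_zero C n X Y} \<subseteq> extensions C n X Y // yoneda_equiv C n X Y"
      using cls [OF tE] quotientI [OF tE, of "yoneda_equiv C n X Y"] by simp
  qed
qed

section \<open>Dimension shifting and cotorsion pairs\<close>

text \<open>An extension by \<open>K\<close> is pushed out along \<open>v\<close> to one by
  \<open>B\<close>, which is null; as \<open>u v\<close> is the identity, the pushout maps back to
  the given extension over \<open>u\<close>.\<close>

lemma Ext_vanishes_retract:
  assumes "Ext_vanishes C n X B" "u \<in> Hom C B K" "v \<in> Hom C K B" "u \<odot> v = Id C K" "X \<in> Obj C"
    "n \<ge> 1"
  shows "Ext_vanishes C n X K"
proof -
  have o: "B \<in> Obj C" "K \<in> Obj C" using assms by (auto simp: Hom_iff)
  show ?thesis unfolding Ext_vanishes_iff [OF assms(5) o(2) assms(6)]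
  proof (intro allI impI)
    fix S assume S: "ses_chain X S K" "length S = n"
    then have "S \<noteq> []" using assms(6) by auto
    then obtain S' where S': "ses_chain X S' B" "length S' = length S" and
      univ: "\<forall>X' T Z g \<alpha>. ses_chain X' T Z \<longrightarrow> g \<in> Hom C B Z \<longrightarrow> chain_mor \<alpha> S T (g \<odot> v) \<longrightarrow> chain_mor \<alpha> S' T g"
      by (rule ses_chain_pushout [OF S(1) assms(3)])
    have "null_chain X S' B"
      using assms(1) S S' Ext_vanishes_iff [OF assms(5) o(1) assms(6)] by simp
    moreover have "chain_mor (Id C X) S' S u"
      using univ S(1) assms(2,4) chain_mor_Id [OF S(1)] by metis
    ultimately show "null_chain X S K" by (rule null_chain_mor [OF _ S'(1) S(1)])
  qed
qed

text \<open>
  A witness that \<open>S\<close> spliced with \<open>(k, g)\<close> is null restricts to a chain of length \<open>n\<close> that maps to \<open>S\<close>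
  through \<open>g\<close>; pushed out to \<open>Dom C g\<close>, it is null by assumption.
\<close>

lemma Ext_vanishes_shift:
  assumes "ses k g" "Ext_vanishes C n X (Dom C g)" "Ext_vanishes C (Suc n) X (Dom C k)"
    "X \<in> Obj C" "n \<ge> 1"
  shows "Ext_vanishes C n X (Cod C g)"
proof -
  note e = ses_simps [OF assms(1)]
  have o: "Dom C g \<in> Obj C" "Dom C k \<in> Obj C" "Cod C g \<in> Obj C" using e by auto
  show ?thesis unfolding Ext_vanishes_iff [OF assms(4) o(3) assms(5)]
  proof (intro allI impI)
    fix S assume S: "ses_chain X S (Cod C g)" "length S = n"
    have "ses_chain X (S @ [(k, g)]) (Dom C k)" using S assms(1) o by (auto simp: ses_chain_append)
    moreover have "length (S @ [(k, g)]) = Suc n" using S by simp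
    ultimately have "null_chain X (S @ [(k, g)]) (Dom C k)"
      using assms(3) Ext_vanishes_iff [OF assms(4) o(2), of "Suc n"] by simp
    then obtain P N where P: "ses_chain X P N"
      "chain_mor (Id C X) P (S @ [(k, g)]) (Zero C N (Dom C k))"
      by (auto simp: null_chain_def)
    have "length P = Suc n" using chain_mor_length [OF P(2)] S by simp
    then obtain A pk pf where A: "P = A @ [(pk, pf)]" "length A = length S"
      using S by (metis length_Suc_conv_rev surj_pair)
    obtain M where M: "ses_chain X A M" "ses pk pf" "Cod C pf = M" "Dom C pk = N" "N \<in> Obj C"
      using P(1) A ses_chain_Obj by (auto simp: ses_chain_append)
    note p = ses_simps [OF M(2)]
    obtain \<gamma> h where \<gamma>: "chain_mor (Id C X) A S \<gamma>" "\<gamma> \<in> Hom C M (Cod C g)"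
      "h \<in> Hom C (Dom C pf) (Dom C g)"
      "g \<odot> h = \<gamma> \<odot> pf" "h \<odot> pk = k \<odot> Zero C N (Dom C k)"
      using P(2) M unfolding A(1) chain_mor_append [OF A(2)] by auto
    have h: "h \<in> Arr C" "Dom C h = Dom C pf" "Cod C h = Dom C g" "\<gamma> \<in> Arr C" "Dom C \<gamma> = M"
      "Cod C \<gamma> = Cod C g"
      using \<gamma> by (simp_all add: Hom_iff)
    \<comment> \<open>\<open>h\<close> kills \<open>pk\<close> because the left component is zero;
      the induced \<open>u\<close> lifts \<open>\<gamma>\<close> through \<open>g\<close>.\<close>
    obtain u where u: "u \<in> Arr C" "Dom C u = Cod C pf" "Cod C u = Cod C h" "u \<odot> pf = h"
      by (rule is_cokernel_desc [OF p(8), of h]) (use \<gamma>(5) h p e M o in auto)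
    have gu: "g \<odot> u = \<gamma>"
      by (rule epi_arrD [OF p(6)]) (use \<gamma>(4) u h p e M in auto)
    have "A \<noteq> []" using A S assms(5) by auto
    moreover have "u \<in> Hom C M (Dom C g)" using u M h by (simp add: Hom_iff)
    \<comment> \<open>The morphism from \<open>A\<close> to \<open>S\<close> has left component
      \<open>g u\<close>, so it factors through the pushout of \<open>A\<close> along
      \<open>u\<close>, an extension by \<open>Dom C g\<close>.\<close>
    ultimately obtain Q where Q: "ses_chain X Q (Dom C g)" "length Q = length A" and
      univ: "\<forall>X' T Z g' \<alpha>. ses_chain X' T Z \<longrightarrow> g' \<in> Hom C (Dom C g) Z \<longrightarrow> chain_mor \<alpha> A T (g' \<odot> u) \<longrightarrow> chain_mor \<alpha> Q T g'"
      using ses_chain_pushout [OF M(1)] by metis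
    have "g \<in> Hom C (Dom C g) (Cod C g)" using e by (simp add: Hom_iff)
    then have "chain_mor (Id C X) Q S g" using univ S(1) \<gamma>(1) gu by blast
    moreover have "null_chain X Q (Dom C g)"
      using assms(2) Q A S Ext_vanishes_iff [OF assms(4) o(1) assms(5)] by simp
    ultimately show "null_chain X S (Cod C g)" using null_chain_mor [OF _ Q(1) S(1)] by blast
  qed
qed

text \<open>An extension of \<open>X\<close> is pulled back along \<open>p\<close> to
  \<open>M\<close>, where a null witness exists; that witness is pulled back along \<open>i\<close>,
  and \<open>p i\<close> is the identity.\<close>

lemma Ext_vanishes_summand:
  assumes "Ext_vanishes C n M Y" "p \<in> Hom C M X" "i \<in> Hom C X M" "p \<odot> i = Id C X" "Y \<in> Obj C"
    "n \<ge> 1"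
  shows "Ext_vanishes C n X Y"
proof -
  have o: "M \<in> Obj C" "X \<in> Obj C" using assms by (auto simp: Hom_iff)
  have iM: "Id C M \<in> Hom C M M" using o by (simp add: Hom_iff)
  show ?thesis unfolding Ext_vanishes_iff [OF o(2) assms(5,6)]
  proof (intro allI impI)
    fix S assume S: "ses_chain X S Y" "length S = n"
    then have "S \<noteq> []" using assms(6) by auto
    then obtain S' where S': "ses_chain M S' Y" "length S' = length S" "chain_mor p S' S (Id C Y)"
      by (rule ses_chain_pullback_ne [OF S(1) assms(2)])
    then have "null_chain M S' Y" using assms(1) S Ext_vanishes_iff [OF o(1) assms(5,6)] by simp
    then obtain P N where P: "ses_chain M P N" "chain_mor (Id C M) P S' (Zero C N Y)"
      by (auto simp: null_chain_def)
    have N: "N \<in> Obj C" using ses_chain_Obj P by blast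
    have "chain_mor (p \<odot> Id C M) P S (Id C Y \<odot> Zero C N Y)"
      by (rule chain_mor_comp [OF P(2) S'(3) P(1) S'(1) S(1) iM assms(2)])
    then have P': "chain_mor p P S (Zero C N Y)" using N assms(2,5) by (simp add: Hom_iff)
    obtain Q N' \<beta> where Q: "ses_chain X Q N'" "length Q = length P" "chain_mor i Q P \<beta>"
      "\<beta> \<in> Hom C N' N"
      by (rule ses_chain_pullback [OF P(1) assms(3)])
    have "chain_mor (p \<odot> i) Q S (Zero C N Y \<odot> \<beta>)"
      by (rule chain_mor_comp [OF Q(3) P' Q(1) P(1) S(1) assms(3,2)])
    then have "chain_mor (Id C X) Q S (Zero C N' Y)" using Q(4) assms(4,5) by (simp add: Hom_iff)
    then show "null_chain X S Y" using Q(1) unfolding null_chain_def by blast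
  qed
qed

text \<open>Each step to the left along the resolution raises the degree by one, until the last
  syzygy is \<open>Y\<close> itself in degree \<open>i + length S\<close>.\<close>

lemma Ext_vanishes_exs:
  assumes "ses_chain K S Y" "insert Y (Dom C ` snd ` set S) \<subseteq> \<B>"
    and "\<And>j B. \<lbrakk>i \<le> j; j \<le> i + length S; B \<in> \<B>\<rbrakk> \<Longrightarrow> Ext_vanishes C j X B"
    and "X \<in> Obj C" "i \<ge> 1"
  shows "Ext_vanishes C i X K"
  using assms(1-3,5)
proof (induction S arbitrary: K i)
  case Nil
  then show ?case by simp
next
  case (Cons e S)
  obtain k f where e: "e = (k, f)" by force
  have s: "ses k f" "Cod C f = K" "ses_chain (Dom C k) S Y" using Cons.prems e by auto
  have "Ext_vanishes C (Suc i) X (Dom C k)"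
    by (rule Cons.IH [OF s(3)]) (use Cons.prems in auto)
  moreover have "Ext_vanishes C i X (Dom C f)" using Cons.prems e by auto
  ultimately show ?case using Ext_vanishes_shift [OF s(1) _ _ assms(4)] s(2) Cons.prems(4) by blast
qed

lemma Ext_vanishes_resolution_class:
  assumes "K \<in> resolution_class C \<B> m" "X \<in> Obj C"
    and "\<And>j B. \<lbrakk>j \<in> {1..Suc m}; B \<in> \<B>\<rbrakk> \<Longrightarrow> Ext_vanishes C j X B"
  shows "Ext_vanishes C 1 X K"
proof -
  obtain l fs where fs: "K \<in> Obj C" "l \<le> m" "length fs = Suc l" "bounded_exact C fs"
    "Cod C (last fs) = K"
    "\<forall>f \<in> set fs. Dom C f \<in> \<B>"
    using assms(1) by (auto simp: resolution_class_def)
  show ?thesis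
  proof (cases "l = 0")
    \<comment> \<open>A resolution of length zero is a single isomorphism \<open>f\<close>, not an
      extension of positive degree; vanishing is carried from its source to \<open>K\<close> as a
      retract.\<close>
    case True
    then obtain f where f: "fs = [f]" using fs(3) by (auto simp: length_Suc_conv)
    obtain Z where Z: "zero_object C Z" "exact_seq C (Zero C Z (Dom C f) # [f] @ [Zero C K Z])"
      using fs(4,5) unfolding bounded_exact_def f by auto
    then have ch: "exact_chain (Zero C K Z) [f] (Zero C Z (Dom C f))"
      using exact_seq_iff_exact_chain [of _ "[f]"] by simp
    have "\<exists>g S. is_kernel C g (Zero C K Z) \<and> ses_chain (Dom C g) S (Dom C f) \<and>
      length [f] = Suc (length S) \<and> [f] = splice_rev g S"
      by (rule exact_chain_imp_splice [OF ch Z(1)]) simp_all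
    then obtain g S where g: "is_kernel C g (Zero C K Z)" "length [f] = Suc (length S)"
      "[f] = splice_rev g S"
      by blast
    have "S = []" using g(2) by simp
    then have fk: "is_kernel C f (Zero C K Z)" using g(1,3) by simp
    note f' = is_kernel_simps [OF fk] and Z' = zero_object_simps [OF Z(1)]
    obtain v where v: "v \<in> Arr C" "Dom C v = K" "Cod C v = Dom C f" "f \<odot> v = Id C K"
      by (rule is_kernel_lift [OF fk, of "Id C K"]) (use fs(1) Z' in auto)
    have "Ext_vanishes C 1 X (Dom C f)" using assms(3) fs(6) f by simp
    then show ?thesis
      by (rule Ext_vanishes_retract [of _ _ _ f _ v]) (use f' v fs(1) Z' assms(2) in \<open>auto simp: Hom_iff\<close>)
  next
    case False
    \<comment> \<open>A resolution of length \<open>l\<close> is an extension of degree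
      \<open>l\<close> of \<open>K\<close> by its leftmost term, so the cutting of extensions
      applies to it.\<close>
    have "fs \<in> extensions C l K (Dom C (hd fs))"
      using fs by (simp add: extensions_def)
    then obtain S where S: "ses_chain K S (Dom C (hd fs))" "length S = l" "fs = splice K S"
      using extensions_iff [of l] False by auto
    have "set fs = set (splice_rev (Id C K) S)" using S(3) by (simp add: splice_def)
    then have eq: "Dom C ` set fs = insert (Dom C (hd fs)) (Dom C ` snd ` set S)"
      using Dom_splice_rev [of "Id C K" S "Dom C (hd fs)"] S(1) fs(1) by simp
    have "insert (Dom C (hd fs)) (Dom C ` snd ` set S) \<subseteq> \<B>"
      unfolding eq [symmetric] using fs(6) by blast
    then show ?thesis
      by (rule Ext_vanishes_exs [OF S(1)]) (use S(2) fs(2) assms in auto)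
  qed
qed

section \<open>Splitting, lifting and cotorsion pairs\<close>

lemma bounded_exact_ses:
  assumes "bounded_exact C [k, f]" shows "ses k f"
proof -
  have "[k, f] \<in> extensions C 1 (Cod C f) (Dom C k)" using assms by (simp add: extensions_def)
  then obtain S where S: "ses_chain (Cod C f) S (Dom C k)" "length S = 1"
    "[k, f] = splice (Cod C f) S"
    using extensions_iff [of 1] by auto
  then obtain k' f' where "S = [(k', f')]"
    by (metis One_nat_def length_0_conv length_Suc_conv surj_pair)
  then show ?thesis using S ses_simps(1) [of k' f'] by (auto simp: splice_def)
qed

text \<open>\<open>Id - s f\<close> is killed by \<open>f\<close>, hence equals \<open>k r\<close>
  for some \<open>r\<close>, the missing projection. Listing \<open>Cod C f\<close> as first summand
  fits the form of \<open>closed_under_direct_summands\<close>.\<close>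

lemma section_biproduct:
  assumes "ses k f" "s \<in> Hom C (Cod C f) (Dom C f)" "f \<odot> s = Id C (Cod C f)"
  shows "\<exists>r. is_biproduct C (Cod C f) (Dom C k) (Dom C f) s k f r"
proof -
  note e = ses_simps [OF assms(1)]
  have s: "s \<in> Arr C" "Dom C s = Cod C f" "Cod C s = Dom C f" using assms by (auto simp: Hom_iff)
  define A where "A = Dom C f"
  have o: "A \<in> Obj C" "Dom C k \<in> Obj C" "Cod C f \<in> Obj C" "Dom C f = A"
    using e by (auto simp: A_def)
  define d where "d = Id C A \<oplus> neg (s \<odot> f)"
  have d: "d \<in> Arr C" "Dom C d = A" "Cod C d = A" using e s o by (simp_all add: d_def)
  have fsf: "f \<odot> (s \<odot> f) = f" using Comp_eq_reassoc [OF assms(3), of f] e s by simp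
  have "f \<odot> d = Zero C A (Cod C f)" using fsf e s o by (simp add: d_def)
  then obtain r where r: "r \<in> Arr C" "Dom C r = A" "Cod C r = Dom C k" "k \<odot> r = d"
    using is_kernel_lift [OF e(7), of d] d o by auto
  have "d \<odot> k = k" "d \<odot> s = Zero C (Cod C f) A" using e s o assms(3) by (simp_all add: d_def)
  then have "k \<odot> (r \<odot> k) = k" "k \<odot> (r \<odot> s) = Zero C (Cod C f) A"
    using Comp_eq_reassoc [OF r(4), of k] Comp_eq_reassoc [OF r(4), of s] r e s o by simp_all
  have "r \<odot> k = Id C (Dom C k)"
    by (rule mono_arrD [OF e(5)]) (use \<open>k \<odot> (r \<odot> k) = k\<close> r e s o in auto)
  moreover have "r \<odot> s = Zero C (Cod C f) (Dom C k)"
    by (rule mono_arrD [OF e(5)]) (use \<open>k \<odot> (r \<odot> s) = _\<close> r e s o in auto)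
  moreover have "s \<odot> f \<oplus> k \<odot> r = Id C A"
  proof -
    have "s \<odot> f \<oplus> d = d \<oplus> s \<odot> f"
      by (rule hom_ops(7) [of _ A A]) (use d e s o in \<open>auto simp: Hom_iff\<close>)
    also have "\<dots> = Id C A \<oplus> (neg (s \<odot> f) \<oplus> s \<odot> f)"
      unfolding d_def by (rule Add_assoc) (use e s o in auto)
    also have "\<dots> = Id C A" using e s o by simp
    finally show ?thesis using r by simp
  qed
  ultimately show ?thesis
    using r e s o assms(3) by (intro exI [of _ r]) (simp add: is_biproduct_def Hom_iff)
qed

lemma Ext_vanishes_1_section:
  assumes "Ext_vanishes C 1 (Cod C f) (Dom C k)" "ses k f"
  obtains s where "s \<in> Hom C (Cod C f) (Dom C f)" "f \<odot> s = Id C (Cod C f)"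
proof -
  note e = ses_simps(1,2) [OF assms(2)]
  have S: "ses_chain (Cod C f) [(k, f)] (Dom C k)" using assms(2) e by simp
  have "null_chain (Cod C f) [(k, f)] (Dom C k)"
    using assms(1) S Ext_vanishes_iff [of "Cod C f" "Dom C k" 1] e by simp
  then show ?thesis using null_chain_single [OF _ S] that by blast
qed

text \<open>The pullback of the sequence along \<open>g\<close> has the same kernel object and
  therefore splits; its section followed by \<open>b\<close> is the lift.\<close>

lemma Ext_vanishes_1_lift:
  assumes "Ext_vanishes C 1 A (Dom C k)" "ses k f" "g \<in> Hom C A (Cod C f)"
  obtains h where "h \<in> Hom C A (Dom C f)" "f \<odot> h = g"
proof -
  note e = ses_simps(1,2) [OF assms(2)]
  have g: "g \<in> Arr C" "Dom C g = A" "Cod C g = Cod C f" using assms by (auto simp: Hom_iff)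
  obtain k' a b where p: "ses k' a" "b \<in> Arr C" "Dom C b = Dom C a" "Cod C a = Dom C g"
    "Cod C b = Dom C f" "f \<odot> b = g \<odot> a" "Dom C k' = Dom C k"
    by (rule pullback_ses [OF assms(2) g(1,3)])
  have "Ext_vanishes C 1 (Cod C a) (Dom C k')" using assms(1) p g by simp
  then obtain s where s: "s \<in> Hom C (Cod C a) (Dom C a)" "a \<odot> s = Id C (Cod C a)"
    using Ext_vanishes_1_section p(1) by blast
  have s': "s \<in> Arr C" "Dom C s = A" "Cod C s = Dom C a" using s p g by (auto simp: Hom_iff)
  note a = ses_simps(1) [OF p(1)]
  have "f \<odot> (b \<odot> s) = g" using Comp_eq_reassoc [OF p(6), of s] s(2) s' p e a g by simp
  moreover have "b \<odot> s \<in> Hom C A (Dom C f)" using s' p by (simp add: Hom_iff)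
  ultimately show ?thesis using that by blast
qed

lemma closed_under_direct_summands_left_perp:
  assumes "\<B> \<subseteq> Obj C" "I \<subseteq> {1..}" "I \<noteq> {}"
  shows "closed_under_direct_summands C (\<Inter>i \<in> I. left_perp C i \<B>)"
  unfolding closed_under_direct_summands_def
proof (intro ballI allI impI INT_I)
  fix M X Y i j p q l
  assume M: "M \<in> (\<Inter>i \<in> I. left_perp C i \<B>)" and b: "is_biproduct C X Y M i j p q" and l: "l \<in> I"
  have "Ext_vanishes C l X B" if "B \<in> \<B>" for B
    by (rule Ext_vanishes_summand [of _ M _ p _ i])
      (use M l that assms is_biproduct_simps [OF b] in \<open>auto simp: left_perp_def Hom_iff\<close>)
  then show "X \<in> left_perp C l \<B>" using is_biproduct_simps [OF b] by (simp add: left_perp_def)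
qed

text \<open>The class of kernels is arbitrary so that one argument yields both the intersection
  formula for \<open>\<A>\<close> and its description as a first perpendicular class.\<close>

lemma approximation_splits:
  assumes "has_approximations C \<A> \<K>" "closed_under_direct_summands C \<A>" "X \<in> Obj C"
    and "\<And>K. K \<in> \<K> \<Longrightarrow> Ext_vanishes C 1 X K"
  shows "X \<in> \<A>"
proof -
  obtain K A k f where K: "K \<in> \<K>" "A \<in> \<A>" "k \<in> Hom C K A" "f \<in> Hom C A X" "bounded_exact C [k, f]"
    using assms(1,3) unfolding has_approximations_def by blast
  have kf: "ses k f" using bounded_exact_ses K by blast
  have d: "Cod C f = X" "Dom C f = A" "Dom C k = K" using K by (auto simp: Hom_iff)
  have "Ext_vanishes C 1 (Cod C f) (Dom C k)" using assms(4) K d by simp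
  then obtain s where "s \<in> Hom C (Cod C f) (Dom C f)" "f \<odot> s = Id C (Cod C f)"
    using Ext_vanishes_1_section kf by blast
  from section_biproduct [OF kf this] show ?thesis
    using assms(2) K(2) d unfolding closed_under_direct_summands_def by metis
qed

text \<open>From right to left the only condition not read off directly is closure under summands,
  which holds for perpendicular classes.\<close>

lemma left_n_cotorsion_pair_iff:
  assumes "n \<ge> 1" "\<A> \<subseteq> Obj C" "\<B> \<subseteq> Obj C"
  shows "left_n_cotorsion_pair C n \<A> \<B> \<longleftrightarrow>
      \<A> = (\<Inter>i \<in> {1..n}. left_perp C i \<B>) \<and>
      has_approximations C \<A> (resolution_class C \<B> (n - 1))"
proof
  assume l: "left_n_cotorsion_pair C n \<A> \<B>"
  then have ap: "has_approximations C \<A> (resolution_class C \<B> (n - 1))"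
    by (simp add: left_n_cotorsion_pair_def)
  moreover have "\<A> \<subseteq> (\<Inter>i \<in> {1..n}. left_perp C i \<B>)"
    using l assms(2) by (auto simp: left_n_cotorsion_pair_def left_perp_def)
  moreover have "X \<in> \<A>" if X: "X \<in> (\<Inter>i \<in> {1..n}. left_perp C i \<B>)" for X
  proof (rule approximation_splits [OF ap])
    show "closed_under_direct_summands C \<A>" using l by (simp add: left_n_cotorsion_pair_def)
    show o: "X \<in> Obj C" using X assms(1) by (auto simp: left_perp_def)
    show "Ext_vanishes C 1 X K" if "K \<in> resolution_class C \<B> (n - 1)" for K
      by (rule Ext_vanishes_resolution_class [OF that o]) (use X assms(1) in \<open>auto simp: left_perp_def\<close>)
  qed
  ultimately show "\<A> = (\<Inter>i \<in> {1..n}. left_perp C i \<B>) \<and>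
      has_approximations C \<A> (resolution_class C \<B> (n - 1))" by blast
next
  assume r: "\<A> = (\<Inter>i \<in> {1..n}. left_perp C i \<B>) \<and>
      has_approximations C \<A> (resolution_class C \<B> (n - 1))"
  have "closed_under_direct_summands C \<A>" unfolding conjunct1 [OF r]
    by (rule closed_under_direct_summands_left_perp) (use assms in auto)
  moreover have "\<forall>i \<in> {1..n}. \<forall>A \<in> \<A>. \<forall>B \<in> \<B>. Ext_vanishes C i A B"
    using r by (auto simp: left_perp_def)
  ultimately show "left_n_cotorsion_pair C n \<A> \<B>"
    unfolding left_n_cotorsion_pair_def using r by blast
qed

text \<open>Vanishing of \<open>Ext\<close> in degree 1 against the resolution class serves twice:
  it gives one inclusion of the perpendicular equation, and it lifts maps along approximations,
  which makes these precovers. The other inclusion comes from splitting.\<close>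

lemma left_n_cotorsion_pair_complete:
  assumes "left_n_cotorsion_pair C n \<A> \<B>" "n \<ge> 1" "\<A> \<subseteq> Obj C"
  shows "complete_left_cotorsion_pair C \<A> (resolution_class C \<B> (n - 1))"
proof -
  let ?K = "resolution_class C \<B> (n - 1)"
  have ap: "has_approximations C \<A> ?K" and cl: "closed_under_direct_summands C \<A>"
    using assms(1) by (simp_all add: left_n_cotorsion_pair_def)
  have v: "Ext_vanishes C 1 A K" if "A \<in> \<A>" "K \<in> ?K" for A K
    by (rule Ext_vanishes_resolution_class [OF that(2)])
      (use that assms in \<open>auto simp: left_n_cotorsion_pair_def\<close>)
  have "\<A> = left_perp C 1 ?K"
    using v assms(3) approximation_splits [OF ap cl] by (auto simp: left_perp_def)
  moreover have "\<exists>f k. precover C \<A> X f \<and> epi_arr C f \<and> is_kernel C k f \<and> Dom C k \<in> ?K"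
    if X: "X \<in> Obj C" for X
  proof -
    obtain K A k f where K: "K \<in> ?K" "A \<in> \<A>" "k \<in> Hom C K A" "f \<in> Hom C A X"
      "bounded_exact C [k, f]"
      using ap X unfolding has_approximations_def by blast
    have kf: "ses k f" using bounded_exact_ses K by blast
    have d: "f \<in> Arr C" "Cod C f = X" "Dom C f = A" "Dom C k = K" using K by (auto simp: Hom_iff)
    have "precover C \<A> X f"
      unfolding precover_def
    proof (intro conjI ballI)
      fix A' f' assume A': "A' \<in> \<A>" "f' \<in> Hom C A' X"
      have "Ext_vanishes C 1 A' (Dom C k)" using v A' K d by simp
      from Ext_vanishes_1_lift [OF this kf] A'(2) d
      show "\<exists>g \<in> Hom C A' (Dom C f). f \<odot> g = f'" by metis
    qed (use d K in auto)
    then show ?thesis using ses_simps(6,7) [OF kf] K(1) d by blast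
  qed
  ultimately show ?thesis unfolding complete_left_cotorsion_pair_def by blast
qed

end

theorem theorem2p7:
  fixes C :: "('o, 'm) ab_cat" and n :: nat and \<A> \<B> :: "'o set"
  assumes "abelian_category C"
    and "n \<ge> 1"
    and "\<A> \<subseteq> Obj C"
    and "\<B> \<subseteq> Obj C"
  shows "(left_n_cotorsion_pair C n \<A> \<B> \<longleftrightarrow>
      \<A> = (\<Inter>i \<in> {1..n}. left_perp C i \<B>) \<and>
      has_approximations C \<A> (resolution_class C \<B> (n - 1)))
    \<and> (left_n_cotorsion_pair C n \<A> \<B> \<or>
      (\<A> = (\<Inter>i \<in> {1..n}. left_perp C i \<B>) \<and>
       has_approximations C \<A> (resolution_class C \<B> (n - 1)))
      \<longrightarrow> complete_left_cotorsion_pair C \<A> (resolution_class C \<B> (n - 1)))"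
proof -
  interpret abelian_category C by fact
  show ?thesis
    using left_n_cotorsion_pair_iff [OF assms(2-4)] left_n_cotorsion_pair_complete [OF _ assms(2,3)] by blast
qed

end
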